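(* Let $K$ be an algebraically closed field of characteristic $2$. Consider $H(S_3,M^1)=\bigoplus_{m\ge0}H^m(S_3,M^1)$ as a right module over the cohomology ring $H(S_3,K)$ via the Yoneda product, with the $\mathrm{SL}(2,\mathbb Z)$-action induced from $M^1=M^1(O_1)\oplus M^1(O_2)\oplus M^1(O_3)$. The $H(S_3,K)$-module $H(S_3,M^1)$ is generated by $H^0(S_3,M^1)$. For the summands, we have: (1) $H(S_3,M^1(O_1))$ is free of rank $1$ over $H(S_3,K)$. The module action induces an $\mathrm{SL}(2,\mathbb Z)$-equivariant isomorphism $H^0(S_3,M^1(O_1))\otimes_K H(S_3,K)\to H(S_3,M^1(O_1))$. (2) $H(S_3,M^1(O_2))$ is free of rank $3$ over $H(S_3,K)$. The module action induces an $\mathrm{SL}(2,\mathbb Z)$-equivariant isomorphism $H^0(S_3,M^1(O_2))\otimes_K H(S_3,K)\to H(S_3,M^1(O_2))$. (3) $H(S_3,M^1(O_3))=H^0(S_3,M^1(O_3))\cong K[\mathbb P^1_3]$ (as an $\mathrm{SL}(2,\mathbb Z)$-module) is a trivial $H(S_3,K)$-module.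
   Context: For a $K[S_3]$-module $M$, $H^m(S_3,M)=\mathrm{Ext}^m_{K[S_3]}(K,M)$ and $H(S_3,M)=\bigoplus_{m\ge0}H^m(S_3,M)$; the latter is a graded right module over the graded algebra $H(S_3,K)=\mathrm{Ext}_{K[S_3]}(K,K)$ via the Yoneda product. A module over $H(S_3,K)$ is called trivial if $H(S_3,K)$ acts through the augmentation, i.e. the projection $H(S_3,K)\to H^0(S_3,K)=K$. $M^1$ is the vector space with basis $\Omega^1=\{(a,b)\in S_3\times S_3\mid ab=ba\}$ (identified with the set of homomorphisms from $\pi_1$ of the torus, free abelian with basis $\alpha_1,\beta_1$, to $S_3$, via the values at $\alpha_1$ and $\beta_1$). $S_3$ acts by $c.(a,b)=(cac^{-1},cbc^{-1})$. A matrix $A\in\mathrm{SL}(2,\mathbb Z)$ acts by $v\mapsto(A^T)^{-1}v$, where a matrix $\begin{pmatrix} p & q \\ r & s \end{pmatrix}$ sends a commuting pair $(a,b)$ to $(a^pb^q,a^rb^s)$. This commutes with $S_3$ and induces an $\mathrm{SL}(2,\mathbb Z)$-action on $H(S_3,M^1)$. $M^1(O_1)$, $M^1(O_2)$, $M^1(O_3)$ are the subspaces spanned by the pairs $(a,b)$ that generate the trivial subgroup, a subgroup of order $2$, and the alternating group $A_3$, respectively; they are invariant under both actions. On the tensor products in (1) and (2), $\mathrm{SL}(2,\mathbb Z)$ acts via the first factor. $\mathbb P^1_3$ is the set of one-dimensional subspaces of $\mathbb Z_3^2$, and $K[\mathbb P^1_3]$ is the corresponding permutation module of $\mathrm{SL}(2,\mathbb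 Z)$ (acting through its natural action on $\mathbb Z_3^2$). *)

theory Defs
  imports
    "HOL-Analysis.Determinants"
    "HOL-Algebra.Sym_Groups"
    "HOL-Algebra.Module"
    "HOL-Algebra.Algebraic_Closure_Type"
    "HOL-Library.Poly_Mapping"
    "HOL-Library.Numeral_Type"
begin

section \<open>Vector spaces\<close>

text \<open>
  The field $K$ is a type of class \<^class>\<open>field\<close>. A $K$-vector space is a record of type
  \<^typ>\<open>('k, 'v) module\<close>. Unless the record denotes an algebra, the fields \<^const>\<open>monoid.mult\<close> and
  \<^const>\<open>monoid.one\<close> carry no information.
\<close>

definition linear_map ::
  "('k, 'v, 'm) module_scheme \<Rightarrow> ('k, 'w, 'n) module_scheme \<Rightarrow> ('v \<Rightarrow> 'w) \<Rightarrow> bool" where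
  "linear_map V W f \<longleftrightarrow>
     f \<in> carrier V \<rightarrow> carrier W \<and>
     (\<forall>x\<in>carrier V. \<forall>y\<in>carrier V. f (x \<oplus>\<^bsub>V\<^esub> y) = f x \<oplus>\<^bsub>W\<^esub> f y) \<and>
     (\<forall>c. \<forall>x\<in>carrier V. f (c \<odot>\<^bsub>V\<^esub> x) = c \<odot>\<^bsub>W\<^esub> f x)"

definition linear_iso ::
  "('k, 'v, 'm) module_scheme \<Rightarrow> ('k, 'w, 'n) module_scheme \<Rightarrow> ('v \<Rightarrow> 'w) \<Rightarrow> bool" where
  "linear_iso V W f \<longleftrightarrow> linear_map V W f \<and> bij_betw f (carrier V) (carrier W)"

definition quotient_space ::
  "('k, 'v, 'm) module_scheme \<Rightarrow> 'v set \<Rightarrow> ('k, 'v set) module" where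
  "quotient_space V U =
     \<lparr>carrier = a_rcosets\<^bsub>V\<^esub> U, monoid.mult = undefined, monoid.one = undefined,
      ring.zero = U, add = set_add V,
      module.smult = (\<lambda>c A. \<Union>a\<in>A. U +>\<^bsub>V\<^esub> (c \<odot>\<^bsub>V\<^esub> a))\<rparr>"

definition direct_sum ::
  "(nat \<Rightarrow> ('k, 'v, 'm) module_scheme) \<Rightarrow> ('k, nat \<Rightarrow> 'v) module" where
  "direct_sum V =
     \<lparr>carrier = {x. (\<forall>n. x n \<in> carrier (V n)) \<and> finite {n. x n \<noteq> \<zero>\<^bsub>V n\<^esub>}},
      monoid.mult = undefined, monoid.one = undefined,
      ring.zero = (\<lambda>n. \<zero>\<^bsub>V n\<^esub>), add = (\<lambda>x y n. x n \<oplus>\<^bsub>V n\<^esub> y n),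
      module.smult = (\<lambda>c x n. c \<odot>\<^bsub>V n\<^esub> x n)\<rparr>"

definition in_degree ::
  "(nat \<Rightarrow> ('k, 'v, 'm) module_scheme) \<Rightarrow> nat \<Rightarrow> 'v \<Rightarrow> nat \<Rightarrow> 'v" where
  "in_degree V n v = (\<lambda>i. if i = n then v else \<zero>\<^bsub>V i\<^esub>)"

definition pm_scale :: "'k::field \<Rightarrow> ('x \<Rightarrow>\<^sub>0 'k) \<Rightarrow> ('x \<Rightarrow>\<^sub>0 'k)" where
  "pm_scale c p = Poly_Mapping.map ((*) c) p"

definition pm_extend :: "('x \<Rightarrow> ('y \<Rightarrow>\<^sub>0 'k::field)) \<Rightarrow> ('x \<Rightarrow>\<^sub>0 'k) \<Rightarrow> ('y \<Rightarrow>\<^sub>0 'k)" where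
  "pm_extend f p = (\<Sum>x\<in>Poly_Mapping.keys p. pm_scale (Poly_Mapping.lookup p x) (f x))"

definition pm_push :: "('x \<Rightarrow> 'y) \<Rightarrow> ('x \<Rightarrow>\<^sub>0 'k::field) \<Rightarrow> ('y \<Rightarrow>\<^sub>0 'k)" where
  "pm_push s = pm_extend (\<lambda>x. Poly_Mapping.single (s x) 1)"

definition free_space :: "'x set \<Rightarrow> ('k::field, 'x \<Rightarrow>\<^sub>0 'k) module" where
  "free_space B =
     \<lparr>carrier = {p. Poly_Mapping.keys p \<subseteq> B}, monoid.mult = undefined, monoid.one = undefined,
      ring.zero = 0, add = (\<lambda>x y. x + y), module.smult = pm_scale\<rparr>"


section \<open>Tensor products over $K$\<close>

definition tensor_relations ::
  "('k::field, 'u, 'm) module_scheme \<Rightarrow> ('k, 'v, 'n) module_scheme \<Rightarrow> ('u \<times> 'v \<Rightarrow>\<^sub>0 'k) set" where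
  "tensor_relations U V =
     {Poly_Mapping.single (u \<oplus>\<^bsub>U\<^esub> u', v) 1 - Poly_Mapping.single (u, v) 1
        - Poly_Mapping.single (u', v) 1 | u u' v. u \<in> carrier U \<and> u' \<in> carrier U \<and> v \<in> carrier V} \<union>
     {Poly_Mapping.single (u, v \<oplus>\<^bsub>V\<^esub> v') 1 - Poly_Mapping.single (u, v) 1
        - Poly_Mapping.single (u, v') 1 | u v v'. u \<in> carrier U \<and> v \<in> carrier V \<and> v' \<in> carrier V} \<union>
     {Poly_Mapping.single (c \<odot>\<^bsub>U\<^esub> u, v) 1 - Poly_Mapping.single (u, v) c
        | c u v. u \<in> carrier U \<and> v \<in> carrier V} \<union>
     {Poly_Mapping.single (u, c \<odot>\<^bsub>V\<^esub> v) 1 - Poly_Mapping.single (u, v) c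
        | c u v. u \<in> carrier U \<and> v \<in> carrier V}"

definition tensor_kernel ::
  "('k::field, 'u, 'm) module_scheme \<Rightarrow> ('k, 'v, 'n) module_scheme \<Rightarrow> ('u \<times> 'v \<Rightarrow>\<^sub>0 'k) set" where
  "tensor_kernel U V =
     (\<lambda>W. submodule W (ring_of_type_algebra :: 'k ring) (free_space (carrier U \<times> carrier V)))
       hull tensor_relations U V"

definition tensor_product ::
  "('k::field, 'u, 'm) module_scheme \<Rightarrow> ('k, 'v, 'n) module_scheme
    \<Rightarrow> ('k, ('u \<times> 'v \<Rightarrow>\<^sub>0 'k) set) module" where
  "tensor_product U V = quotient_space (free_space (carrier U \<times> carrier V)) (tensor_kernel U V)"

definition pure_tensor ::
  "('k::field, 'u, 'm) module_scheme \<Rightarrow> ('k, 'v, 'n) module_scheme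
    \<Rightarrow> 'u \<Rightarrow> 'v \<Rightarrow> ('u \<times> 'v \<Rightarrow>\<^sub>0 'k) set" where
  "pure_tensor U V u v =
     tensor_kernel U V +>\<^bsub>free_space (carrier U \<times> carrier V)\<^esub> Poly_Mapping.single (u, v) 1"

text \<open>$S \otimes T$ for endomorphisms $S$ of $U$ and $T$ of $V$\<close>
definition tensor_map ::
  "('k::field, 'u, 'm) module_scheme \<Rightarrow> ('k, 'v, 'n) module_scheme \<Rightarrow> ('u \<Rightarrow> 'u) \<Rightarrow> ('v \<Rightarrow> 'v)
    \<Rightarrow> ('u \<times> 'v \<Rightarrow>\<^sub>0 'k) set \<Rightarrow> ('u \<times> 'v \<Rightarrow>\<^sub>0 'k) set" where
  "tensor_map U V S T t =
     (\<Union>p\<in>t. tensor_kernel U V +>\<^bsub>free_space (carrier U \<times> carrier V)\<^esub> pm_push (map_prod S T) p)"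


section \<open>Right modules\<close>

definition right_module ::
  "('r, 'm) ring_scheme \<Rightarrow> ('v, 'n) ring_scheme \<Rightarrow> ('v \<Rightarrow> 'r \<Rightarrow> 'v) \<Rightarrow> bool" where
  "right_module R M a \<longleftrightarrow>
     ring R \<and> abelian_group M \<and>
     (\<forall>x\<in>carrier M. \<forall>r\<in>carrier R. a x r \<in> carrier M) \<and>
     (\<forall>x\<in>carrier M. \<forall>y\<in>carrier M. \<forall>r\<in>carrier R. a (x \<oplus>\<^bsub>M\<^esub> y) r = a x r \<oplus>\<^bsub>M\<^esub> a y r) \<and>
     (\<forall>x\<in>carrier M. \<forall>r\<in>carrier R. \<forall>s\<in>carrier R. a x (r \<oplus>\<^bsub>R\<^esub> s) = a x r \<oplus>\<^bsub>M\<^esub> a x s) \<and>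
     (\<forall>x\<in>carrier M. \<forall>r\<in>carrier R. \<forall>s\<in>carrier R. a x (r \<otimes>\<^bsub>R\<^esub> s) = a (a x r) s) \<and>
     (\<forall>x\<in>carrier M. a x \<one>\<^bsub>R\<^esub> = x)"

definition right_submodule ::
  "('r, 'm) ring_scheme \<Rightarrow> ('v, 'n) ring_scheme \<Rightarrow> ('v \<Rightarrow> 'r \<Rightarrow> 'v) \<Rightarrow> 'v set \<Rightarrow> bool" where
  "right_submodule R M a N \<longleftrightarrow>
     additive_subgroup N M \<and> (\<forall>x\<in>N. \<forall>r\<in>carrier R. a x r \<in> N)"

definition right_generated_by ::
  "('r, 'm) ring_scheme \<Rightarrow> ('v, 'n) ring_scheme \<Rightarrow> ('v \<Rightarrow> 'r \<Rightarrow> 'v) \<Rightarrow> 'v set \<Rightarrow> bool" where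
  "right_generated_by R M a B \<longleftrightarrow>
     B \<subseteq> carrier M \<and> right_submodule R M a hull B = carrier M"

definition right_free_of_rank ::
  "('r, 'm) ring_scheme \<Rightarrow> ('v, 'n) ring_scheme \<Rightarrow> ('v \<Rightarrow> 'r \<Rightarrow> 'v) \<Rightarrow> nat \<Rightarrow> bool" where
  "right_free_of_rank R M a n \<longleftrightarrow>
     right_module R M a \<and>
     (\<exists>b \<in> {..<n} \<rightarrow> carrier M. \<forall>x\<in>carrier M.
        \<exists>!r. r \<in> {..<n} \<rightarrow>\<^sub>E carrier R \<and> x = (\<Oplus>\<^bsub>M\<^esub>i\<in>{..<n}. a (b i) (r i)))"


section \<open>Modules over the group algebra\<close>

text \<open>
  A $K[G]$-module is a $K$-vector space on which $G$ acts by linear maps.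
\<close>

record ('k, 'v, 'g) gmodule = "('k, 'v) module" +
  gact :: "'g \<Rightarrow> 'v \<Rightarrow> 'v"

definition permutation_module ::
  "'x set \<Rightarrow> ('g \<Rightarrow> 'x \<Rightarrow> 'x) \<Rightarrow> ('k::field, 'x \<Rightarrow>\<^sub>0 'k, 'g) gmodule" where
  "permutation_module B s =
     \<lparr>carrier = {p. Poly_Mapping.keys p \<subseteq> B}, monoid.mult = undefined, monoid.one = undefined,
      ring.zero = 0, add = (\<lambda>x y. x + y), module.smult = pm_scale, gact = (\<lambda>g. pm_push (s g))\<rparr>"

definition trivial_module :: "('k::field, 'k, 'g) gmodule" where
  "trivial_module =
     \<lparr>carrier = UNIV, monoid.mult = undefined, monoid.one = undefined,
      ring.zero = 0, add = (\<lambda>x y. x + y), module.smult = (*), gact = (\<lambda>g x. x)\<rparr>"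

text \<open>
  The vector space $\mathrm{Hom}_{K[G]}(P, M)$. Maps are extensional, that is, \<^const>\<open>undefined\<close>
  outside the carrier of $P$.
\<close>

definition ghom_set ::
  "('g, 'l) monoid_scheme \<Rightarrow> ('k, 'p, 'g) gmodule \<Rightarrow> ('k, 'v, 'g) gmodule \<Rightarrow> ('p \<Rightarrow> 'v) set" where
  "ghom_set G P M =
     {f \<in> extensional (carrier P). linear_map P M f \<and>
        (\<forall>g\<in>carrier G. \<forall>x\<in>carrier P. f (gact P g x) = gact M g (f x))}"

definition ghom_space ::
  "('g, 'l) monoid_scheme \<Rightarrow> ('k, 'p, 'g) gmodule \<Rightarrow> ('k, 'v, 'g) gmodule
    \<Rightarrow> ('k, 'p \<Rightarrow> 'v) module" where
  "ghom_space G P M =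
     \<lparr>carrier = ghom_set G P M, monoid.mult = undefined, monoid.one = undefined,
      ring.zero = (\<lambda>x\<in>carrier P. \<zero>\<^bsub>M\<^esub>),
      add = (\<lambda>f h. \<lambda>x\<in>carrier P. f x \<oplus>\<^bsub>M\<^esub> h x),
      module.smult = (\<lambda>c f. \<lambda>x\<in>carrier P. c \<odot>\<^bsub>M\<^esub> f x)\<rparr>"


section \<open>Ext and the Yoneda product\<close>

text \<open>
  $\mathrm{Ext}_{K[G]}(K, M)$ is computed from the standard free resolution
  $\dots \to P_1 \to P_0 \to K \to 0$, where $P_n$ has the $K$-basis $G^{n+1}$ with diagonal
  action of $G$, and where
  $d(x_0, \dots, x_n) = \sum_i (-1)^i (x_0, \dots, \hat{x}_i, \dots, x_n)$.
\<close>

definition std_res ::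
  "('g, 'l) monoid_scheme \<Rightarrow> nat \<Rightarrow> ('k::field, 'g list \<Rightarrow>\<^sub>0 'k, 'g) gmodule" where
  "std_res G n =
     permutation_module {xs. length xs = Suc n \<and> set xs \<subseteq> carrier G} (\<lambda>g. map (\<lambda>x. g \<otimes>\<^bsub>G\<^esub> x))"

definition std_diff :: "('g list \<Rightarrow>\<^sub>0 'k::field) \<Rightarrow> ('g list \<Rightarrow>\<^sub>0 'k)" where
  "std_diff =
     pm_extend (\<lambda>xs. \<Sum>i<length xs. Poly_Mapping.single (take i xs @ drop (Suc i) xs) ((-1) ^ i))"

definition std_aug :: "('g list \<Rightarrow>\<^sub>0 'k::field) \<Rightarrow> 'k" where
  "std_aug p = (\<Sum>xs\<in>Poly_Mapping.keys p. Poly_Mapping.lookup p xs)"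

definition cochains ::
  "('g, 'l) monoid_scheme \<Rightarrow> ('k::field, 'v, 'g) gmodule \<Rightarrow> nat
    \<Rightarrow> ('k, ('g list \<Rightarrow>\<^sub>0 'k) \<Rightarrow> 'v) module" where
  "cochains G M n = ghom_space G (std_res G n) M"

definition cocycles ::
  "('g, 'l) monoid_scheme \<Rightarrow> ('k::field, 'v, 'g) gmodule \<Rightarrow> nat
    \<Rightarrow> (('g list \<Rightarrow>\<^sub>0 'k) \<Rightarrow> 'v) set" where
  "cocycles G M n =
     {f \<in> carrier (cochains G M n).
        compose (carrier (std_res G (Suc n))) f std_diff = \<zero>\<^bsub>cochains G M (Suc n)\<^esub>}"

definition coboundaries ::
  "('g, 'l) monoid_scheme \<Rightarrow> ('k::field, 'v, 'g) gmodule \<Rightarrow> nat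
    \<Rightarrow> (('g list \<Rightarrow>\<^sub>0 'k) \<Rightarrow> 'v) set" where
  "coboundaries G M n =
     (case n of
        0 \<Rightarrow> {\<zero>\<^bsub>cochains G M 0\<^esub>}
      | Suc m \<Rightarrow> (\<lambda>f. compose (carrier (std_res G n)) f std_diff) ` carrier (cochains G M m))"

definition Ext_class ::
  "('g, 'l) monoid_scheme \<Rightarrow> ('k::field, 'v, 'g) gmodule \<Rightarrow> nat
    \<Rightarrow> (('g list \<Rightarrow>\<^sub>0 'k) \<Rightarrow> 'v) \<Rightarrow> (('g list \<Rightarrow>\<^sub>0 'k) \<Rightarrow> 'v) set" where
  "Ext_class G M n f = coboundaries G M n +>\<^bsub>cochains G M n\<^esub> f"

text \<open>$H^n(G, M) = \mathrm{Ext}^n_{K[G]}(K, M)$\<close>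
definition Ext ::
  "('g, 'l) monoid_scheme \<Rightarrow> ('k::field, 'v, 'g) gmodule \<Rightarrow> nat
    \<Rightarrow> ('k, (('g list \<Rightarrow>\<^sub>0 'k) \<Rightarrow> 'v) set) module" where
  "Ext G M n =
     quotient_space ((cochains G M n)\<lparr>carrier := cocycles G M n\<rparr>) (coboundaries G M n)"

text \<open>
  \<open>chain_lift G n g \<phi>\<close>: the chain map $\varphi_k : P_{n+k} \to P_k$ lifts the cocycle
  $g : P_n \to K$.
\<close>
definition chain_lift ::
  "('g, 'l) monoid_scheme \<Rightarrow> nat \<Rightarrow> (('g list \<Rightarrow>\<^sub>0 'k::field) \<Rightarrow> 'k)
    \<Rightarrow> (nat \<Rightarrow> ('g list \<Rightarrow>\<^sub>0 'k) \<Rightarrow> ('g list \<Rightarrow>\<^sub>0 'k)) \<Rightarrow> bool" where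
  "chain_lift G n g \<phi> \<longleftrightarrow>
     (\<forall>k. \<phi> k \<in> ghom_set G (std_res G (n + k)) (std_res G k)) \<and>
     (\<forall>x\<in>carrier (std_res G n :: ('k, _, 'g) gmodule). std_aug (\<phi> 0 x) = g x) \<and>
     (\<forall>k. \<forall>x\<in>carrier (std_res G (n + Suc k) :: ('k, _, 'g) gmodule).
        std_diff (\<phi> (Suc k) x) = \<phi> k (std_diff x))"

text \<open>
  The Yoneda product $\mathrm{Ext}^m(K, M) \times \mathrm{Ext}^n(K, K) \to \mathrm{Ext}^{m+n}(K, M)$
  sends $([f], [g])$ to $[f \circ \varphi_m]$ for a lift $\varphi$ of $g$. Taking the union over all
  choices of $f$, $g$ and $\varphi$ yields a single class precisely because the product is well defined.
\<close>
definition yoneda ::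
  "('g, 'l) monoid_scheme \<Rightarrow> ('k::field, 'v, 'g) gmodule \<Rightarrow> nat \<Rightarrow> nat
    \<Rightarrow> (('g list \<Rightarrow>\<^sub>0 'k) \<Rightarrow> 'v) set \<Rightarrow> (('g list \<Rightarrow>\<^sub>0 'k) \<Rightarrow> 'k) set
    \<Rightarrow> (('g list \<Rightarrow>\<^sub>0 'k) \<Rightarrow> 'v) set" where
  "yoneda G M m n x y =
     (\<Union>f\<in>x. \<Union>g\<in>y. \<Union>\<phi>\<in>{\<phi>. chain_lift G n g \<phi>}.
        Ext_class G M (m + n) (compose (carrier (std_res G (m + n))) f (\<phi> m)))"

text \<open>$H(G, M)$ with the right action of $H(G, K)$\<close>

definition coh ::
  "('g, 'l) monoid_scheme \<Rightarrow> ('k::field, 'v, 'g) gmodule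
    \<Rightarrow> ('k, nat \<Rightarrow> (('g list \<Rightarrow>\<^sub>0 'k) \<Rightarrow> 'v) set) module" where
  "coh G M = direct_sum (Ext G M)"

definition coh_act ::
  "('g, 'l) monoid_scheme \<Rightarrow> ('k::field, 'v, 'g) gmodule
    \<Rightarrow> (nat \<Rightarrow> (('g list \<Rightarrow>\<^sub>0 'k) \<Rightarrow> 'v) set) \<Rightarrow> (nat \<Rightarrow> (('g list \<Rightarrow>\<^sub>0 'k) \<Rightarrow> 'k) set)
    \<Rightarrow> (nat \<Rightarrow> (('g list \<Rightarrow>\<^sub>0 'k) \<Rightarrow> 'v) set)" where
  "coh_act G M x h = (\<lambda>n. \<Oplus>\<^bsub>Ext G M n\<^esub>m\<in>{..n}. yoneda G M m (n - m) (x m) (h (n - m)))"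

definition Ext_one :: "('g, 'l) monoid_scheme \<Rightarrow> (('g list \<Rightarrow>\<^sub>0 'k::field) \<Rightarrow> 'k) set" where
  "Ext_one G =
     Ext_class G trivial_module 0
       (restrict std_aug (carrier (std_res G 0 :: ('k, 'g list \<Rightarrow>\<^sub>0 'k, 'g) gmodule)))"

definition coh_ring ::
  "('g, 'l) monoid_scheme \<Rightarrow> ('k::field, nat \<Rightarrow> (('g list \<Rightarrow>\<^sub>0 'k) \<Rightarrow> 'k) set) module" where
  "coh_ring G = (coh G trivial_module)
     \<lparr>monoid.mult := coh_act G trivial_module,
       monoid.one := in_degree (Ext G trivial_module) 0 (Ext_one G)\<rparr>"

text \<open>The projection $H(G, K) \to H^0(G, K) = K$\<close>
definition coh_aug ::
  "('g, 'l) monoid_scheme \<Rightarrow> (nat \<Rightarrow> (('g list \<Rightarrow>\<^sub>0 'k::field) \<Rightarrow> 'k) set) \<Rightarrow> 'k" where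
  "coh_aug G h = (THE c. h 0 = c \<odot>\<^bsub>Ext G trivial_module 0\<^esub> Ext_one G)"

definition trivial_coh_module ::
  "('g, 'l) monoid_scheme \<Rightarrow> ('k::field, 'v, 'g) gmodule \<Rightarrow> bool" where
  "trivial_coh_module G M \<longleftrightarrow>
     (\<forall>x\<in>carrier (coh G M). \<forall>h\<in>carrier (coh_ring G).
        coh_act G M x h = coh_aug G h \<odot>\<^bsub>coh G M\<^esub> x)"

definition coh_degree0 ::
  "('g, 'l) monoid_scheme \<Rightarrow> ('k::field, 'v, 'g) gmodule
    \<Rightarrow> (nat \<Rightarrow> (('g list \<Rightarrow>\<^sub>0 'k) \<Rightarrow> 'v) set) set" where
  "coh_degree0 G M = in_degree (Ext G M) 0 ` carrier (Ext G M 0)"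

text \<open>Maps induced by a $K[G]$-endomorphism $T$ of $M$\<close>

definition Ext_map ::
  "('g, 'l) monoid_scheme \<Rightarrow> ('k::field, 'v, 'g) gmodule \<Rightarrow> ('v \<Rightarrow> 'v) \<Rightarrow> nat
    \<Rightarrow> (('g list \<Rightarrow>\<^sub>0 'k) \<Rightarrow> 'v) set \<Rightarrow> (('g list \<Rightarrow>\<^sub>0 'k) \<Rightarrow> 'v) set" where
  "Ext_map G M T n x = (\<Union>f\<in>x. Ext_class G M n (compose (carrier (std_res G n)) T f))"

definition coh_map ::
  "('g, 'l) monoid_scheme \<Rightarrow> ('k::field, 'v, 'g) gmodule \<Rightarrow> ('v \<Rightarrow> 'v)
    \<Rightarrow> (nat \<Rightarrow> (('g list \<Rightarrow>\<^sub>0 'k) \<Rightarrow> 'v) set) \<Rightarrow> (nat \<Rightarrow> (('g list \<Rightarrow>\<^sub>0 'k) \<Rightarrow> 'v) set)" where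
  "coh_map G M T x = (\<lambda>n. Ext_map G M T n (x n))"


section \<open>Commuting pairs in the symmetric group\<close>

abbreviation S3 :: "(nat \<Rightarrow> nat) monoid" where
  "S3 \<equiv> sym_group 3"

type_synonym perm_pair = "(nat \<Rightarrow> nat) \<times> (nat \<Rightarrow> nat)"

definition Omega1 :: "perm_pair set" where
  "Omega1 = {(a, b). a \<in> carrier S3 \<and> b \<in> carrier S3 \<and> a \<otimes>\<^bsub>S3\<^esub> b = b \<otimes>\<^bsub>S3\<^esub> a}"

definition O1 :: "perm_pair set" where
  "O1 = {(a, b) \<in> Omega1. generate S3 {a, b} = {\<one>\<^bsub>S3\<^esub>}}"

definition O2 :: "perm_pair set" where
  "O2 = {(a, b) \<in> Omega1. card (generate S3 {a, b}) = 2}"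

definition O3 :: "perm_pair set" where
  "O3 = {(a, b) \<in> Omega1. generate S3 {a, b} = carrier (alt_group 3)}"

definition conj_pair :: "(nat \<Rightarrow> nat) \<Rightarrow> perm_pair \<Rightarrow> perm_pair" where
  "conj_pair c = (\<lambda>(a, b).
     (c \<otimes>\<^bsub>S3\<^esub> a \<otimes>\<^bsub>S3\<^esub> inv\<^bsub>S3\<^esub> c, c \<otimes>\<^bsub>S3\<^esub> b \<otimes>\<^bsub>S3\<^esub> inv\<^bsub>S3\<^esub> c))"

text \<open>$M^1(B)$ for a conjugation-invariant set $B$ of commuting pairs; $M^1 = M^1(\Omega^1)$\<close>
definition M1 :: "perm_pair set \<Rightarrow> ('k::field, perm_pair \<Rightarrow>\<^sub>0 'k, nat \<Rightarrow> nat) gmodule" where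
  "M1 B = permutation_module B conj_pair"

definition SL2Z :: "(int^2^2) set" where
  "SL2Z = {A. det A = 1}"

definition matrix_pair :: "int^2^2 \<Rightarrow> perm_pair \<Rightarrow> perm_pair" where
  "matrix_pair A = (\<lambda>(a, b).
     (a [^]\<^bsub>S3\<^esub> (A$1$1) \<otimes>\<^bsub>S3\<^esub> b [^]\<^bsub>S3\<^esub> (A$1$2),
      a [^]\<^bsub>S3\<^esub> (A$2$1) \<otimes>\<^bsub>S3\<^esub> b [^]\<^bsub>S3\<^esub> (A$2$2)))"

definition sl2_act :: "int^2^2 \<Rightarrow> (perm_pair \<Rightarrow>\<^sub>0 'k::field) \<Rightarrow> (perm_pair \<Rightarrow>\<^sub>0 'k)" where
  "sl2_act A = pm_push (matrix_pair (matrix_inv (transpose A)))"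

text \<open>
  The type \<^typ>\<open>3\<close> is the ring $\mathbb{Z}_3$; in \<^typ>\<open>3^2\<close> the $3$ is this ring and the $2$ the
  index set.
\<close>

definition P13 :: "(3^2) set set" where
  "P13 = {L. \<exists>v. v \<noteq> 0 \<and> L = {c *s v | c. True}}"

definition line_act :: "int^2^2 \<Rightarrow> (3^2) set \<Rightarrow> (3^2) set" where
  "line_act A L = (\<lambda>v. (\<chi> i j. of_int (A$i$j)) *v v) ` L"

definition KP13 :: "('k::field, (3^2) set \<Rightarrow>\<^sub>0 'k, int^2^2) gmodule" where
  "KP13 = permutation_module P13 line_act"

text \<open>
  The module action induces an $\mathrm{SL}(2, \mathbb{Z})$-equivariant isomorphism of right
  $H(S_3, K)$-modules $H^0(S_3, M) \otimes_K H(S_3, K) \to H(S_3, M)$, where $M = M^1(B)$.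
\<close>
definition action_iso :: "('k::field, perm_pair \<Rightarrow>\<^sub>0 'k, nat \<Rightarrow> nat) gmodule \<Rightarrow> bool" where
  "action_iso M \<longleftrightarrow>
     (\<exists>\<Phi>. linear_iso (tensor_product (Ext S3 M 0) (coh_ring S3)) (coh S3 M) \<Phi> \<and>
        (\<forall>u\<in>carrier (Ext S3 M 0). \<forall>h\<in>carrier (coh_ring S3).
           \<Phi> (pure_tensor (Ext S3 M 0) (coh_ring S3) u h)
             = coh_act S3 M (in_degree (Ext S3 M) 0 u) h) \<and>
        (\<forall>u\<in>carrier (Ext S3 M 0). \<forall>h\<in>carrier (coh_ring S3). \<forall>h'\<in>carrier (coh_ring S3).
           \<Phi> (pure_tensor (Ext S3 M 0) (coh_ring S3) u (h \<otimes>\<^bsub>coh_ring S3\<^esub> h'))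
             = coh_act S3 M (\<Phi> (pure_tensor (Ext S3 M 0) (coh_ring S3) u h)) h') \<and>
        (\<forall>A\<in>SL2Z. \<forall>t\<in>carrier (tensor_product (Ext S3 M 0) (coh_ring S3)).
           \<Phi> (tensor_map (Ext S3 M 0) (coh_ring S3) (Ext_map S3 M (sl2_act A) 0) id t)
             = coh_map S3 M (sl2_act A) (\<Phi> t)))"

end

theory Submission
  imports Defs "HOL-Library.Function_Algebras"
begin

text \<open>
  Everything is computed on representatives. A cochain is an equivariant function on tuples of group
  elements, and in this description the Yoneda product is the cup product
  \<open>(F \<smile> h) (x\<^sub>0, \<dots>, x\<^sub>m\<^sub>+\<^sub>n) = F (x\<^sub>0, \<dots>, x\<^sub>m) h (x\<^sub>m, \<dots>, x\<^sub>m\<^sub>+\<^sub>n)\<close>: front faces define one lift of the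
  cocycle \<open>h\<close> to a chain map, and the class of the product does not depend on the lift since the
  standard resolution is contractible (\<open>yoneda_cls\<close>). The ring and module axioms are thereby reduced
  to the associativity of the cup product and the Leibniz rule.

  The structure of the cohomology comes from a decomposition of the identity of \<open>M = M\<^sup>1\<close> into
  \<open>\<Sum>\<^sub>i p\<^sub>i(_) u\<^sub>i\<close>, with invariants \<open>u\<^sub>i\<close> and invariant functionals \<open>p\<^sub>i\<close>, and the trace
  \<open>\<Sum>\<^sub>g g t g\<^sup>-\<^sup>1\<close> of a linear map \<open>t\<close>. The trace induces zero in positive degrees, by an explicit
  homotopy (\<open>cobd_trace_homotopy\<close>), so that a cocycle \<open>F\<close> of positive degree is cohomologous to
  \<open>\<Sum>\<^sub>i u\<^sub>i \<cdot> p\<^sub>i(F)\<close>. Hence the cohomology is generated in degree \<open>0\<close>. If the \<open>u\<^sub>i\<close> span the invariants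
  and \<open>p\<^sub>i(u\<^sub>j) = \<delta>\<^sub>i\<^sub>j\<close>, it is free on the classes of the \<open>u\<^sub>i\<close>, because the \<open>p\<^sub>i\<close> recover the
  coefficients. Nothing needs to be known about the ring \<open>H(S\<^sub>3, K)\<close> itself.

  In characteristic \<open>2\<close> such a decomposition exists with orbit sums \<open>u\<^sub>i\<close> and sums \<open>p\<^sub>i\<close> of coefficients
  over orbits (\<open>trace_kernel_trace\<close>). For the trivial pair \<open>t = 0\<close> will do. The pairs that generate a
  subgroup of order two form three copies of the set of transpositions, on which \<open>S\<^sub>3\<close> acts doubly
  transitively; the trace of a matrix unit off the diagonal is the identity plus the all-one matrix,
  and the latter is \<open>p\<^sub>i(_) u\<^sub>i\<close>. On the pairs that generate \<open>A\<^sub>3\<close>, stabilizers have the odd order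
  three, and the identity is the trace of the projection onto orbit representatives; no \<open>u\<^sub>i\<close> occurs,
  so that the cohomology is concentrated in degree \<open>0\<close>, where it consists of the invariants.

  The isomorphism with \<open>H\<^sup>0(S\<^sub>3, M) \<otimes> H(S\<^sub>3, K)\<close> follows from the unique expansion in the \<open>u\<^sub>i\<close>, by
  which the relations of the tensor product generate the kernel of the action map. Finally, pairs that
  generate \<open>A\<^sub>3\<close> are the nonzero vectors of \<open>\<int>\<^sub>3\<^sup>2\<close>, and \<open>S\<^sub>3\<close> acts on them through the signs, so that
  the invariants are the functions on the set of lines.
\<close>

section \<open>Linear extension of maps on a basis\<close>

abbreviation "keys \<equiv> Poly_Mapping.keys"
abbreviation "single \<equiv> Poly_Mapping.single"
abbreviation "lookup \<equiv> Poly_Mapping.lookup"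

definition lin :: "('k::field \<Rightarrow> 'v \<Rightarrow> 'v::ab_group_add) \<Rightarrow> ('x \<Rightarrow> 'v) \<Rightarrow> ('x \<Rightarrow>\<^sub>0 'k) \<Rightarrow> 'v" where
  "lin s F p = (\<Sum>x\<in>keys p. s (lookup p x) (F x))"

lemma lookup_pm_scale [simp]:
  "lookup (pm_scale c p) x = c * lookup p x"
  unfolding pm_scale_def by (simp add: Poly_Mapping.map.rep_eq when_def)

lemma vector_space_pm_scale: "vector_space (pm_scale :: 'k::field \<Rightarrow> ('x \<Rightarrow>\<^sub>0 'k) \<Rightarrow> _)"
  by unfold_locales (auto intro!: poly_mapping_eqI simp: lookup_add algebra_simps)

lemma vector_space_mult: "vector_space ((*) :: 'k::field \<Rightarrow> 'k \<Rightarrow> 'k)"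
  by unfold_locales (auto simp: algebra_simps)

lemma vector_space_fun:
  assumes "vector_space s"
  shows "vector_space (\<lambda>c (F :: 'x \<Rightarrow> 'v::ab_group_add) x. s c (F x))"
proof -
  interpret vector_space s by fact
  show ?thesis
    by unfold_locales (auto simp: fun_eq_iff scale_right_distrib scale_left_distrib)
qed

lemma pm_extend_eq_lin: "pm_extend = lin pm_scale"
  by (simp add: fun_eq_iff pm_extend_def lin_def)

lemma keys_pm_scale: "keys (pm_scale c p) \<subseteq> keys p"
  by (auto simp: in_keys_iff)

lemma pm_scale_single [simp]:
  "pm_scale c (single x d) = single x (c * d)"
  by (rule poly_mapping_eqI) (simp add: lookup_single when_def)

context vector_space
begin

lemma lin_superset:
  assumes "finite A" "keys p \<subseteq> A"
  shows "lin scale F p = (\<Sum>x\<in>A. scale (lookup p x) (F x))"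
  unfolding lin_def using assms
  by (intro sum.mono_neutral_left) (auto simp: in_keys_iff)

lemma lin_zero [simp]: "lin scale F 0 = 0"
  by (simp add: lin_def)

lemma lin_add: "lin scale F (p + q) = lin scale F p + lin scale F q"
proof -
  let ?A = "keys p \<union> keys q"
  have "keys (p + q) \<subseteq> ?A"
    by (rule Poly_Mapping.keys_add)
  then show ?thesis
    by (simp add: lin_superset[of ?A] lookup_add scale_left_distrib sum.distrib)
qed

lemma lin_scale: "lin scale F (pm_scale c p) = scale c (lin scale F p)"
proof -
  have "lin scale F (pm_scale c p)
      = (\<Sum>x\<in>keys p. scale (lookup (pm_scale c p) x) (F x))"
    by (rule lin_superset[OF _ keys_pm_scale]) simp
  then show ?thesis
    by (simp add: lin_def scale_sum_right)
qed

lemma lin_single [simp]: "lin scale F (single x c) = scale c (F x)"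
  using lin_superset[of "{x}" "single x c" F] by simp

lemma lin_uminus: "lin scale F (- p) = - lin scale F p"
  using lin_add[of F p "- p"] by (simp add: eq_neg_iff_add_eq_0 add.commute)

lemma lin_diff: "lin scale F (p - q) = lin scale F p - lin scale F q"
  using lin_add[of F p "- q"] by (simp add: lin_uminus)

lemma lin_sum: "lin scale F (sum f A) = (\<Sum>a\<in>A. lin scale F (f a))"
  by (induction A rule: infinite_finite_induct) (auto simp: lin_add)

lemma lin_fun_add: "lin scale (\<lambda>x. F x + H x) p = lin scale F p + lin scale H p"
  by (simp add: lin_def scale_right_distrib sum.distrib)

lemma lin_fun_diff: "lin scale (\<lambda>x. F x - H x) p = lin scale F p - lin scale H p"
  by (simp add: lin_def scale_right_diff_distrib sum_subtractf)

lemma lin_fun_scale: "lin scale (\<lambda>x. scale c (F x)) p = scale c (lin scale F p)"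
  by (simp add: lin_def scale_sum_right mult.commute)

lemma lin_cong: "(\<And>x. x \<in> keys p \<Longrightarrow> F x = H x) \<Longrightarrow> lin scale F p = lin scale H p"
  by (simp add: lin_def)

lemma lin_closed:
  assumes "0 \<in> C" "\<And>a b. a \<in> C \<Longrightarrow> b \<in> C \<Longrightarrow> a + b \<in> C" "\<And>c a. a \<in> C \<Longrightarrow> scale c a \<in> C"
    and "\<And>x. x \<in> keys p \<Longrightarrow> F x \<in> C"
  shows "lin scale F p \<in> C"
proof -
  have "(\<Sum>x\<in>A. scale (lookup p x) (F x)) \<in> C"
    if "finite A" "A \<subseteq> keys p" for A
    using that by (induction A rule: finite_induct) (auto intro: assms)
  then show ?thesis
    unfolding lin_def by simp
qed

end

lemma linear_lin:
  assumes "vector_space s" "vector_space s'"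
    and "\<And>a b. L (a + b) = L a + L b" "\<And>c a. L (s c a) = s' c (L a)"
  shows "L (lin s F p) = lin s' (\<lambda>x. L (F x)) p"
proof -
  have "L 0 = 0" using assms(3)[of 0 0] by simp
  then have "L (\<Sum>x\<in>A. s (lookup p x) (F x)) =
      (\<Sum>x\<in>A. s' (lookup p x) (L (F x)))" for A
    by (induction A rule: infinite_finite_induct) (auto simp: assms)
  then show ?thesis by (simp add: lin_def)
qed

lemma lin_lin:
  assumes "vector_space s"
  shows "lin s F (lin pm_scale H p) = lin s (\<lambda>x. lin s F (H x)) p"
proof -
  interpret vector_space s by fact
  show ?thesis
    by (rule linear_lin[OF vector_space_pm_scale assms]) (auto simp: lin_add lin_scale)
qed

interpretation pm: vector_space pm_scale by (rule vector_space_pm_scale)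

lemma lin_pm_single [simp]: "lin pm_scale (\<lambda>x. single x 1) p = p"
proof (rule poly_mapping_eqI)
  fix y
  show "lookup (lin pm_scale (\<lambda>x. single x 1) p) y
      = lookup p y"
    by (auto simp: lin_def lookup_sum lookup_single when_def in_keys_iff if_distrib cong: if_cong)
qed

text \<open>
  Cochains are linear on their carrier only, so that linearity is assumed just on the span of \<open>B\<close>.
\<close>
lemma linear_on_eq_lin:
  assumes s: "vector_space s"
    and add: "\<And>p q. keys p \<subseteq> B \<Longrightarrow> keys q \<subseteq> B \<Longrightarrow> L (p + q) = L p + L q"
    and scale: "\<And>c p. keys p \<subseteq> B \<Longrightarrow> L (pm_scale c p) = s c (L p)"
    and p: "keys p \<subseteq> B"
  shows "L p = lin s (\<lambda>x. L (single x 1)) p"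
proof -
  interpret vector_space s by fact
  have L0: "L 0 = 0" using add[of 0 0] by simp
  let ?t = "\<lambda>x. pm_scale (lookup p x) (single x 1)"
  have "keys (sum ?t A) \<subseteq> B \<and> L (sum ?t A) =
      (\<Sum>x\<in>A. s (lookup p x) (L (single x 1)))"
    if "finite A" "A \<subseteq> keys p" for A
    using that
  proof (induction A rule: finite_induct)
    case (insert x A)
    have x: "x \<in> B" using insert.prems p by auto
    have k: "keys (sum ?t A) \<subseteq> B" "keys (?t x) \<subseteq> B"
      using insert x by (auto simp: in_keys_iff lookup_single when_def split: if_splits)
    have "L (?t x + sum ?t A) = L (?t x) + L (sum ?t A)"
      by (rule add[OF k(2,1)])
    moreover have "L (?t x) = s (lookup p x) (L (single x 1))"
      using x by (intro scale) auto
    moreover have "keys (?t x + sum ?t A) \<subseteq> B"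
      using Poly_Mapping.keys_add[of "?t x" "sum ?t A"] k by blast
    ultimately show ?case using insert by (simp del: pm_scale_single)
  qed (use L0 in auto)
  from this[of "keys p"] lin_pm_single[of p] show ?thesis
    by (simp add: lin_def del: lin_pm_single)
qed

lemma pm_push_eq_lin: "pm_push f p = lin pm_scale (\<lambda>x. single (f x) 1) p"
  by (simp add: pm_push_def pm_extend_eq_lin)

lemma pm_push_add: "pm_push f (p + q) = pm_push f p + pm_push f q"
  by (simp add: pm_push_eq_lin pm.lin_add)

lemma pm_push_scale: "pm_push f (pm_scale c p) = pm_scale c (pm_push f p)"
  by (simp add: pm_push_eq_lin pm.lin_scale)

lemma pm_push_single [simp]: "pm_push f (single x c) = single (f x) c"
  by (simp add: pm_push_eq_lin)

lemma pm_push_zero [simp]: "pm_push f 0 = 0"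
  by (simp add: pm_push_eq_lin)

lemma lin_pm_push:
  assumes "vector_space s"
  shows "lin s F (pm_push f p) = lin s (\<lambda>x. F (f x)) p"
proof -
  interpret vector_space s by fact
  show ?thesis by (simp add: pm_push_eq_lin lin_lin[OF assms])
qed

lemma pm_push_push: "pm_push f (pm_push h p) = pm_push (\<lambda>x. f (h x)) p"
  by (simp add: pm_push_eq_lin lin_lin[OF vector_space_pm_scale])

lemma keys_pm_push: "keys (pm_push f p) \<subseteq> f ` keys p"
proof -
  have "pm_push f p \<in> {q. keys q \<subseteq> f ` keys p}"
    unfolding pm_push_eq_lin
    by (rule pm.lin_closed)
      (auto dest!: subsetD[OF Poly_Mapping.keys_add] subsetD[OF keys_pm_scale])
  then show ?thesis by simp
qed

lemma lookup_pm_push: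
  assumes "inj_on f B" "keys p \<subseteq> B" "x \<in> B"
  shows "lookup (pm_push f p) (f x) = lookup p x"
proof -
  have "lookup (pm_push f p) (f x)
      = (\<Sum>y\<in>keys p. if y = x then lookup p y else 0)"
    unfolding pm_push_eq_lin lin_def lookup_sum
    using assms by (intro sum.cong) (auto simp: lookup_single when_def inj_on_def)
  then show ?thesis by (auto simp: in_keys_iff)
qed

section \<open>Vector spaces as records and their quotients\<close>

abbreviation kspace :: "('k::field, 'v, 'm) module_scheme \<Rightarrow> bool" where
  "kspace V \<equiv> Module.module (ring_of_type_algebra :: 'k ring) V"

lemma ring_of_type_algebra_simps [simp]:
  "carrier (ring_of_type_algebra :: 'k::field ring) = UNIV"
  "x \<oplus>\<^bsub>ring_of_type_algebra\<^esub> y = x + (y :: 'k)"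
  "x \<otimes>\<^bsub>ring_of_type_algebra\<^esub> y = x * (y :: 'k)"
  "\<one>\<^bsub>ring_of_type_algebra\<^esub> = (1 :: 'k)"
  "\<zero>\<^bsub>ring_of_type_algebra\<^esub> = (0 :: 'k)"
  by (simp_all add: ring_of_type_algebra_def)

text \<open>
  Cochains are restricted functions and cohomology classes are families of cosets. Their vector
  space axioms are therefore checked on representatives, which live in a type with pointwise
  operations, and transported along the map \<open>q\<close> from representatives to elements.
\<close>
lemma kspace_presentation:
  fixes q :: "'a::ab_group_add \<Rightarrow> 'w" and W :: "('k::field, 'w, 'm) module_scheme"
  assumes s: "vector_space s"
    and Z: "0 \<in> Z" "\<And>a b. a \<in> Z \<Longrightarrow> b \<in> Z \<Longrightarrow> a + b \<in> Z" "\<And>c a. a \<in> Z \<Longrightarrow> s c a \<in> Z"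
    and carrier: "carrier W = q ` Z"
    and zero: "\<zero>\<^bsub>W\<^esub> = q 0"
    and add: "\<And>a b. a \<in> Z \<Longrightarrow> b \<in> Z \<Longrightarrow> q a \<oplus>\<^bsub>W\<^esub> q b = q (a + b)"
    and smult: "\<And>c a. a \<in> Z \<Longrightarrow> c \<odot>\<^bsub>W\<^esub> q a = q (s c a)"
  shows "kspace W"
proof -
  interpret vector_space s by fact
  have neg: "- a \<in> Z" if "a \<in> Z" for a
    using Z(3)[OF that, of "-1"] by simp
  have "abelian_group W"
  proof (rule abelian_groupI)
    fix x assume "x \<in> carrier W"
    then obtain a where a: "a \<in> Z" "x = q a" by (auto simp: carrier)
    then show "\<exists>y\<in>carrier W. y \<oplus>\<^bsub>W\<^esub> x = \<zero>\<^bsub>W\<^esub>"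
      using neg[OF a(1)] by (intro bexI[of _ "q (- a)"]) (auto simp: carrier add zero)
  qed (auto simp: carrier zero add Z ac_simps)
  then show ?thesis
    by (intro moduleI cring_from_type_algebra) (auto simp: carrier zero add smult Z scale_right_distrib scale_left_distrib)
qed

text \<open>
  The operations of \<^const>\<open>quotient_space\<close> are unions over cosets; the point of this locale is that
  they can be computed on representatives.
\<close>
locale quotient_of_space =
  fixes V :: "('k::field, 'v, 'm) module_scheme" and U :: "'v set"
  assumes space: "kspace V" and subspace: "submodule U (ring_of_type_algebra :: 'k ring) V"
begin

sublocale V: Module.module "ring_of_type_algebra :: 'k ring" V by (rule space)
sublocale U: submodule U "ring_of_type_algebra :: 'k ring" V by (rule subspace)

lemma U_carrier: "u \<in> U \<Longrightarrow> u \<in> carrier V"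
  using U.subset by auto

lemma U_closed: "\<zero>\<^bsub>V\<^esub> \<in> U" "u \<in> U \<Longrightarrow> v \<in> U \<Longrightarrow> u \<oplus>\<^bsub>V\<^esub> v \<in> U" "u \<in> U \<Longrightarrow> c \<odot>\<^bsub>V\<^esub> u \<in> U"
  "u \<in> U \<Longrightarrow> \<ominus>\<^bsub>V\<^esub> u \<in> U"
  using U.one_closed U.m_closed U.smult_closed U.m_inv_closed by (auto simp: a_inv_def)

lemma mem_coset: "x \<in> U +>\<^bsub>V\<^esub> a \<longleftrightarrow> (\<exists>u\<in>U. x = u \<oplus>\<^bsub>V\<^esub> a)"
  by (auto simp: a_r_coset_def')

lemma coset_eqI:
  assumes "a \<in> carrier V" "b \<in> carrier V" "u \<in> U" "a = u \<oplus>\<^bsub>V\<^esub> b"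
  shows "U +>\<^bsub>V\<^esub> a = U +>\<^bsub>V\<^esub> b"
proof (rule Set.set_eqI)
  fix x
  have u: "u \<in> carrier V" "\<ominus>\<^bsub>V\<^esub> u \<in> carrier V" using assms U_carrier by auto
  have b: "b = \<ominus>\<^bsub>V\<^esub> u \<oplus>\<^bsub>V\<^esub> a"
    using assms u by (simp add: V.M.add.m_assoc[symmetric] V.M.l_neg)
  show "x \<in> U +>\<^bsub>V\<^esub> a \<longleftrightarrow> x \<in> U +>\<^bsub>V\<^esub> b"
  proof
    assume "x \<in> U +>\<^bsub>V\<^esub> a"
    then obtain w where w: "w \<in> U" "x = w \<oplus>\<^bsub>V\<^esub> a" by (auto simp: mem_coset)
    then have "x = (w \<oplus>\<^bsub>V\<^esub> u) \<oplus>\<^bsub>V\<^esub> b"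
      using assms u U_carrier by (simp add: V.M.add.m_assoc)
    then show "x \<in> U +>\<^bsub>V\<^esub> b" using w assms(3) U_closed by (auto simp: mem_coset)
  next
    assume "x \<in> U +>\<^bsub>V\<^esub> b"
    then obtain w where w: "w \<in> U" "x = w \<oplus>\<^bsub>V\<^esub> b" by (auto simp: mem_coset)
    have "(w \<oplus>\<^bsub>V\<^esub> \<ominus>\<^bsub>V\<^esub> u) \<oplus>\<^bsub>V\<^esub> a = w \<oplus>\<^bsub>V\<^esub> (\<ominus>\<^bsub>V\<^esub> u \<oplus>\<^bsub>V\<^esub> a)"
      using w(1) assms(1) u U_carrier by (simp add: V.M.add.m_assoc)
    then have "x = (w \<oplus>\<^bsub>V\<^esub> \<ominus>\<^bsub>V\<^esub> u) \<oplus>\<^bsub>V\<^esub> a"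
      using w(2) b by simp
    then show "x \<in> U +>\<^bsub>V\<^esub> a" using w assms(3) U_closed by (auto simp: mem_coset)
  qed
qed

lemma coset_eq_iff:
  assumes "a \<in> carrier V" "b \<in> carrier V"
  shows "U +>\<^bsub>V\<^esub> a = U +>\<^bsub>V\<^esub> b \<longleftrightarrow> (\<exists>u\<in>U. a = u \<oplus>\<^bsub>V\<^esub> b)"
proof
  have "a \<in> U +>\<^bsub>V\<^esub> a" using U_closed(1) assms by (auto simp: mem_coset intro!: bexI[of _ "\<zero>\<^bsub>V\<^esub>"])
  moreover assume "U +>\<^bsub>V\<^esub> a = U +>\<^bsub>V\<^esub> b"
  ultimately show "\<exists>u\<in>U. a = u \<oplus>\<^bsub>V\<^esub> b" by (simp add: mem_coset)
qed (use assms coset_eqI in auto)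

lemma carrier_quotient: "carrier (quotient_space V U) = (\<lambda>a. U +>\<^bsub>V\<^esub> a) ` carrier V"
  by (auto simp: quotient_space_def A_RCOSETS_def')

lemma zero_quotient: "\<zero>\<^bsub>quotient_space V U\<^esub> = U +>\<^bsub>V\<^esub> \<zero>\<^bsub>V\<^esub>"
  using U_carrier by (auto simp: quotient_space_def a_r_coset_def')

lemma add_quotient:
  assumes "a \<in> carrier V" "b \<in> carrier V"
  shows "(U +>\<^bsub>V\<^esub> a) \<oplus>\<^bsub>quotient_space V U\<^esub> (U +>\<^bsub>V\<^esub> b) = U +>\<^bsub>V\<^esub> (a \<oplus>\<^bsub>V\<^esub> b)"
proof -
  have mem: "x \<in> (U +>\<^bsub>V\<^esub> a) <+>\<^bsub>V\<^esub> (U +>\<^bsub>V\<^esub> b)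
      \<longleftrightarrow> (\<exists>u\<in>U. \<exists>w\<in>U. x = (u \<oplus>\<^bsub>V\<^esub> a) \<oplus>\<^bsub>V\<^esub> (w \<oplus>\<^bsub>V\<^esub> b))" for x
    by (auto simp: set_add_def' a_r_coset_def')
  have 1: "(u \<oplus>\<^bsub>V\<^esub> a) \<oplus>\<^bsub>V\<^esub> (w \<oplus>\<^bsub>V\<^esub> b) = (u \<oplus>\<^bsub>V\<^esub> w) \<oplus>\<^bsub>V\<^esub> (a \<oplus>\<^bsub>V\<^esub> b)" if "u \<in> U" "w \<in> U" for u w
    using that assms U_carrier by (simp add: V.M.add.m_ac)
  have 2: "u \<oplus>\<^bsub>V\<^esub> \<zero>\<^bsub>V\<^esub> = u" if "u \<in> U" for u
    using that U_carrier by simp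
  have "(U +>\<^bsub>V\<^esub> a) <+>\<^bsub>V\<^esub> (U +>\<^bsub>V\<^esub> b) = U +>\<^bsub>V\<^esub> (a \<oplus>\<^bsub>V\<^esub> b)"
  proof (rule Set.set_eqI)
    fix x
    have "x \<in> (U +>\<^bsub>V\<^esub> a) <+>\<^bsub>V\<^esub> (U +>\<^bsub>V\<^esub> b)
        \<longleftrightarrow> (\<exists>u\<in>U. \<exists>w\<in>U. x = (u \<oplus>\<^bsub>V\<^esub> w) \<oplus>\<^bsub>V\<^esub> (a \<oplus>\<^bsub>V\<^esub> b))"
      using 1 by (simp add: mem)
    also have "\<dots> \<longleftrightarrow> (\<exists>u\<in>U. x = u \<oplus>\<^bsub>V\<^esub> (a \<oplus>\<^bsub>V\<^esub> b))"
      using U_closed(1) U_closed(2) 2 by metis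
    finally show "x \<in> (U +>\<^bsub>V\<^esub> a) <+>\<^bsub>V\<^esub> (U +>\<^bsub>V\<^esub> b) \<longleftrightarrow> x \<in> U +>\<^bsub>V\<^esub> (a \<oplus>\<^bsub>V\<^esub> b)"
      by (simp add: mem_coset)
  qed
  then show ?thesis by (simp add: quotient_space_def)
qed

lemma smult_quotient:
  assumes "a \<in> carrier V"
  shows "c \<odot>\<^bsub>quotient_space V U\<^esub> (U +>\<^bsub>V\<^esub> a) = U +>\<^bsub>V\<^esub> (c \<odot>\<^bsub>V\<^esub> a)"
proof -
  have "U +>\<^bsub>V\<^esub> (c \<odot>\<^bsub>V\<^esub> b) = U +>\<^bsub>V\<^esub> (c \<odot>\<^bsub>V\<^esub> a)" if b: "b \<in> U +>\<^bsub>V\<^esub> a" for b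
  proof -
    obtain u where u: "u \<in> U" "b = u \<oplus>\<^bsub>V\<^esub> a" using b by (auto simp: mem_coset)
    then show ?thesis
      using assms U_carrier U_closed
      by (intro coset_eqI[of _ _ "c \<odot>\<^bsub>V\<^esub> u"]) (auto simp: V.smult_r_distr)
  qed
  moreover have "a \<in> U +>\<^bsub>V\<^esub> a"
    using assms U_closed(1) by (auto simp: mem_coset intro!: bexI[of _ "\<zero>\<^bsub>V\<^esub>"])
  ultimately have "(\<Union>b\<in>U +>\<^bsub>V\<^esub> a. U +>\<^bsub>V\<^esub> (c \<odot>\<^bsub>V\<^esub> b)) = U +>\<^bsub>V\<^esub> (c \<odot>\<^bsub>V\<^esub> a)"
    by blast
  then show ?thesis by (simp add: quotient_space_def)
qed

lemma kspace_quotient: "kspace (quotient_space V U)"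
proof -
  let ?q = "\<lambda>a. U +>\<^bsub>V\<^esub> a"
  note simps = carrier_quotient zero_quotient add_quotient smult_quotient
  have "abelian_group (quotient_space V U)"
  proof (rule abelian_groupI)
    fix x assume "x \<in> carrier (quotient_space V U)"
    then obtain a where a: "a \<in> carrier V" "x = ?q a" by (auto simp: simps)
    then show "\<exists>y\<in>carrier (quotient_space V U).
        y \<oplus>\<^bsub>quotient_space V U\<^esub> x = \<zero>\<^bsub>quotient_space V U\<^esub>"
      by (intro bexI[of _ "?q (\<ominus>\<^bsub>V\<^esub> a)"]) (auto simp: simps V.M.l_neg)
  qed (auto simp: simps V.M.add.m_ac)
  then show ?thesis
    by (intro moduleI cring_from_type_algebra) (auto simp: simps V.smult_l_distr[simplified] V.smult_r_distr V.smult_assoc1[simplified] V.smult_one[simplified])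
qed

end

section \<open>Coboundary and cup product of functions on tuples\<close>

text \<open>
  A cochain is a function on lists, of all degrees at once: its component of degree \<open>n\<close> is its
  restriction to lists of length \<open>n + 1\<close>. Peeling off the first vertex turns the alternating sum
  over all faces into a recursion, in which the partial function \<open>F (x # _)\<close> plays the role of a
  cochain that is nonzero on the empty list. This is why the Leibniz rule below carries a
  correction term in \<open>F []\<close>.
\<close>

fun cobd :: "('g list \<Rightarrow> 'v::ab_group_add) \<Rightarrow> 'g list \<Rightarrow> 'v" where
  "cobd F [] = 0"
| "cobd F (x # xs) = F xs - cobd (\<lambda>ys. F (x # ys)) xs"

text \<open>
  Front face times back face, with the vertex between them shared.
\<close>
fun cup :: "('k \<Rightarrow> 'v \<Rightarrow> 'v) \<Rightarrow> ('g list \<Rightarrow> 'v::ab_group_add) \<Rightarrow> ('g list \<Rightarrow> 'k) \<Rightarrow> 'g list \<Rightarrow> 'v" where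
  "cup s F h [] = 0"
| "cup s F h (x # xs) = s (h (x # xs)) (F [x]) + cup s (\<lambda>ys. F (x # ys)) h xs"

definition alt :: "('g list \<Rightarrow> 'v::ab_group_add) \<Rightarrow> 'g list \<Rightarrow> 'v" where
  "alt F xs = (if even (length xs) then F xs else - F xs)"

definition component :: "nat \<Rightarrow> ('g list \<Rightarrow> 'v::zero) \<Rightarrow> 'g list \<Rightarrow> 'v" where
  "component n F xs = (if length xs = Suc n then F xs else 0)"

definition cup_unit :: "'g list \<Rightarrow> 'k::field" where
  "cup_unit xs = (if length xs = 1 then 1 else 0)"

lemma cobd_linear:
  assumes "\<And>a b. L (a - b) = L a - L b"
  shows "L (cobd F xs) = cobd (\<lambda>ys. L (F ys)) xs"
proof (induction xs arbitrary: F)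
  case Nil
  show ?case using assms[of 0 0] by simp
qed (simp add: assms)

lemma cobd_add: "cobd (\<lambda>ys. F ys + H ys) xs = cobd F xs + cobd H xs"
  by (induction xs arbitrary: F H) auto

lemma cobd_diff: "cobd (\<lambda>ys. F ys - H ys) xs = cobd F xs - cobd H xs"
  by (induction xs arbitrary: F H) auto

lemma cobd_zero [simp]: "cobd (\<lambda>ys. 0) xs = 0"
  by (induction xs) auto

lemma cobd_cong:
  assumes "\<And>ys. Suc (length ys) = length xs \<Longrightarrow> set ys \<subseteq> set xs \<Longrightarrow> F ys = H ys"
  shows "cobd F xs = cobd H xs"
  using assms
proof (induction xs arbitrary: F H)
  case (Cons x xs)
  have "cobd (\<lambda>ys. F (x # ys)) xs = cobd (\<lambda>ys. H (x # ys)) xs"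
    by (intro Cons.IH Cons.prems) auto
  moreover have "F xs = H xs" by (intro Cons.prems) auto
  ultimately show ?case by simp
qed simp

lemma cobd_map: "cobd F (map f xs) = cobd (\<lambda>ys. F (map f ys)) xs"
  by (induction xs arbitrary: F) auto

text \<open>
  One step of the recursion produces \<open>cobd F xs\<close> twice with opposite signs, and what remains is the
  same statement for the shorter list.
\<close>
lemma cobd_cobd [simp]: "cobd (cobd F) xs = 0"
proof (induction xs arbitrary: F)
  case (Cons x xs)
  have "cobd (\<lambda>ys. cobd F (x # ys)) xs = cobd F xs - cobd (cobd (\<lambda>ys. F (x # ys))) xs"
    by (simp add: cobd_diff)
  then show ?case by (simp add: Cons.IH)
qed simp

lemma (in vector_space) cobd_eq_sum:
  "cobd F xs = (\<Sum>i<length xs. scale ((-1) ^ i) (F (take i xs @ drop (Suc i) xs)))"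
proof (induction xs arbitrary: F)
  case (Cons x xs)
  have "cobd F (x # xs) = F xs - (\<Sum>i<length xs. scale ((-1) ^ i) (F (x # take i xs @ drop (Suc i) xs)))"
    by (simp add: Cons.IH)
  also have "\<dots> = (\<Sum>i<length (x # xs).
      scale ((-1) ^ i) (F (take i (x # xs) @ drop (Suc i) (x # xs))))"
    by (simp add: sum.lessThan_Suc_shift sum_negf del: sum.lessThan_Suc)
  finally show ?case .
qed simp

lemma cobd_alt: "cobd (alt F) xs = - alt (cobd F) xs"
proof (induction xs arbitrary: F)
  case (Cons x xs)
  have "cobd (\<lambda>ys. alt F (x # ys)) xs = - cobd (alt (\<lambda>ys. F (x # ys))) xs"
    by (subst cobd_linear[where L = uminus]) (auto intro!: cobd_cong simp: alt_def)
  then show ?case by (simp add: Cons.IH) (simp add: alt_def)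
qed (simp add: alt_def)

lemma cobd_component: "cobd (component n F) xs = component (Suc n) (cobd F) xs"
proof (cases "length xs = Suc (Suc n)")
  case True
  then show ?thesis by (auto simp: component_def intro!: cobd_cong)
next
  case False
  then have "cobd (component n F) xs = cobd (\<lambda>ys. 0) xs"
    by (intro cobd_cong) (auto simp: component_def)
  with False show ?thesis by (simp add: component_def)
qed

lemma cup_cong:
  assumes "\<And>ys. ys \<noteq> [] \<Longrightarrow> set ys \<subseteq> set xs \<Longrightarrow> F ys = F' ys"
    and "\<And>ys. ys \<noteq> [] \<Longrightarrow> set ys \<subseteq> set xs \<Longrightarrow> h ys = h' ys"
  shows "cup s F h xs = cup s F' h' xs"
  using assms
proof (induction xs arbitrary: F F')
  case (Cons x xs)
  have "cup s (\<lambda>ys. F (x # ys)) h xs = cup s (\<lambda>ys. F' (x # ys)) h' xs"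
    by (intro Cons.IH Cons.prems) auto
  moreover have "F [x] = F' [x]" "h (x # xs) = h' (x # xs)" by (intro Cons.prems; simp)+
  ultimately show ?case by simp
qed simp

lemma cup_map: "cup s F h (map f xs) = cup s (\<lambda>ys. F (map f ys)) (\<lambda>ys. h (map f ys)) xs"
  by (induction xs arbitrary: F) auto

lemma cup_linear:
  assumes "\<And>a b. L (a + b) = L a + L b" "\<And>c a. L (s c a) = s' c (L a)"
  shows "L (cup s F h xs) = cup s' (\<lambda>ys. L (F ys)) h xs"
proof (induction xs arbitrary: F)
  case Nil
  show ?case using assms(1)[of 0 0] by simp
qed (simp add: assms)

lemma cup_eq_sum:
  "cup s F h xs = (\<Sum>m<length xs. s (h (drop m xs)) (F (take (Suc m) xs)))"
proof (induction xs arbitrary: F)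
  case (Cons x xs)
  then show ?case by (simp add: sum.lessThan_Suc_shift del: sum.lessThan_Suc)
qed simp

context vector_space
begin

lemma cup_add_left: "cup scale (\<lambda>ys. F ys + F' ys) h xs = cup scale F h xs + cup scale F' h xs"
  by (simp add: cup_eq_sum scale_right_distrib sum.distrib)

lemma cup_add_right: "cup scale F (\<lambda>ys. h ys + h' ys) xs = cup scale F h xs + cup scale F h' xs"
  by (simp add: cup_eq_sum scale_left_distrib sum.distrib)

lemma cup_scale_left: "cup scale (\<lambda>ys. scale c (F ys)) h xs = scale c (cup scale F h xs)"
  by (simp add: cup_eq_sum scale_sum_right mult.commute)

lemma cup_scale_right: "cup scale F (\<lambda>ys. c * h ys) xs = scale c (cup scale F h xs)"
  by (simp add: cup_eq_sum scale_sum_right)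

lemma cup_zero_left [simp]: "cup scale (\<lambda>ys. 0) h xs = 0"
  by (simp add: cup_eq_sum)

lemma cup_zero_right: "(\<And>ys. ys \<noteq> [] \<Longrightarrow> set ys \<subseteq> set xs \<Longrightarrow> h ys = 0) \<Longrightarrow> cup scale F h xs = 0"
  using cup_cong[of xs F F h "\<lambda>ys. 0" scale] by (simp add: cup_eq_sum)

lemma cup_assoc: "cup scale (cup scale F h) k xs = cup scale F (cup (*) h k) xs"
proof (induction xs arbitrary: F)
  case (Cons x xs)
  have "cup scale (\<lambda>ys. cup scale F h (x # ys)) k xs
      = cup scale (\<lambda>ys. scale (h (x # ys)) (F [x])) k xs
        + cup scale (cup scale (\<lambda>ys. F (x # ys)) h) k xs"
    by (simp add: cup_add_left)
  also have "cup scale (\<lambda>ys. scale (h (x # ys)) (F [x])) k xs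
      = scale (cup (*) (\<lambda>ys. h (x # ys)) k xs) (F [x])"
    by (rule cup_linear[symmetric, where L = "\<lambda>c. scale c (F [x])"]) (auto simp: scale_left_distrib)
  finally show ?case by (simp add: Cons.IH scale_left_distrib)
qed simp

lemma cup_cup_unit: "xs \<noteq> [] \<Longrightarrow> cup scale F cup_unit xs = F xs"
proof (induction xs arbitrary: F)
  case (Cons x xs)
  then show ?case by (cases xs) (auto simp: cup_unit_def)
qed simp

lemma cup_degree_zero:
  assumes "\<And>ys. length ys \<noteq> 1 \<Longrightarrow> F ys = 0"
  shows "cup scale F h (x # xs) = scale (h (x # xs)) (F [x])"
proof -
  have "cup scale (\<lambda>ys. F (x # ys)) h xs = cup scale (\<lambda>ys. 0) h xs"
    by (rule cup_cong) (auto intro: assms)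
  then show ?thesis by simp
qed

text \<open>
  The sign of the Leibniz rule is carried by \<^const>\<open>alt\<close>. The induction peels off the first vertex and
  so passes from \<open>F\<close> to a function that need not vanish on the empty list; the term in \<open>F []\<close>
  accounts for this and is zero for cochains.
\<close>
lemma cobd_cup:
  assumes "h [] = 0"
  shows "cobd (cup scale F h) xs
    = cup scale (cobd F) h xs - cup scale (alt F) (cobd h) xs - scale (h xs) (F [])"
proof (induction xs arbitrary: F)
  case Nil
  show ?case using assms by simp
next
  case (Cons x xs)
  let ?Fx = "\<lambda>ys. F (x # ys)"
  have 1: "cobd (\<lambda>ys. cup scale F h (x # ys)) xs
      = scale (cobd (\<lambda>ys. h (x # ys)) xs) (F [x]) + cobd (cup scale ?Fx h) xs"
    using cobd_linear[of "\<lambda>c. scale c (F [x])" "\<lambda>ys. h (x # ys)" xs]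
    by (simp add: cobd_add scale_left_diff_distrib)
  have 2: "cup scale (\<lambda>ys. cobd F (x # ys)) h xs = cup scale F h xs - cup scale (cobd ?Fx) h xs"
    by (simp add: cup_eq_sum scale_right_diff_distrib sum_subtractf)
  have 3: "cup scale (\<lambda>ys. alt F (x # ys)) (cobd h) xs = - cup scale (alt ?Fx) (cobd h) xs"
    by (simp add: cup_eq_sum sum_negf[symmetric] alt_def if_distrib cong: if_cong)
      (auto intro!: sum.cong)
  have 4: "alt F [x] = - F [x]" by (simp add: alt_def)
  show ?case
    unfolding cobd.simps(2)[of "cup scale F h"] cup.simps(2)[of scale "cobd F"]
      cup.simps(2)[of scale "alt F"] 1 2 3 4 Cons.IH
    by (simp add: scale_left_diff_distrib algebra_simps)
qed

end

lemma cup_unit_cup: "cup (*) cup_unit h xs = (if xs = [] then 0 else (h xs :: 'k::field))"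
  by (cases xs)
    (auto simp: vector_space.cup_degree_zero[OF vector_space_mult] cup_unit_def simp del: cup.simps(2))

section \<open>Cohomology classes of functions on tuples\<close>

lemma kspace_submoduleI:
  fixes V :: "('k::field, 'v, 'm) module_scheme"
  assumes "kspace V" "U \<subseteq> carrier V" "\<zero>\<^bsub>V\<^esub> \<in> U"
    and "\<And>a b. a \<in> U \<Longrightarrow> b \<in> U \<Longrightarrow> a \<oplus>\<^bsub>V\<^esub> b \<in> U" "\<And>c a. a \<in> U \<Longrightarrow> c \<odot>\<^bsub>V\<^esub> a \<in> U"
  shows "submodule U (ring_of_type_algebra :: 'k ring) V"
proof -
  interpret V: Module.module "ring_of_type_algebra :: 'k ring" V by fact
  have "\<ominus>\<^bsub>V\<^esub> a \<in> U" if "a \<in> U" for a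
    using that assms(2) V.smult_l_minus[of "1 :: 'k" a] V.smult_one[of a]
      assms(5)[OF that, of "\<ominus>\<^bsub>ring_of_type_algebra\<^esub> (1 :: 'k)"]
    by auto
  then show ?thesis
    using assms by (intro V.submoduleI) auto
qed

definition tuples :: "('g, 'l) monoid_scheme \<Rightarrow> nat \<Rightarrow> 'g list set" where
  "tuples G n = {xs. length xs = Suc n \<and> set xs \<subseteq> carrier G}"

lemma std_res_simps [simp]:
  "carrier (std_res G n) = {p. keys p \<subseteq> tuples G n}"
  "x \<oplus>\<^bsub>std_res G n\<^esub> y = x + y" "\<zero>\<^bsub>std_res G n\<^esub> = 0"
  "module.smult (std_res G n) = pm_scale"
  "gact (std_res G n) g = pm_push (map (\<lambda>x. g \<otimes>\<^bsub>G\<^esub> x))"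
  by (simp_all add: std_res_def permutation_module_def tuples_def)

lemma std_diff_eq_lin: "std_diff = lin pm_scale (cobd (\<lambda>ys. single ys 1))"
  unfolding std_diff_def pm_extend_eq_lin pm.cobd_eq_sum by simp

lemma std_diff_single [simp]:
  "std_diff (single xs 1) = cobd (\<lambda>ys. single ys 1) xs"
  by (simp add: std_diff_eq_lin)

lemma lin_std_diff:
  assumes "vector_space s"
  shows "lin s F (std_diff p) = lin s (cobd F) p"
proof -
  interpret vector_space s by fact
  have "lin s F (cobd (\<lambda>ys. single ys 1) xs) = cobd F xs" for xs
    by (subst cobd_linear[where L = "lin s F"]) (simp_all add: lin_diff)
  then show ?thesis
    by (simp add: std_diff_eq_lin lin_lin[OF assms])
qed

lemma std_diff_diff:
  "std_diff (p - q) = std_diff p - std_diff q"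
  by (simp add: std_diff_eq_lin pm.lin_diff)

lemma std_aug_eq_lin: "std_aug = lin (*) (\<lambda>_. 1)"
  by (simp add: fun_eq_iff std_aug_def lin_def)

lemma cobd_closed:
  assumes "0 \<in> C" "\<And>a b. a \<in> C \<Longrightarrow> b \<in> C \<Longrightarrow> a - b \<in> C"
    and "\<And>ys. Suc (length ys) = length xs \<Longrightarrow> set ys \<subseteq> set xs \<Longrightarrow> F ys \<in> C"
  shows "cobd F xs \<in> C"
  using assms(3)
proof (induction xs arbitrary: F)
  case (Cons x xs)
  have "cobd (\<lambda>ys. F (x # ys)) xs \<in> C"
    by (intro Cons.IH Cons.prems) auto
  moreover have "F xs \<in> C" by (intro Cons.prems) auto
  ultimately show ?case by (simp add: assms)
qed (simp add: assms)

lemma keys_diff_subset: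
  "keys (a :: _ \<Rightarrow>\<^sub>0 'k::ab_group_add) \<subseteq> B \<Longrightarrow> keys b \<subseteq> B
    \<Longrightarrow> keys (a - b) \<subseteq> B"
  using Poly_Mapping.keys_diff[of a b] by blast

lemma keys_add_subset:
  "keys (a :: _ \<Rightarrow>\<^sub>0 'k::ab_group_add) \<subseteq> B \<Longrightarrow> keys b \<subseteq> B
    \<Longrightarrow> keys (a + b) \<subseteq> B"
  using Poly_Mapping.keys_add[of a b] by blast

lemma keys_pm_scale_subset:
  "keys a \<subseteq> B \<Longrightarrow> keys (pm_scale c a) \<subseteq> B"
  using keys_pm_scale[of c a] by blast

lemma std_diff_closed:
  fixes p :: "'g list \<Rightarrow>\<^sub>0 'k::field"
  assumes "keys p \<subseteq> tuples G (Suc n)"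
  shows "keys (std_diff p) \<subseteq> tuples G n"
proof -
  have "cobd (\<lambda>ys. single ys (1 :: 'k)) xs \<in> {q. keys q \<subseteq> tuples G n}"
    if "xs \<in> tuples G (Suc n)" for xs
    by (rule cobd_closed, simp_all add: keys_diff_subset) (use that in \<open>auto simp: tuples_def\<close>)
  note cl = this
  have "std_diff p \<in> {q. keys q \<subseteq> tuples G n}"
    unfolding std_diff_eq_lin
    by (rule pm.lin_closed)
      (use subsetD[OF assms] cl in \<open>simp_all add: keys_add_subset keys_pm_scale_subset\<close>)
  then show ?thesis by simp
qed

text \<open>
  The value at the empty list is fixed to zero, so that the coboundary of a function on the empty
  list, the augmentation, does not contribute in degree \<open>0\<close>. The values at lists with entries
  outside the group are arbitrary: no class depends on them.
\<close>
definition cochain :: "('g, 'l) monoid_scheme \<Rightarrow> ('k, 'v::ab_group_add, 'g) gmodule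
    \<Rightarrow> ('g list \<Rightarrow> 'v) \<Rightarrow> bool" where
  "cochain G M F \<longleftrightarrow> F [] = 0 \<and>
     (\<forall>xs. set xs \<subseteq> carrier G \<longrightarrow> F xs \<in> carrier M \<and>
        (\<forall>g\<in>carrier G. F (map (\<lambda>x. g \<otimes>\<^bsub>G\<^esub> x) xs) = gact M g (F xs)))"

definition cocycle :: "('g, 'l) monoid_scheme \<Rightarrow> ('k, 'v::ab_group_add, 'g) gmodule
    \<Rightarrow> ('g list \<Rightarrow> 'v) \<Rightarrow> bool" where
  "cocycle G M F \<longleftrightarrow> cochain G M F \<and> (\<forall>xs. set xs \<subseteq> carrier G \<longrightarrow> cobd F xs = 0)"

text \<open>
  The passage from functions on tuples to the maps on the standard resolution by which
  \<^const>\<open>cochains\<close> is defined.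
\<close>
definition to_cochain :: "('g, 'l) monoid_scheme \<Rightarrow> ('k::field, 'v::ab_group_add, 'g) gmodule \<Rightarrow> nat
    \<Rightarrow> ('g list \<Rightarrow> 'v) \<Rightarrow> ('g list \<Rightarrow>\<^sub>0 'k) \<Rightarrow> 'v" where
  "to_cochain G M n F = restrict (lin (module.smult M) F) {p. keys p \<subseteq> tuples G n}"

definition cls :: "('g, 'l) monoid_scheme \<Rightarrow> ('k::field, 'v::ab_group_add, 'g) gmodule \<Rightarrow> nat
    \<Rightarrow> ('g list \<Rightarrow> 'v) \<Rightarrow> (('g list \<Rightarrow>\<^sub>0 'k) \<Rightarrow> 'v) set" where
  "cls G M n F = Ext_class G M n (to_cochain G M n F)"

text \<open>
  Modules whose addition is that of the ambient type; all modules of interest are of this form,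
  and so sums in them can be computed in the type.
\<close>
locale gmod = G: group G + vector_space "module.smult M"
  for G :: "('g, 'l) monoid_scheme" and M :: "('k::field, 'v::ab_group_add, 'g) gmodule" +
  assumes zero_M [simp]: "\<zero>\<^bsub>M\<^esub> = 0"
    and add_M [simp]: "x \<oplus>\<^bsub>M\<^esub> y = x + y"
    and zero_closed [simp]: "0 \<in> carrier M"
    and add_closed [simp]: "x \<in> carrier M \<Longrightarrow> y \<in> carrier M \<Longrightarrow> x + y \<in> carrier M"
    and smult_closed [simp]: "x \<in> carrier M \<Longrightarrow> c \<odot>\<^bsub>M\<^esub> x \<in> carrier M"
    and act_closed [simp]: "g \<in> carrier G \<Longrightarrow> x \<in> carrier M \<Longrightarrow> gact M g x \<in> carrier M"
    and act_add: "g \<in> carrier G \<Longrightarrow> gact M g (x + y) = gact M g x + gact M g y"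
    and act_smult: "g \<in> carrier G \<Longrightarrow> gact M g (c \<odot>\<^bsub>M\<^esub> x) = c \<odot>\<^bsub>M\<^esub> gact M g x"
    and act_mult: "g \<in> carrier G \<Longrightarrow> h \<in> carrier G \<Longrightarrow> x \<in> carrier M \<Longrightarrow>
      gact M (g \<otimes>\<^bsub>G\<^esub> h) x = gact M g (gact M h x)"
    and act_one: "x \<in> carrier M \<Longrightarrow> gact M \<one>\<^bsub>G\<^esub> x = x"
begin

lemma diff_closed [simp]: "x \<in> carrier M \<Longrightarrow> y \<in> carrier M \<Longrightarrow> x - y \<in> carrier M"
  using add_closed[of x "(-1) \<odot>\<^bsub>M\<^esub> y"] smult_closed[of y "-1"] by simp

lemma uminus_closed [simp]: "x \<in> carrier M \<Longrightarrow> - x \<in> carrier M"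
  using diff_closed[of 0 x] by simp

lemma sum_closed: "(\<And>i. i \<in> I \<Longrightarrow> f i \<in> carrier M) \<Longrightarrow> sum f I \<in> carrier M"
  by (induction I rule: infinite_finite_induct) auto

lemma act_zero [simp]: "g \<in> carrier G \<Longrightarrow> gact M g 0 = 0"
  using act_add[of g 0 0] by simp

lemma act_diff: "g \<in> carrier G \<Longrightarrow> gact M g (x - y) = gact M g x - gact M g y"
  using act_add[of g "x - y" y] by (simp add: algebra_simps)

lemma act_uminus: "g \<in> carrier G \<Longrightarrow> gact M g (- y) = - gact M g y"
  using act_diff[of g 0 y] by simp

lemma act_sum: "g \<in> carrier G \<Longrightarrow> gact M g (sum f I) = (\<Sum>i\<in>I. gact M g (f i))"
  by (induction I rule: infinite_finite_induct) (auto simp: act_add)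

abbreviation "C \<equiv> cochain G M"
abbreviation "Z \<equiv> cocycle G M"

lemma cochainD:
  assumes "C F"
  shows "F [] = 0" "set xs \<subseteq> carrier G \<Longrightarrow> F xs \<in> carrier M"
    "g \<in> carrier G \<Longrightarrow> set xs \<subseteq> carrier G \<Longrightarrow> F (map (\<lambda>x. g \<otimes>\<^bsub>G\<^esub> x) xs) = gact M g (F xs)"
  using assms by (auto simp: cochain_def)

lemma cocycleD:
  assumes "Z F"
  shows "C F" "set xs \<subseteq> carrier G \<Longrightarrow> cobd F xs = 0"
  using assms by (auto simp: cocycle_def)

lemma cochain_zero: "C (\<lambda>xs. 0)" and cocycle_zero: "Z (\<lambda>xs. 0)"
  by (auto simp: cochain_def cocycle_def)

lemma cochain_add: "C F \<Longrightarrow> C H \<Longrightarrow> C (\<lambda>xs. F xs + H xs)"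
  by (auto simp: cochain_def act_add)

lemma cochain_diff: "C F \<Longrightarrow> C H \<Longrightarrow> C (\<lambda>xs. F xs - H xs)"
  by (auto simp: cochain_def act_diff)

lemma cochain_smult: "C F \<Longrightarrow> C (\<lambda>xs. c \<odot>\<^bsub>M\<^esub> F xs)"
  by (auto simp: cochain_def act_smult)

lemma cochain_component: "C F \<Longrightarrow> C (component n F)"
  by (auto simp: cochain_def component_def)

lemma cochain_alt: "C F \<Longrightarrow> C (alt F)"
  by (auto simp: cochain_def alt_def act_uminus)

lemma cochain_cobd: "C F \<Longrightarrow> C (cobd F)"
  unfolding cochain_def
proof (intro conjI allI impI ballI)
  fix xs assume F: "F [] = 0 \<and> (\<forall>xs. set xs \<subseteq> carrier G \<longrightarrow> F xs \<in> carrier M \<and>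
      (\<forall>g\<in>carrier G. F (map (\<lambda>x. g \<otimes>\<^bsub>G\<^esub> x) xs) = gact M g (F xs)))"
    and xs: "set xs \<subseteq> carrier G"
  show "cobd F xs \<in> carrier M"
    using F xs by (intro cobd_closed) auto
  fix g assume g: "g \<in> carrier G"
  have "cobd F (map (\<lambda>x. g \<otimes>\<^bsub>G\<^esub> x) xs) = cobd (\<lambda>ys. gact M g (F ys)) xs"
    unfolding cobd_map using F xs g by (intro cobd_cong) auto
  then show "cobd F (map (\<lambda>x. g \<otimes>\<^bsub>G\<^esub> x) xs) = gact M g (cobd F xs)"
    using g by (simp add: cobd_linear[where L = "gact M g"] act_diff)
qed simp

lemma cobd_smult: "cobd (\<lambda>xs. c \<odot>\<^bsub>M\<^esub> F xs) ys = c \<odot>\<^bsub>M\<^esub> cobd F ys"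
  by (rule cobd_linear[symmetric]) (rule scale_right_diff_distrib)

lemma cocycle_cobd: "C F \<Longrightarrow> Z (cobd F)"
  by (simp add: cocycle_def cochain_cobd)

lemma cocycle_add: "Z F \<Longrightarrow> Z H \<Longrightarrow> Z (\<lambda>xs. F xs + H xs)"
  by (simp add: cocycle_def cochain_add cobd_add)

lemma cocycle_diff: "Z F \<Longrightarrow> Z H \<Longrightarrow> Z (\<lambda>xs. F xs - H xs)"
  by (simp add: cocycle_def cochain_diff cobd_diff)

lemma cocycle_smult: "Z F \<Longrightarrow> Z (\<lambda>xs. c \<odot>\<^bsub>M\<^esub> F xs)"
  by (simp add: cocycle_def cochain_smult cobd_smult)

lemma cocycle_component: "Z F \<Longrightarrow> Z (component n F)"
  by (auto simp: cocycle_def cochain_component cobd_component) (auto simp: component_def)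

lemma cocycle_alt: "Z F \<Longrightarrow> Z (alt F)"
  by (auto simp: cocycle_def cochain_alt cobd_alt) (auto simp: alt_def)

lemma cocycle_sum: "(\<And>i. i \<in> I \<Longrightarrow> Z (F i)) \<Longrightarrow> Z (\<lambda>xs. \<Sum>i\<in>I. F i xs)"
  by (induction I rule: infinite_finite_induct) (auto simp: cocycle_zero cocycle_add)

lemma to_cochain_eq_iff: "to_cochain G M n F = to_cochain G M n H \<longleftrightarrow> (\<forall>xs\<in>tuples G n. F xs = H xs)"
proof
  assume eq: "to_cochain G M n F = to_cochain G M n H"
  show "\<forall>xs\<in>tuples G n. F xs = H xs"
  proof
    fix xs assume "xs \<in> tuples G n"
    then show "F xs = H xs"
      using fun_cong[OF eq, of "single xs 1"] by (simp add: to_cochain_def)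
  qed
next
  assume "\<forall>xs\<in>tuples G n. F xs = H xs"
  then show "to_cochain G M n F = to_cochain G M n H"
    unfolding to_cochain_def by (intro restrict_ext lin_cong) auto
qed

lemma to_cochain_in_cochains:
  assumes F: "C F"
  shows "to_cochain G M n F \<in> carrier (cochains G M n)"
proof -
  have lin: "lin (module.smult M) F p \<in> carrier M" if "keys p \<subseteq> tuples G n" for p
    using that cochainD(2)[OF F] by (intro lin_closed) (auto simp: tuples_def)
  have push: "keys (pm_push (map (\<lambda>x. g \<otimes>\<^bsub>G\<^esub> x)) p) \<subseteq> tuples G n"
    if "keys p \<subseteq> tuples G n" "g \<in> carrier G" for p :: "'g list \<Rightarrow>\<^sub>0 'k" and g
    using keys_pm_push[of "map (\<lambda>x. g \<otimes>\<^bsub>G\<^esub> x)" p] that by (fastforce simp: tuples_def)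
  have act: "lin (module.smult M) F (pm_push (map (\<lambda>x. g \<otimes>\<^bsub>G\<^esub> x)) p)
      = gact M g (lin (module.smult M) F p)"
    if "keys p \<subseteq> tuples G n" "g \<in> carrier G" for p g
  proof -
    have "lin (module.smult M) F (pm_push (map (\<lambda>x. g \<otimes>\<^bsub>G\<^esub> x)) p)
        = lin (module.smult M) (\<lambda>xs. gact M g (F xs)) p"
      unfolding lin_pm_push[OF vector_space_axioms]
      using that cochainD(3)[OF F] by (intro lin_cong) (auto simp: tuples_def)
    also have "\<dots> = gact M g (lin (module.smult M) F p)"
      by (rule linear_lin[symmetric, OF vector_space_axioms vector_space_axioms])
        (use that in \<open>auto simp: act_add act_smult\<close>)
    finally show ?thesis .
  qed
  show ?thesis
    by (auto simp: cochains_def ghom_space_def ghom_set_def to_cochain_def linear_map_def lin act push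
        keys_add_subset keys_pm_scale_subset lin_add lin_scale)
qed

lemma cochains_obtain:
  assumes f: "f \<in> carrier (cochains G M n)"
  obtains F where "C F" "component n F = F" "f = to_cochain G M n F"
proof
  define F where "F xs = (if xs \<in> tuples G n then f (single xs 1) else 0)" for xs
  have f': "f \<in> extensional {p. keys p \<subseteq> tuples G n}"
    "\<And>p. keys p \<subseteq> tuples G n \<Longrightarrow> f p \<in> carrier M"
    "\<And>p q. keys p \<subseteq> tuples G n \<Longrightarrow> keys q \<subseteq> tuples G n
      \<Longrightarrow> f (p + q) = f p + f q"
    "\<And>c p. keys p \<subseteq> tuples G n \<Longrightarrow> f (pm_scale c p) = c \<odot>\<^bsub>M\<^esub> f p"
    "\<And>g p. g \<in> carrier G \<Longrightarrow> keys p \<subseteq> tuples G n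
      \<Longrightarrow> f (pm_push (map (\<lambda>x. g \<otimes>\<^bsub>G\<^esub> x)) p) = gact M g (f p)"
    using f by (auto simp: cochains_def ghom_space_def ghom_set_def linear_map_def)
  show "f = to_cochain G M n F"
  proof
    fix p
    show "f p = to_cochain G M n F p"
    proof (cases "keys p \<subseteq> tuples G n")
      case True
      have "f p = lin (module.smult M) (\<lambda>xs. f (single xs 1)) p"
        using f'(3,4) True by (rule linear_on_eq_lin[OF vector_space_axioms])
      also have "\<dots> = lin (module.smult M) F p"
        using True by (intro lin_cong) (auto simp: F_def)
      finally show ?thesis using True by (simp add: to_cochain_def)
    qed (use f'(1) in \<open>auto simp: to_cochain_def extensional_def\<close>)
  qed
  show "C F"
    unfolding cochain_def
  proof (intro conjI allI impI ballI)
    show "F [] = 0" by (simp add: F_def tuples_def)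
    fix xs assume xs: "set xs \<subseteq> carrier G"
    then show "F xs \<in> carrier M" using f'(2) by (simp add: F_def)
    fix g assume g: "g \<in> carrier G"
    have "map (\<lambda>x. g \<otimes>\<^bsub>G\<^esub> x) xs \<in> tuples G n \<longleftrightarrow> xs \<in> tuples G n"
      using xs g by (auto simp: tuples_def)
    then show "F (map (\<lambda>x. g \<otimes>\<^bsub>G\<^esub> x) xs) = gact M g (F xs)"
      using f'(5)[OF g, of "single xs 1"] g by (auto simp: F_def)
  qed
  show "component n F = F"
    by (auto simp: component_def F_def tuples_def fun_eq_iff)
qed

lemma compose_to_cochain_diff:
  "compose (carrier (std_res G (Suc n))) (to_cochain G M n F) std_diff = to_cochain G M (Suc n) (cobd F)"
  by (rule ext) (simp add: compose_def to_cochain_def std_diff_closed lin_std_diff[OF vector_space_axioms])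

lemma cochains_zero: "\<zero>\<^bsub>cochains G M n\<^esub> = to_cochain G M n (\<lambda>xs. 0)"
  by (auto simp: cochains_def ghom_space_def to_cochain_def lin_def intro!: restrict_ext)

lemma cochains_add: "to_cochain G M n F \<oplus>\<^bsub>cochains G M n\<^esub> to_cochain G M n H = to_cochain G M n (\<lambda>xs. F xs + H xs)"
  by (auto simp: cochains_def ghom_space_def to_cochain_def lin_fun_add intro!: restrict_ext)

lemma cochains_smult: "c \<odot>\<^bsub>cochains G M n\<^esub> to_cochain G M n F = to_cochain G M n (\<lambda>xs. c \<odot>\<^bsub>M\<^esub> F xs)"
  by (auto simp: cochains_def ghom_space_def to_cochain_def lin_fun_scale intro!: restrict_ext)

lemma to_cochain_in_cocycles_iff:
  assumes "C F"
  shows "to_cochain G M n F \<in> cocycles G M n \<longleftrightarrow> (\<forall>xs\<in>tuples G (Suc n). cobd F xs = 0)"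
  using to_cochain_in_cochains[OF assms, of n]
  by (simp add: cocycles_def compose_to_cochain_diff cochains_zero to_cochain_eq_iff del: std_res_simps)

lemma cocycles_eq: "cocycles G M n = to_cochain G M n ` {F. Z F}"
proof (intro subset_antisym subsetI)
  fix f assume f: "f \<in> cocycles G M n"
  then obtain F where F: "C F" "component n F = F" "f = to_cochain G M n F"
    using cochains_obtain by (auto simp: cocycles_def)
  have "cobd F xs = 0" if "set xs \<subseteq> carrier G" for xs
    using f to_cochain_in_cocycles_iff[OF F(1), of n] F(3) that cobd_component[of n F xs] F(2)
    by (auto simp: tuples_def component_def split: if_splits)
  with F show "f \<in> to_cochain G M n ` {F. Z F}" by (auto simp: cocycle_def)
qed (auto simp: to_cochain_in_cocycles_iff cocycle_def tuples_def)

text \<open>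
  In degree \<open>0\<close> this holds because the coboundary of a cochain vanishes on lists of length one.
\<close>
lemma coboundaries_eq: "coboundaries G M n = (\<lambda>E. to_cochain G M n (cobd E)) ` {E. C E}"
proof (cases n)
  case 0
  have "to_cochain G M 0 (cobd E) = to_cochain G M 0 (\<lambda>xs. 0)" if "C E" for E
    using cochainD(1)[OF that] by (auto simp: to_cochain_eq_iff tuples_def length_Suc_conv)
  then have "(\<lambda>E. to_cochain G M 0 (cobd E)) ` {E. C E} = {to_cochain G M 0 (\<lambda>xs. 0)}"
    using cochain_zero by auto
  with 0 show ?thesis by (simp add: coboundaries_def cochains_zero)
next
  case (Suc m)
  have "carrier (cochains G M m) = to_cochain G M m ` {E. C E}"
    using to_cochain_in_cochains by (auto elim: cochains_obtain)
  with Suc show ?thesis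
    by (auto simp: coboundaries_def compose_to_cochain_diff image_image simp del: std_res_simps)
qed

lemma quotient_Ext:
  "quotient_of_space ((cochains G M n)\<lparr>carrier := cocycles G M n\<rparr>) (coboundaries G M n)"
proof (rule quotient_of_space.intro)
  let ?V = "(cochains G M n)\<lparr>carrier := cocycles G M n\<rparr>"
  show V: "kspace ?V"
    by (rule kspace_presentation[OF vector_space_fun[OF vector_space_axioms],
          where Z = "{F. Z F}" and q = "to_cochain G M n"])
      (auto simp: cocycles_eq cochains_zero cochains_add cochains_smult cocycle_smult zero_fun_def
        plus_fun_def cocycle_zero cocycle_add)
  have 0: "to_cochain G M n (\<lambda>xs. 0) = to_cochain G M n (cobd (\<lambda>xs. 0))"
    by (simp add: to_cochain_eq_iff)
  show "submodule (coboundaries G M n) (ring_of_type_algebra :: 'k ring) ?V"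
    by (rule kspace_submoduleI[OF V])
      (auto simp: cocycles_eq coboundaries_eq cochains_zero 0 cochains_add cochains_smult
        cobd_add[symmetric] cobd_smult[symmetric] intro!: imageI cocycle_cobd cochain_add
        cochain_smult cochain_zero)
qed

lemma cls_coset:
  "cls G M n F = coboundaries G M n +>\<^bsub>(cochains G M n)\<lparr>carrier := cocycles G M n\<rparr>\<^esub> to_cochain G M n F"
  by (simp add: cls_def Ext_class_def a_r_coset_def')

lemma cls_eq_iff:
  assumes "Z F" "Z H"
  shows "cls G M n F = cls G M n H
    \<longleftrightarrow> (\<exists>E. C E \<and> (\<forall>xs\<in>tuples G n. F xs = H xs + cobd E xs))"
proof -
  interpret Q: quotient_of_space "(cochains G M n)\<lparr>carrier := cocycles G M n\<rparr>" "coboundaries G M n"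
    by (rule quotient_Ext)
  show ?thesis
    using assms unfolding cls_coset
    by (subst Q.coset_eq_iff)
      (auto simp: cocycles_eq coboundaries_eq cochains_add to_cochain_eq_iff add.commute)
qed

lemma cls_cong: "(\<And>xs. xs \<in> tuples G n \<Longrightarrow> F xs = H xs) \<Longrightarrow> cls G M n F = cls G M n H"
  using to_cochain_eq_iff[of n F H] by (simp add: cls_def)

lemma carrier_Ext: "carrier (Ext G M n) = cls G M n ` {F. Z F}"
proof -
  interpret Q: quotient_of_space "(cochains G M n)\<lparr>carrier := cocycles G M n\<rparr>" "coboundaries G M n"
    by (rule quotient_Ext)
  show ?thesis
    by (simp add: Ext_def Q.carrier_quotient cls_coset) (simp add: cocycles_eq image_image)
qed

lemma kspace_Ext: "kspace (Ext G M n)"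
  unfolding Ext_def by (rule quotient_of_space.kspace_quotient[OF quotient_Ext])

lemma Ext_zero: "\<zero>\<^bsub>Ext G M n\<^esub> = cls G M n (\<lambda>xs. 0)"
  unfolding Ext_def quotient_of_space.zero_quotient[OF quotient_Ext] cls_coset
  by (simp add: cochains_zero)

lemma Ext_add:
  assumes "Z F" "Z H"
  shows "cls G M n F \<oplus>\<^bsub>Ext G M n\<^esub> cls G M n H = cls G M n (\<lambda>xs. F xs + H xs)"
  using assms unfolding Ext_def cls_coset
  by (subst quotient_of_space.add_quotient[OF quotient_Ext]) (auto simp: cocycles_eq cochains_add)

lemma Ext_smult:
  assumes "Z F"
  shows "c \<odot>\<^bsub>Ext G M n\<^esub> cls G M n F = cls G M n (\<lambda>xs. c \<odot>\<^bsub>M\<^esub> F xs)"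
  using assms unfolding Ext_def cls_coset
  by (subst quotient_of_space.smult_quotient[OF quotient_Ext]) (auto simp: cocycles_eq cochains_smult)

text \<open>
  The Yoneda product and the maps induced on cohomology are unions over the elements of classes;
  by this lemma every such element is again given by a cocycle of the same class.
\<close>
lemma mem_cls:
  assumes "Z F"
  shows "f \<in> cls G M n F \<longleftrightarrow> (\<exists>H. Z H \<and> f = to_cochain G M n H \<and> cls G M n H = cls G M n F)"
proof
  assume "f \<in> cls G M n F"
  then obtain E where E: "C E" "f = to_cochain G M n (\<lambda>xs. cobd E xs + F xs)"
    by (auto simp: cls_def Ext_class_def a_r_coset_def' coboundaries_eq cochains_add)
  moreover have Z: "Z (\<lambda>xs. cobd E xs + F xs)"
    using E(1) assms by (intro cocycle_add cocycle_cobd)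
  moreover have "cls G M n (\<lambda>xs. cobd E xs + F xs) = cls G M n F"
    using E(1) by (subst cls_eq_iff[OF Z assms]) (auto simp: add.commute)
  ultimately show "\<exists>H. Z H \<and> f = to_cochain G M n H \<and> cls G M n H = cls G M n F" by auto
next
  assume "\<exists>H. Z H \<and> f = to_cochain G M n H \<and> cls G M n H = cls G M n F"
  then obtain H E where H: "Z H" "f = to_cochain G M n H" and E: "C E"
    "\<forall>xs\<in>tuples G n. H xs = F xs + cobd E xs"
    using cls_eq_iff[OF _ assms] by blast
  then have "f = to_cochain G M n (cobd E) \<oplus>\<^bsub>cochains G M n\<^esub> to_cochain G M n F"
    by (auto simp: cochains_add to_cochain_eq_iff add.commute)
  with E(1) show "f \<in> cls G M n F"
    by (auto simp: cls_def Ext_class_def a_r_coset_def' coboundaries_eq)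
qed

lemma cls_nonempty: "Z F \<Longrightarrow> to_cochain G M n F \<in> cls G M n F"
  by (auto simp: mem_cls)

end

subsection \<open>Maps of modules\<close>

definition gmod_map :: "('g, 'l) monoid_scheme \<Rightarrow> ('k, 'v::ab_group_add, 'g) gmodule
    \<Rightarrow> ('k, 'w::ab_group_add, 'g) gmodule \<Rightarrow> ('v \<Rightarrow> 'w) \<Rightarrow> bool" where
  "gmod_map G M N T \<longleftrightarrow>
     (\<forall>x y. T (x + y) = T x + T y) \<and> (\<forall>c x. T (c \<odot>\<^bsub>M\<^esub> x) = c \<odot>\<^bsub>N\<^esub> T x) \<and>
     (\<forall>x\<in>carrier M. T x \<in> carrier N) \<and>
     (\<forall>g\<in>carrier G. \<forall>x\<in>carrier M. T (gact M g x) = gact N g (T x))"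

lemma gmod_map_diff:
  assumes "gmod_map G M N T"
  shows "T 0 = 0" "T (x - y) = T x - T y"
proof -
  have add: "T (x + y) = T x + T y" for x y using assms by (simp add: gmod_map_def)
  show "T 0 = 0" using add[of 0 0] by simp
  show "T (x - y) = T x - T y" using add[of "x - y" y] by simp
qed

lemma cochain_map:
  "gmod_map G M N T \<Longrightarrow> cochain G M F \<Longrightarrow> cochain G N (\<lambda>xs. T (F xs))"
  using gmod_map_diff(1)[of G M N T] by (auto simp: cochain_def gmod_map_def)

lemma cobd_gmod_map: "gmod_map G M N T \<Longrightarrow> cobd (\<lambda>xs. T (F xs)) ys = T (cobd F ys)"
  by (rule cobd_linear[symmetric]) (rule gmod_map_diff)

lemma cocycle_map:
  "gmod_map G M N T \<Longrightarrow> cocycle G M F \<Longrightarrow> cocycle G N (\<lambda>xs. T (F xs))"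
  using gmod_map_diff(1)[of G M N T] by (auto simp: cocycle_def cochain_map cobd_gmod_map)

lemma cls_map_eq:
  assumes "gmod G M" "gmod G N" "gmod_map G M N T" "cocycle G M F" "cocycle G M H"
    and eq: "cls G M n F = cls G M n H"
  shows "cls G N n (\<lambda>xs. T (F xs)) = cls G N n (\<lambda>xs. T (H xs))"
proof -
  interpret M: gmod G M by fact
  interpret N: gmod G N by fact
  obtain E where E: "cochain G M E" "\<forall>xs\<in>tuples G n. F xs = H xs + cobd E xs"
    using eq M.cls_eq_iff assms by blast
  then show ?thesis
    using assms cochain_map[OF assms(3) E(1)]
    by (subst N.cls_eq_iff)
      (auto simp: cocycle_map cobd_gmod_map gmod_map_def intro!: exI[of _ "\<lambda>xs. T (E xs)"])
qed

lemma Ext_map_cls: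
  assumes "gmod G M" "gmod_map G M M T" "cocycle G M F"
  shows "Ext_map G M T n (cls G M n F) = cls G M n (\<lambda>xs. T (F xs))"
proof -
  interpret M: gmod G M by fact
  have comp: "compose (carrier (std_res G n)) T (to_cochain G M n H) = to_cochain G M n (\<lambda>xs. T (H xs))" for H
  proof -
    have "T (lin (module.smult M) H p) = lin (module.smult M) (\<lambda>xs. T (H xs)) p" for p
      by (rule linear_lin[OF M.vector_space_axioms M.vector_space_axioms])
        (use assms(2) in \<open>auto simp: gmod_map_def\<close>)
    then show ?thesis by (intro HOL.ext) (simp add: to_cochain_def compose_def)
  qed
  have "Ext_class G M n (compose (carrier (std_res G n)) T f) = cls G M n (\<lambda>xs. T (F xs))"
    if f: "f \<in> cls G M n F" for f
  proof -
    obtain H where H: "cocycle G M H" "f = to_cochain G M n H" "cls G M n H = cls G M n F"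
      using f unfolding M.mem_cls[OF assms(3)] by blast
    have "Ext_class G M n (compose (carrier (std_res G n)) T f) = cls G M n (\<lambda>xs. T (H xs))"
      unfolding H(2) comp cls_def ..
    also have "\<dots> = cls G M n (\<lambda>xs. T (F xs))"
      by (rule cls_map_eq[OF assms(1,1,2) H(1) assms(3) H(3)])
    finally show ?thesis .
  qed
  moreover have "to_cochain G M n F \<in> cls G M n F" using assms(3) by (rule M.cls_nonempty)
  ultimately show ?thesis
    unfolding Ext_map_def by blast
qed

section \<open>The Yoneda product is the cup product\<close>

lemma trivial_module_simps [simp]:
  "carrier trivial_module = UNIV" "x \<oplus>\<^bsub>trivial_module\<^esub> y = x + y"
  "\<zero>\<^bsub>trivial_module\<^esub> = 0" "module.smult trivial_module = (*)" "gact trivial_module g x = x"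
  by (simp_all add: trivial_module_def)

lemma gmod_trivial: "group G \<Longrightarrow> gmod G (trivial_module :: ('k::field, 'k, 'g) gmodule)"
  by (intro gmod.intro gmod_axioms.intro) (simp_all add: vector_space_mult algebra_simps)

lemma permutation_module_simps [simp]:
  "carrier (permutation_module B s) = {p. keys p \<subseteq> B}"
  "x \<oplus>\<^bsub>permutation_module B s\<^esub> y = x + y"
  "\<zero>\<^bsub>permutation_module B s\<^esub> = 0" "module.smult (permutation_module B s) = pm_scale"
  "gact (permutation_module B s) g = pm_push (s g)"
  by (simp_all add: permutation_module_def)

lemma pm_push_cong: "(\<And>x. x \<in> keys p \<Longrightarrow> f x = h x) \<Longrightarrow> pm_push f p = pm_push h p"
  unfolding pm_push_eq_lin by (intro pm.lin_cong) auto

lemma pm_push_ident: "pm_push (\<lambda>x. x) p = p"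
  by (simp add: pm_push_eq_lin)

lemma gmod_permutation:
  assumes "group G"
    and closed: "\<And>g x. g \<in> carrier G \<Longrightarrow> x \<in> B \<Longrightarrow> s g x \<in> B"
    and mult: "\<And>g h x. g \<in> carrier G \<Longrightarrow> h \<in> carrier G \<Longrightarrow> x \<in> B \<Longrightarrow>
      s (g \<otimes>\<^bsub>G\<^esub> h) x = s g (s h x)"
    and one: "\<And>x. x \<in> B \<Longrightarrow> s \<one>\<^bsub>G\<^esub> x = x"
  shows "gmod G (permutation_module B s :: ('k::field, 'x \<Rightarrow>\<^sub>0 'k, 'g) gmodule)"
proof (intro gmod.intro gmod_axioms.intro, simp_all add: vector_space_pm_scale assms(1)
    keys_add_subset keys_pm_scale_subset pm_push_add pm_push_scale)
  fix g and p :: "'x \<Rightarrow>\<^sub>0 'k" assume g: "g \<in> carrier G" and p: "keys p \<subseteq> B"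
  show "keys (pm_push (s g) p) \<subseteq> B"
    using keys_pm_push[of "s g" p] closed g p by blast
  fix h assume h: "h \<in> carrier G"
  show "pm_push (s (g \<otimes>\<^bsub>G\<^esub> h)) p = pm_push (s g) (pm_push (s h) p)"
    unfolding pm_push_push using mult[OF g h] p by (intro pm_push_cong) auto
next
  fix p :: "'x \<Rightarrow>\<^sub>0 'k" assume p: "keys p \<subseteq> B"
  have "pm_push (s \<one>\<^bsub>G\<^esub>) p = pm_push (\<lambda>x. x) p"
    using one p by (intro pm_push_cong) auto
  then show "pm_push (s \<one>\<^bsub>G\<^esub>) p = p" by (simp add: pm_push_ident)
qed

lemma gmod_std_res:
  assumes "group G"
  shows "gmod G (std_res G k :: ('k::field, 'g list \<Rightarrow>\<^sub>0 'k, 'g) gmodule)"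
proof -
  interpret group G by fact
  have eq: "map ((\<otimes>\<^bsub>G\<^esub>) (g \<otimes>\<^bsub>G\<^esub> h)) xs = map ((\<otimes>\<^bsub>G\<^esub>) g) (map ((\<otimes>\<^bsub>G\<^esub>) h) xs)"
    if "g \<in> carrier G" "h \<in> carrier G" "set xs \<subseteq> carrier G" for g h xs
    using that by (auto simp: m_assoc)
  have one: "map ((\<otimes>\<^bsub>G\<^esub>) \<one>\<^bsub>G\<^esub>) xs = xs" if "set xs \<subseteq> carrier G" for xs
    using that by (intro map_idI) auto
  show ?thesis
    unfolding std_res_def using eq one by (intro gmod_permutation assms) auto
qed

subsection \<open>Products of cocycles\<close>

context gmod
begin

abbreviation "K \<equiv> (trivial_module :: ('k, 'k, 'g) gmodule)"
abbreviation "cupM \<equiv> cup (module.smult M)"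

lemma gmod_K: "gmod G K"
  by (rule gmod_trivial) (rule G.group_axioms)

lemma cup_component:
  assumes "length xs = Suc (m + n)"
  shows "cupM (component m F) h xs = h (drop m xs) \<odot>\<^bsub>M\<^esub> F (take (Suc m) xs)"
proof -
  have "cupM (component m F) h xs
      = (\<Sum>i<length xs. if i = m then h (drop m xs) \<odot>\<^bsub>M\<^esub> F (take (Suc m) xs) else 0)"
    unfolding cup_eq_sum using assms by (intro sum.cong) (auto simp: component_def)
  then show ?thesis using assms by simp
qed

lemma cochain_cup:
  assumes F: "C F" and h: "cochain G K h"
  shows "C (cupM F h)"
  unfolding cochain_def
proof (intro conjI allI impI ballI)
  fix xs assume xs: "set xs \<subseteq> carrier G"
  have "F (take (Suc m) xs) \<in> carrier M" for m
    using xs set_take_subset[of "Suc m" xs] by (intro cochainD(2)[OF F]) blast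
  then show "cupM F h xs \<in> carrier M"
    unfolding cup_eq_sum by (intro sum_closed) auto
  fix g assume g: "g \<in> carrier G"
  have h': "h (map ((\<otimes>\<^bsub>G\<^esub>) g) ys) = h ys" if "set ys \<subseteq> carrier G" for ys
    using h g that by (auto simp: cochain_def)
  have "cupM F h (map ((\<otimes>\<^bsub>G\<^esub>) g) xs) = cupM (\<lambda>ys. gact M g (F ys)) h xs"
    unfolding cup_map using xs cochainD(3)[OF F g] h' by (intro cup_cong) auto
  also have "\<dots> = gact M g (cupM F h xs)"
    using g by (intro cup_linear[symmetric]) (auto simp: act_add act_smult)
  finally show "cupM F h (map ((\<otimes>\<^bsub>G\<^esub>) g) xs) = gact M g (cupM F h xs)" .
qed simp

lemma cobd_cup_cocycle:
  assumes "F [] = 0" "cocycle G K h" "set xs \<subseteq> carrier G"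
  shows "cobd (cupM F h) xs = cupM (cobd F) h xs"
proof -
  have "cupM (alt F) (cobd h) xs = 0"
    by (rule cup_zero_right) (use assms in \<open>auto simp: cocycle_def\<close>)
  moreover have "h [] = 0" using assms by (simp add: cocycle_def cochain_def)
  ultimately show ?thesis using assms by (simp add: cobd_cup)
qed

lemma cobd_cup_cobd:
  assumes "Z F" "cochain G K e" "set xs \<subseteq> carrier G"
  shows "cupM F (cobd e) xs = cobd (\<lambda>ys. - cupM (alt F) e ys) xs"
proof -
  have "cupM (cobd (alt F)) e xs = cupM (\<lambda>_. 0) e xs"
    using cocycleD(2)[OF cocycle_alt[OF assms(1)]] assms(3) by (intro cup_cong) auto
  moreover have "alt (alt F) = F" by (auto simp: alt_def fun_eq_iff)
  moreover have "e [] = 0" "F [] = 0" using assms by (auto simp: cocycle_def cochain_def)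
  ultimately have "cobd (cupM (alt F) e) xs = - cupM F (cobd e) xs"
    by (simp add: cobd_cup alt_def[of F "[]"])
  moreover have "cobd (\<lambda>ys. - cupM (alt F) e ys) xs = - cobd (cupM (alt F) e) xs"
    by (rule cobd_linear[symmetric]) simp
  ultimately show ?thesis by simp
qed

lemma cocycle_cup:
  assumes "Z F" "cocycle G K h"
  shows "Z (cupM F h)"
proof -
  have "cupM (cobd F) h xs = cupM (\<lambda>_. 0) h xs" if "set xs \<subseteq> carrier G" for xs
    using cocycleD(2)[OF assms(1)] that by (intro cup_cong) auto
  then show ?thesis
    using assms cobd_cup_cocycle[of F h] by (auto simp: cocycle_def cochain_cup) (simp add: cochain_def)
qed

text \<open>
  The first factor changes by a coboundary \<open>cobd E\<close> and the second by \<open>cobd e\<close>. By the Leibniz rule the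
  product then changes by the coboundaries of \<open>E1\<close> and \<open>E2\<close>, as the other factor is a cocycle in each
  case. In degree \<open>0\<close> there is no \<open>E\<close> to speak of, because coboundaries vanish there.
\<close>
lemma cls_cup_cong:
  assumes F: "Z F" "Z F'" "cls G M m F = cls G M m F'"
    and h: "cocycle G K h" "cocycle G K h'" "cls G K n h = cls G K n h'"
  shows "cls G M (m + n) (cupM (component m F) h) = cls G M (m + n) (cupM (component m F') h')"
proof -
  interpret K: gmod G K by (rule gmod_K)
  obtain E where E: "C E" "\<And>xs. xs \<in> tuples G m \<Longrightarrow> F xs = F' xs + cobd E xs"
    using cls_eq_iff[OF F(1,2)] F(3) by blast
  obtain e where e: "cochain G K e" "\<And>xs. xs \<in> tuples G n \<Longrightarrow> h xs = h' xs + cobd e xs"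
    using K.cls_eq_iff[OF h(1,2)] h(3) by blast
  define E1 where "E1 = cupM (if m = 0 then (\<lambda>_. 0) else component (m - 1) E) h"
  define E2 where "E2 = (\<lambda>ys. - cupM (alt (component m F')) e ys)"
  have CE: "C E1" "C E2"
    using h(1) E(1) e(1) F(2) cochain_cup[of "alt (component m F')" e] cochain_diff[OF cochain_zero]
    by (auto simp: E1_def E2_def cocycle_def intro!: cochain_cup cochain_zero cochain_component
        cochain_alt)
  have comp0: "component m (cobd E) xs = cobd (if m = 0 then (\<lambda>_. 0) else component (m - 1) E) xs"
    if "xs \<noteq> []" for xs
  proof (cases m)
    case 0
    then show ?thesis
      using cochainD(1)[OF E(1)] by (auto simp: component_def length_Suc_conv)
  qed (simp add: cobd_component)
  have "cupM (component m F) h xs = cupM (component m F') h' xs + cobd (\<lambda>ys. E1 ys + E2 ys) xs"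
    if xs: "xs \<in> tuples G (m + n)" for xs
  proof -
    have len: "length xs = Suc (m + n)" and set: "set xs \<subseteq> carrier G"
      using xs by (auto simp: tuples_def)
    have "drop m xs \<in> tuples G n" "take (Suc m) xs \<in> tuples G m"
      using xs set_drop_subset[of m xs] set_take_subset[of "Suc m" xs] by (auto simp: tuples_def)
    then have "cupM (component m F) h xs
        = cupM (component m F') h' xs + cupM (component m (cobd E)) h xs
          + cupM (component m F') (cobd e) xs"
      using E(2) e(2) by (simp add: cup_component[OF len] scale_right_distrib scale_left_distrib)
    also have "cupM (component m (cobd E)) h xs
        = cupM (cobd (if m = 0 then (\<lambda>_. 0) else component (m - 1) E)) h xs"
      using comp0 by (intro cup_cong) auto
    also have "\<dots> = cobd E1 xs"
      unfolding E1_def using E(1) h(1) set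
      by (intro cobd_cup_cocycle[symmetric]) (auto simp: cochain_def component_def)
    also have "cupM (component m F') (cobd e) xs = cobd E2 xs"
      unfolding E2_def by (rule cobd_cup_cobd[OF cocycle_component[OF F(2)] e(1) set])
    finally show ?thesis by (simp add: cobd_add add.assoc)
  qed
  then show ?thesis
    using F h CE
    by (subst cls_eq_iff) (auto intro!: cocycle_cup cocycle_component exI[of _ "\<lambda>ys. E1 ys + E2 ys"] cochain_add)
qed

end

subsection \<open>Lifts of cocycles to chain maps\<close>

definition cone :: "'g \<Rightarrow> ('g list \<Rightarrow>\<^sub>0 'k::field) \<Rightarrow> ('g list \<Rightarrow>\<^sub>0 'k)" where
  "cone a = pm_push (Cons a)"

lemma cone_diff: "cone a (p - q) = cone a p - cone a q"
  by (simp add: cone_def pm_push_eq_lin pm.lin_diff)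

text \<open>Prepending a vertex contracts the augmented standard resolution.\<close>
lemma std_diff_cone: "std_diff (cone a p) = p - cone a (std_diff p)"
proof -
  have "std_diff (cone a p) = lin pm_scale (\<lambda>xs. single xs 1
      - cobd (\<lambda>ys. single (a # ys) 1) xs) p"
    by (simp add: cone_def std_diff_eq_lin lin_pm_push[OF vector_space_pm_scale])
  also have "\<dots> = p - lin pm_scale (\<lambda>xs. cone a (cobd (\<lambda>ys. single ys 1) xs)) p"
    by (simp add: pm.lin_fun_diff cobd_linear[where L = "cone a"] cone_diff) (simp add: cone_def)
  also have "lin pm_scale (\<lambda>xs. cone a (cobd (\<lambda>ys. single ys 1) xs)) p
      = cone a (std_diff p)"
    unfolding std_diff_eq_lin
    by (rule linear_lin[symmetric, OF vector_space_pm_scale vector_space_pm_scale])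
      (auto simp: cone_def pm_push_add pm_push_scale)
  finally show ?thesis .
qed

lemma Nil_notin_tuples: "[] \<notin> tuples G n"
  by (simp add: tuples_def)

text \<open>
  The differential of the standard resolution is the alternating sum over all faces also in degree
  \<open>0\<close>, where it is the augmentation, with the empty list as basis of the ground field.
\<close>
lemma std_diff_degree_zero:
  assumes "keys p \<subseteq> tuples G 0"
  shows "std_diff p = single [] (std_aug p)"
proof -
  have "std_diff p = lin pm_scale (\<lambda>xs. single [] 1) p"
    unfolding std_diff_eq_lin using assms
    by (intro pm.lin_cong) (auto simp: tuples_def length_Suc_conv)
  also have "\<dots> = single [] (std_aug p)"
    by (rule poly_mapping_eqI)
      (simp add: lin_def std_aug_def lookup_sum lookup_single when_def)
  finally show ?thesis .
qed

definition front_face :: "nat \<Rightarrow> 'g list \<Rightarrow> ('g list \<Rightarrow>\<^sub>0 'k::field)" where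
  "front_face k = component k (\<lambda>ys. single ys 1)"

lemma std_diff_front_face: "std_diff (front_face (Suc k) xs) = cobd (front_face k) xs"
  by (simp add: front_face_def cobd_component) (simp add: component_def std_diff_eq_lin)

lemma cochain_front_face: "cochain G (std_res G k) (front_face k)"
  by (auto simp: cochain_def front_face_def component_def tuples_def)

context gmod
begin

abbreviation "P n \<equiv> (std_res G n :: ('k, 'g list \<Rightarrow>\<^sub>0 'k, 'g) gmodule)"

lemma gmod_P: "gmod G (P n)"
  by (rule gmod_std_res) (rule G.group_axioms)

text \<open>
  The map that sends a tuple to its front face, with the value of \<open>h\<close> on the back face as
  coefficient, is a chain map without any sign: it is the cup product of the tautological cochain
  \<^const>\<open>front_face\<close> with the cocycle \<open>h\<close>, and the differential of the resolution turns the tautological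
  cochain of one degree into the coboundary of that of the preceding degree.
\<close>
lemma chain_lift_front_face:
  assumes h: "cocycle G K h"
  shows "chain_lift G n (to_cochain G K n h)
    (\<lambda>k. to_cochain G (P k) (n + k) (cup pm_scale (front_face k) h))"
  unfolding chain_lift_def
proof (intro conjI allI ballI)
  fix k
  interpret Pk: gmod G "P k" by (rule gmod_P)
  have "cochain G (P k) (cup pm_scale (front_face k) h)"
    using Pk.cochain_cup[OF cochain_front_face, of h] h
    by (simp add: cocycle_def std_res_def)
  from Pk.to_cochain_in_cochains[OF this, of "n + k"]
  show "to_cochain G (P k) (n + k) (cup pm_scale (front_face k) h) \<in> ghom_set G (P (n + k)) (P k)"
    by (simp add: cochains_def ghom_space_def)
next
  fix x assume x: "x \<in> carrier (P n)"
  let ?L = "lin (*) (\<lambda>_. 1 :: 'k)"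
  have L: "?L (p + q) = ?L p + ?L q" "?L (pm_scale c p) = c * ?L p"
    for p q :: "'g list \<Rightarrow>\<^sub>0 'k" and c
    using vector_space.lin_add[OF vector_space_mult, of "\<lambda>_. 1"]
      vector_space.lin_scale[OF vector_space_mult, of "\<lambda>_. 1"] by auto
  have "?L (cup pm_scale (front_face 0) h xs) = h xs" for xs
  proof -
    have "?L (cup pm_scale (front_face 0) h xs) = cup (*) (\<lambda>ys. ?L (front_face 0 ys)) h xs"
      by (rule cup_linear) (rule L)+
    also have "(\<lambda>ys. ?L (front_face 0 ys)) = cup_unit"
      by (auto simp: fun_eq_iff front_face_def component_def cup_unit_def
          vector_space.lin_single[OF vector_space_mult] vector_space.lin_zero[OF vector_space_mult])
    finally show ?thesis using h by (auto simp: cup_unit_cup cocycle_def cochain_def)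
  qed
  then show "std_aug (to_cochain G (P 0) (n + 0) (cup pm_scale (front_face 0) h) x)
      = to_cochain G K n h x"
    using x by (simp add: to_cochain_def std_aug_eq_lin lin_lin[OF vector_space_mult])
next
  fix k x assume x: "x \<in> carrier (P (n + Suc k))"
  have "std_diff (cup pm_scale (front_face (Suc k)) h xs) = cobd (cup pm_scale (front_face k) h) xs"
    if xs: "set xs \<subseteq> carrier G" for xs
  proof -
    have "std_diff (cup pm_scale (front_face (Suc k)) h xs)
        = cup pm_scale (\<lambda>ys. std_diff (front_face (Suc k) ys)) h xs"
      by (rule cup_linear) (simp_all add: std_diff_eq_lin pm.lin_add pm.lin_scale)
    also have "\<dots> = cup pm_scale (cobd (front_face k)) h xs"
      unfolding std_diff_front_face ..
    also have "\<dots> = cobd (cup pm_scale (front_face k) h) xs"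
      using gmod.cobd_cup_cocycle[OF gmod_P[of k], of "front_face k" h xs] h xs
      by (simp add: front_face_def component_def std_res_def)
    finally show ?thesis .
  qed
  note eq = this
  have "std_diff (lin pm_scale (cup pm_scale (front_face (Suc k)) h) x)
      = lin pm_scale (\<lambda>xs. std_diff (cup pm_scale (front_face (Suc k)) h xs)) x"
    unfolding std_diff_eq_lin
    by (rule linear_lin[OF vector_space_pm_scale vector_space_pm_scale]) (auto simp: pm.lin_add pm.lin_scale)
  also have "\<dots> = lin pm_scale (cobd (cup pm_scale (front_face k) h)) x"
    using x eq by (intro pm.lin_cong) (auto simp: tuples_def)
  finally show "std_diff (to_cochain G (P (Suc k)) (n + Suc k) (cup pm_scale (front_face (Suc k)) h) x)
      = to_cochain G (P k) (n + k) (cup pm_scale (front_face k) h) (std_diff x)"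
    using x std_diff_closed[of x G "n + k"]
    by (simp add: to_cochain_def lin_std_diff[OF vector_space_pm_scale])
qed


text \<open>
  A family of cochains with values in the resolution that commutes with the differentials and has
  augmentation zero is null-homotopic. The homotopy contracts towards the first vertex of each
  tuple, which makes it equivariant.
\<close>
lemma null_homotopy:
  fixes \<Psi> :: "nat \<Rightarrow> 'g list \<Rightarrow> ('g list \<Rightarrow>\<^sub>0 'k)"
  assumes cochain: "\<And>k. cochain G (P k) (\<Psi> k)"
    and aug: "\<And>xs. xs \<in> tuples G n \<Longrightarrow> std_aug (\<Psi> 0 xs) = 0"
    and comm: "\<And>k xs. xs \<in> tuples G (Suc (n + k)) \<Longrightarrow> std_diff (\<Psi> (Suc k) xs) = cobd (\<Psi> k) xs"
  obtains h where "\<And>k. cochain G (P (Suc k)) (h k)"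
    "\<And>xs. xs \<in> tuples G n \<Longrightarrow> std_diff (h 0 xs) = \<Psi> 0 xs"
    "\<And>k xs. xs \<in> tuples G (Suc (n + k)) \<Longrightarrow>
       std_diff (h (Suc k) xs) = \<Psi> (Suc k) xs - cobd (h k) xs"
proof -
  define contract :: "nat \<Rightarrow> ('g list \<Rightarrow> ('g list \<Rightarrow>\<^sub>0 'k)) \<Rightarrow> 'g list \<Rightarrow> ('g list \<Rightarrow>\<^sub>0 'k)"
    where "contract k D xs = (if xs \<in> tuples G k then cone (hd xs) (D xs) else 0)" for k D xs
  define h where "h = rec_nat (contract n (\<Psi> 0))
    (\<lambda>k hk. contract (n + Suc k) (\<lambda>xs. \<Psi> (Suc k) xs - cobd hk xs))"
  have h0: "h 0 = contract n (\<Psi> 0)"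
    and hSuc: "h (Suc k) = contract (n + Suc k) (\<lambda>xs. \<Psi> (Suc k) xs - cobd (h k) xs)" for k
    by (simp_all add: h_def)
  have contract: "cochain G (P (Suc k)) (contract j D)" if D: "cochain G (P k) D" for j k D
    unfolding cochain_def
  proof (intro conjI allI impI ballI)
    show "contract j D [] = 0" by (simp add: contract_def tuples_def)
    fix xs assume xs: "set xs \<subseteq> carrier G"
    have D': "keys (D xs) \<subseteq> tuples G k" using D xs by (auto simp: cochain_def)
    have "keys (cone (hd xs) (D xs)) \<subseteq> tuples G (Suc k)" if "xs \<noteq> []"
      using keys_pm_push[of "Cons (hd xs)" "D xs"] D' xs hd_in_set[OF that]
      by (fastforce simp: cone_def tuples_def)
    then show "contract j D xs \<in> carrier (P (Suc k))"
      by (cases "xs = []") (simp_all add: contract_def Nil_notin_tuples)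
    fix g assume g: "g \<in> carrier G"
    have "map ((\<otimes>\<^bsub>G\<^esub>) g) xs \<in> tuples G j \<longleftrightarrow> xs \<in> tuples G j"
      using xs g by (auto simp: tuples_def)
    moreover have "cone (hd (map ((\<otimes>\<^bsub>G\<^esub>) g) xs)) (D (map ((\<otimes>\<^bsub>G\<^esub>) g) xs))
        = pm_push (map ((\<otimes>\<^bsub>G\<^esub>) g)) (cone (hd xs) (D xs))" if "xs \<noteq> []"
      using D g xs that by (simp add: cochain_def cone_def pm_push_push hd_map)
    ultimately show "contract j D (map ((\<otimes>\<^bsub>G\<^esub>) g) xs) = gact (P (Suc k)) g (contract j D xs)"
      by (cases "xs = []") (simp_all add: contract_def Nil_notin_tuples)
  qed
  have coch: "cochain G (P (Suc k)) (h k)" for k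
  proof (induction k)
    case 0
    then show ?case unfolding h0 by (rule contract) (rule cochain)
  next
    case (Suc k)
    interpret Pk: gmod G "P (Suc k)" by (rule gmod_P)
    show ?case unfolding hSuc
      by (intro contract Pk.cochain_diff Pk.cochain_cobd cochain Suc)
  qed
  have base: "std_diff (h 0 xs) = \<Psi> 0 xs" if xs: "xs \<in> tuples G n" for xs
  proof -
    have "keys (\<Psi> 0 xs) \<subseteq> tuples G 0"
      using cochain[of 0] xs by (auto simp: cochain_def tuples_def)
    then have "std_diff (\<Psi> 0 xs) = 0"
      using aug[OF xs] by (simp add: std_diff_degree_zero)
    then show ?thesis using xs by (simp add: h0 contract_def std_diff_cone) (simp add: cone_def)
  qed
  have step_aux: "std_diff (h (Suc k) xs) = \<Psi> (Suc k) xs - cobd (h k) xs"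
    if xs: "xs \<in> tuples G (Suc (n + k))"
      and eq: "cobd (\<lambda>ys. std_diff (h k ys)) xs = cobd (\<Psi> k) xs" for k xs
  proof -
    have "std_diff (\<Psi> (Suc k) xs - cobd (h k) xs) = 0"
      using comm[OF xs] eq by (simp add: std_diff_diff cobd_linear[where L = std_diff])
    then show ?thesis
      using xs by (simp add: hSuc contract_def std_diff_cone) (simp add: cone_def)
  qed
  have step: "xs \<in> tuples G (Suc (n + k)) \<Longrightarrow>
      std_diff (h (Suc k) xs) = \<Psi> (Suc k) xs - cobd (h k) xs" for k xs
  proof (induction k arbitrary: xs)
    case (0 xs)
    have "cobd (\<lambda>ys. std_diff (h 0 ys)) xs = cobd (\<Psi> 0) xs"
      using 0 base by (intro cobd_cong) (auto simp: tuples_def)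
    then show ?case by (rule step_aux[OF 0])
  next
    case (Suc k xs)
    have "cobd (\<lambda>ys. std_diff (h (Suc k) ys)) xs = cobd (\<lambda>ys. \<Psi> (Suc k) ys - cobd (h k) ys) xs"
      using Suc.prems Suc.IH by (intro cobd_cong) (auto simp: tuples_def)
    then have "cobd (\<lambda>ys. std_diff (h (Suc k) ys)) xs = cobd (\<Psi> (Suc k)) xs"
      by (simp add: cobd_diff)
    then show ?case by (rule step_aux[OF Suc.prems])
  qed
  show thesis by (rule that[OF coch base step])
qed

lemma gmod_map_lin:
  assumes "C F"
  shows "gmod_map G (P n) M (lin (module.smult M) F)"
proof -
  have "to_cochain G M n F \<in> ghom_set G (P n) M"
    using to_cochain_in_cochains[OF assms, of n] by (simp add: cochains_def ghom_space_def)
  then have f: "\<And>p. keys p \<subseteq> tuples G n \<Longrightarrow> to_cochain G M n F p \<in> carrier M"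
    "\<And>g p. g \<in> carrier G \<Longrightarrow> keys p \<subseteq> tuples G n \<Longrightarrow>
       to_cochain G M n F (pm_push (map ((\<otimes>\<^bsub>G\<^esub>) g)) p) = gact M g (to_cochain G M n F p)"
    by (auto simp: ghom_set_def linear_map_def)
  have "keys (pm_push (map ((\<otimes>\<^bsub>G\<^esub>) g)) p) \<subseteq> tuples G n"
    if "g \<in> carrier G" "keys p \<subseteq> tuples G n" for g and p :: "'g list \<Rightarrow>\<^sub>0 'k"
    using gmod.act_closed[OF gmod_P, of g p n] that by simp
  with f show ?thesis
    by (auto simp: gmod_map_def to_cochain_def lin_add lin_scale)
qed

lemma chain_lift_values:
  assumes "chain_lift G n g \<phi>"
  obtains \<Phi> where "\<And>k. cochain G (P k) (\<Phi> k)" "\<And>k. \<phi> k = to_cochain G (P k) (n + k) (\<Phi> k)"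
    "\<And>xs. xs \<in> tuples G n \<Longrightarrow> std_aug (\<Phi> 0 xs) = g (single xs 1)"
    "\<And>k xs. xs \<in> tuples G (Suc (n + k)) \<Longrightarrow> std_diff (\<Phi> (Suc k) xs) = cobd (\<Phi> k) xs"
proof -
  have "\<exists>F. cochain G (P k) F \<and> \<phi> k = to_cochain G (P k) (n + k) F" for k
  proof -
    interpret Pk: gmod G "P k" by (rule gmod_P)
    have "\<phi> k \<in> carrier (cochains G (P k) (n + k))"
      using assms by (simp add: chain_lift_def cochains_def ghom_space_def)
    then show ?thesis by (elim Pk.cochains_obtain) blast
  qed
  then obtain \<Phi> where \<Phi>: "\<And>k. cochain G (P k) (\<Phi> k)" "\<And>k. \<phi> k = to_cochain G (P k) (n + k) (\<Phi> k)"
    by metis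
  have val: "\<phi> k (single xs 1) = \<Phi> k xs" if "xs \<in> tuples G (n + k)" for k xs
    using that by (simp add: \<Phi>(2) to_cochain_def)
  have aug: "std_aug (\<Phi> 0 xs) = g (single xs 1)" if "xs \<in> tuples G n" for xs
  proof -
    have "single xs 1 \<in> carrier (P n)" using that by simp
    with assms have "std_aug (\<phi> 0 (single xs 1)) = g (single xs 1)"
      unfolding chain_lift_def by blast
    then show ?thesis using val[of xs 0] that by simp
  qed
  have comm: "std_diff (\<Phi> (Suc k) xs) = cobd (\<Phi> k) xs" if xs: "xs \<in> tuples G (Suc (n + k))" for k xs
  proof -
    have s: "single xs 1 \<in> carrier (P (n + Suc k))" using xs by simp
    have "std_diff (\<phi> (Suc k) (single xs 1)) = \<phi> k (std_diff (single xs 1))"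
      using assms s unfolding chain_lift_def by blast
    moreover have "\<phi> k (std_diff (single xs 1)) = cobd (\<Phi> k) xs"
      using s std_diff_closed[of "single xs (1 :: 'k)" G "n + k"]
      by (simp add: \<Phi>(2) to_cochain_def lin_std_diff[OF vector_space_pm_scale] del: std_diff_single)
    ultimately show ?thesis using val[of xs "Suc k"] xs by simp
  qed
  show thesis by (rule that[OF \<Phi> aug comm])
qed

text \<open>
  Any lift of \<open>h\<close> differs from the one by front faces by a null-homotopic family. After composition
  with the cocycle \<open>F\<close>, the part \<open>d h'\<close> of the homotopy formula vanishes and the other part becomes
  the coboundary of \<open>F \<circ> h'\<close>. So the class does not depend on the lift.
\<close>
lemma compose_chain_lift:
  assumes F: "Z F" and h: "cocycle G K h" and lift: "chain_lift G n (to_cochain G K n h) \<phi>"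
  shows "Ext_class G M (m + n) (compose (carrier (P (m + n))) (to_cochain G M m F) (\<phi> m))
    = cls G M (m + n) (cupM (component m F) h)"
proof -
  obtain \<Phi> where \<Phi>: "\<And>k. cochain G (P k) (\<Phi> k)" "\<And>k. \<phi> k = to_cochain G (P k) (n + k) (\<Phi> k)"
    "\<And>xs. xs \<in> tuples G n \<Longrightarrow> std_aug (\<Phi> 0 xs) = to_cochain G K n h (single xs 1)"
    "\<And>k xs. xs \<in> tuples G (Suc (n + k)) \<Longrightarrow> std_diff (\<Phi> (Suc k) xs) = cobd (\<Phi> k) xs"
    using chain_lift_values[OF lift] by blast
  obtain \<Theta> where \<Theta>: "\<And>k. cochain G (P k) (\<Theta> k)"
    "\<And>k. to_cochain G (P k) (n + k) (cup pm_scale (front_face k) h) = to_cochain G (P k) (n + k) (\<Theta> k)"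
    "\<And>xs. xs \<in> tuples G n \<Longrightarrow> std_aug (\<Theta> 0 xs) = to_cochain G K n h (single xs 1)"
    "\<And>k xs. xs \<in> tuples G (Suc (n + k)) \<Longrightarrow> std_diff (\<Theta> (Suc k) xs) = cobd (\<Theta> k) xs"
    using chain_lift_values[OF chain_lift_front_face[OF h]] by blast
  define \<Psi> where "\<Psi> k xs = \<Phi> k xs - \<Theta> k xs" for k xs
  have "cochain G (P k) (\<Psi> k)" for k
    using gmod.cochain_diff[OF gmod_P \<Phi>(1) \<Theta>(1)] by (simp add: \<Psi>_def[abs_def])
  moreover have "std_aug (\<Psi> 0 xs) = 0" if "xs \<in> tuples G n" for xs
    using \<Phi>(3) \<Theta>(3) that
    by (simp add: \<Psi>_def std_aug_eq_lin vector_space.lin_diff[OF vector_space_mult])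
  moreover have "std_diff (\<Psi> (Suc k) xs) = cobd (\<Psi> k) xs" if "xs \<in> tuples G (Suc (n + k))" for k xs
    using \<Phi>(4) \<Theta>(4) that by (simp add: \<Psi>_def[abs_def] std_diff_diff cobd_diff)
  ultimately obtain h' where h': "\<And>k. cochain G (P (Suc k)) (h' k)"
    "\<And>xs. xs \<in> tuples G n \<Longrightarrow> std_diff (h' 0 xs) = \<Psi> 0 xs"
    "\<And>k xs. xs \<in> tuples G (Suc (n + k)) \<Longrightarrow>
       std_diff (h' (Suc k) xs) = \<Psi> (Suc k) xs - cobd (h' k) xs"
    using null_homotopy[of \<Psi> n] by metis
  let ?L = "lin (module.smult M) F"
  define E where "E = (case m of 0 \<Rightarrow> (\<lambda>_. 0) | Suc k \<Rightarrow> (\<lambda>ys. ?L (h' k ys)))"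
  have E: "C E"
    using h'(1) gmod_map_lin[of F] cocycleD(1)[OF F]
    by (auto simp: E_def cochain_zero split: nat.split intro: cochain_map)
  have diff0: "?L (std_diff p) = 0" if "keys p \<subseteq> tuples G (Suc m)" for p
  proof -
    have "?L (std_diff p) = lin (module.smult M) (\<lambda>_. 0) p"
      unfolding lin_std_diff[OF vector_space_axioms]
      using that cocycleD(2)[OF F] by (intro lin_cong) (auto simp: tuples_def)
    then show ?thesis by (simp add: lin_def)
  qed
  have \<Psi>_eq: "?L (\<Psi> m xs) = cobd E xs" if xs: "xs \<in> tuples G (m + n)" for xs
  proof (cases m)
    case 0
    then have "?L (\<Psi> m xs) = ?L (std_diff (h' 0 xs))" using xs h'(2) by simp
    also have "\<dots> = 0"
      using h'(1)[of 0] xs 0 by (intro diff0) (auto simp: cochain_def tuples_def)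
    finally show ?thesis by (simp add: E_def 0)
  next
    case (Suc k)
    then have "\<Psi> m xs = std_diff (h' m xs) + cobd (h' k) xs"
      using xs h'(3)[of xs k] by (simp add: add.commute)
    moreover have "?L (std_diff (h' m xs)) = 0"
      using h'(1)[of m] xs by (intro diff0) (auto simp: cochain_def tuples_def)
    ultimately show ?thesis
      by (simp add: lin_add E_def Suc cobd_linear[where L = ?L] lin_diff)
  qed
  have \<Theta>_eq: "?L (\<Theta> m xs) = cupM (component m F) h xs" if xs: "xs \<in> tuples G (m + n)" for xs
  proof -
    have "\<Theta> m xs = cup pm_scale (front_face m) h xs"
      using \<Theta>(2)[of m] xs
      by (simp add: gmod.to_cochain_eq_iff[OF gmod_P] add.commute)
    also have "?L \<dots> = cupM (\<lambda>ys. ?L (front_face m ys)) h xs"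
      by (rule cup_linear) (simp_all add: lin_add lin_scale)
    also have "(\<lambda>ys. ?L (front_face m ys)) = component m F"
      by (auto simp: front_face_def component_def fun_eq_iff)
    finally show ?thesis .
  qed
  have "Ext_class G M (m + n) (compose (carrier (P (m + n))) (to_cochain G M m F) (\<phi> m))
      = cls G M (m + n) (\<lambda>xs. ?L (\<Phi> m xs))"
  proof -
    have "\<phi> m \<in> ghom_set G (P (n + m)) (P m)" using lift by (simp add: chain_lift_def)
    then have \<phi>: "keys (\<phi> m x) \<subseteq> tuples G m"
      if "keys x \<subseteq> tuples G (m + n)" for x
      using that by (auto simp: ghom_set_def linear_map_def add.commute)
    have "compose (carrier (P (m + n))) (to_cochain G M m F) (\<phi> m)
        = to_cochain G M (m + n) (\<lambda>xs. ?L (\<Phi> m xs))"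
    proof
      fix x
      show "compose (carrier (P (m + n))) (to_cochain G M m F) (\<phi> m) x
          = to_cochain G M (m + n) (\<lambda>xs. ?L (\<Phi> m xs)) x"
      proof (cases "keys x \<subseteq> tuples G (m + n)")
        case True
        moreover from True have "\<phi> m x = lin pm_scale (\<Phi> m) x"
          by (simp add: \<Phi>(2) to_cochain_def add.commute)
        ultimately show ?thesis
          using \<phi>[OF True]
          by (simp add: compose_def to_cochain_def lin_lin[OF vector_space_axioms])
      qed (simp add: compose_def to_cochain_def)
    qed
    then show ?thesis by (simp add: cls_def)
  qed
  also have "\<dots> = cls G M (m + n) (\<lambda>xs. cupM (component m F) h xs + cobd E xs)"
  proof (rule cls_cong)
    fix xs assume xs: "xs \<in> tuples G (m + n)"
    have "\<Phi> m xs = \<Theta> m xs + \<Psi> m xs" by (simp add: \<Psi>_def)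
    then show "?L (\<Phi> m xs) = cupM (component m F) h xs + cobd E xs"
      using \<Psi>_eq[OF xs] \<Theta>_eq[OF xs] by (simp add: lin_add)
  qed
  also have "\<dots> = cls G M (m + n) (cupM (component m F) h)"
    using F h E
    by (subst cls_eq_iff) (auto intro!: cocycle_add cocycle_cup cocycle_component cocycle_cobd)
  finally show ?thesis .
qed

theorem yoneda_cls:
  assumes F: "Z F" and h: "cocycle G K h"
  shows "yoneda G M m n (cls G M m F) (cls G K n h) = cls G M (m + n) (cupM (component m F) h)"
proof -
  interpret K: gmod G K by (rule gmod_K)
  have "Ext_class G M (m + n) (compose (carrier (P (m + n))) f (\<phi> m))
      = cls G M (m + n) (cupM (component m F) h)"
    if f: "f \<in> cls G M m F" and g: "g \<in> cls G K n h" and \<phi>: "chain_lift G n g \<phi>" for f g \<phi>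
  proof -
    obtain F' where F': "Z F'" "f = to_cochain G M m F'" "cls G M m F' = cls G M m F"
      using f unfolding mem_cls[OF F] by blast
    obtain g' where g': "cocycle G K g'" "g = to_cochain G K n g'" "cls G K n g' = cls G K n h"
      using g unfolding K.mem_cls[OF h] by blast
    show ?thesis
      using compose_chain_lift[OF F'(1) g'(1), of n \<phi> m] \<phi>
        cls_cup_cong[OF F'(1) F F'(3) g'(1) h g'(3)]
      unfolding F'(2) g'(2) by simp
  qed
  note eq = this
  have mem: "to_cochain G M m F \<in> cls G M m F" "to_cochain G K n h \<in> cls G K n h"
    using F h by (auto intro: cls_nonempty K.cls_nonempty)
  obtain \<phi> where \<phi>: "chain_lift G n (to_cochain G K n h) \<phi>"
    using chain_lift_front_face[OF h] by blast
  show ?thesis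
  proof (intro subset_antisym subsetI)
    fix x assume "x \<in> yoneda G M m n (cls G M m F) (cls G K n h)"
    then obtain f g \<phi> where "f \<in> cls G M m F" "g \<in> cls G K n h" "chain_lift G n g \<phi>"
      "x \<in> Ext_class G M (m + n) (compose (carrier (P (m + n))) f (\<phi> m))"
      unfolding yoneda_def by (elim UN_E CollectE)
    then show "x \<in> cls G M (m + n) (cupM (component m F) h)" using eq by metis
  next
    fix x assume "x \<in> cls G M (m + n) (cupM (component m F) h)"
    then have "x \<in> Ext_class G M (m + n)
        (compose (carrier (P (m + n))) (to_cochain G M m F) (\<phi> m))"
      unfolding eq[OF mem \<phi>] .
    then show "x \<in> yoneda G M m n (cls G M m F) (cls G K n h)"
      unfolding yoneda_def by (intro UN_I[OF mem(1)] UN_I[OF mem(2)] UN_I[of \<phi>] CollectI \<phi>)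
  qed
qed

end

section \<open>The cohomology ring and its modules\<close>

text \<open>
  A single function on lists of all lengths represents an element of the graded space of cohomology,
  one class in each degree.
\<close>
definition CLS :: "('g, 'l) monoid_scheme \<Rightarrow> ('k::field, 'v::ab_group_add, 'g) gmodule
    \<Rightarrow> ('g list \<Rightarrow> 'v) \<Rightarrow> nat \<Rightarrow> (('g list \<Rightarrow>\<^sub>0 'k) \<Rightarrow> 'v) set" where
  "CLS G M F = (\<lambda>n. cls G M n F)"

text \<open>
  The counterpart, for representatives, of the finite support of the elements of a direct sum.
\<close>
definition bounded_degree :: "('g list \<Rightarrow> 'v::zero) \<Rightarrow> bool" where
  "bounded_degree F \<longleftrightarrow> (\<exists>N. \<forall>xs. length xs > N \<longrightarrow> F xs = 0)"

lemma bounded_degree_zero: "bounded_degree (\<lambda>xs. 0)"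
  by (simp add: bounded_degree_def)

lemma bounded_degree_component: "bounded_degree (component n F)"
  by (auto simp: bounded_degree_def component_def intro!: exI[of _ "Suc n"])

lemma bounded_degree_pointwise:
  assumes "bounded_degree F" "bounded_degree H" "f 0 0 = 0"
  shows "bounded_degree (\<lambda>xs. f (F xs) (H xs))"
proof -
  obtain N N' where "\<forall>xs. length xs > N \<longrightarrow> F xs = 0" "\<forall>xs. length xs > N' \<longrightarrow> H xs = 0"
    using assms by (auto simp: bounded_degree_def)
  then show ?thesis
    using assms(3) by (auto simp: bounded_degree_def intro!: exI[of _ "max N N'"])
qed

lemma bounded_degree_add:
  "bounded_degree F \<Longrightarrow> bounded_degree H \<Longrightarrow> bounded_degree (\<lambda>xs. F xs + (H xs :: 'v::ab_group_add))"
  by (rule bounded_degree_pointwise) auto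

lemma bounded_degree_compose:
  "bounded_degree F \<Longrightarrow> f 0 = 0 \<Longrightarrow> bounded_degree (\<lambda>xs. f (F xs))"
  using bounded_degree_pointwise[of F F "\<lambda>x y. f x"] by simp

lemma finsum_presentation:
  fixes q :: "('a \<Rightarrow> 'v::ab_group_add) \<Rightarrow> 'w" and W :: "('k::field, 'w, 'm) module_scheme"
  assumes W: "kspace W" and Q: "Q (\<lambda>x. 0)" "\<And>a b. Q a \<Longrightarrow> Q b \<Longrightarrow> Q (\<lambda>x. a x + b x)"
    and carrier: "\<And>a. Q a \<Longrightarrow> q a \<in> carrier W" and zero: "\<zero>\<^bsub>W\<^esub> = q (\<lambda>x. 0)"
    and add: "\<And>a b. Q a \<Longrightarrow> Q b \<Longrightarrow> q a \<oplus>\<^bsub>W\<^esub> q b = q (\<lambda>x. a x + b x)"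
    and I: "finite I" "\<And>i. i \<in> I \<Longrightarrow> Q (f i)"
  shows "finsum W (\<lambda>i. q (f i)) I = q (\<lambda>x. \<Sum>i\<in>I. f i x)"
proof -
  interpret W: Module.module "ring_of_type_algebra :: 'k ring" W by fact
  have "Q (\<lambda>x. \<Sum>i\<in>I. f i x) \<and> finsum W (\<lambda>i. q (f i)) I = q (\<lambda>x. \<Sum>i\<in>I. f i x)"
    using I
  proof (induction I rule: finite_induct)
    case (insert i I)
    then show ?case
      by (subst W.finsum_insert) (auto simp: Q carrier add)
  qed (simp add: zero Q)
  then show ?thesis by simp
qed

lemma tuplesD: "xs \<in> tuples G n \<Longrightarrow> xs \<noteq> [] \<and> set xs \<subseteq> carrier G"
  by (auto simp: tuples_def)

context gmod
begin

abbreviation "ZB F \<equiv> Z F \<and> bounded_degree F"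

lemma Ext_finsum:
  assumes "finite I" "\<And>i. i \<in> I \<Longrightarrow> Z (F i)"
  shows "finsum (Ext G M n) (\<lambda>i. cls G M n (F i)) I = cls G M n (\<lambda>xs. \<Sum>i\<in>I. F i xs)"
  by (rule finsum_presentation[OF kspace_Ext, where Q = Z])
    (use assms in \<open>auto simp: cocycle_zero cocycle_add carrier_Ext Ext_zero Ext_add\<close>)

lemma cls_eq_zero:
  assumes "\<forall>xs. length xs > n \<longrightarrow> F xs = 0"
  shows "cls G M n F = \<zero>\<^bsub>Ext G M n\<^esub>"
  unfolding Ext_zero using assms by (intro cls_cong) (auto simp: tuples_def)

lemma carrier_coh: "carrier (coh G M) = CLS G M ` {F. ZB F}"
proof (intro subset_antisym subsetI)
  fix x assume "x \<in> CLS G M ` {F. ZB F}"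
  then obtain F N where F: "x = CLS G M F" "Z F" "\<forall>xs. length xs > N \<longrightarrow> F xs = 0"
    by (auto simp: bounded_degree_def)
  have "n \<in> {..N}" if "x n \<noteq> \<zero>\<^bsub>Ext G M n\<^esub>" for n
  proof (rule ccontr)
    assume "n \<notin> {..N}"
    then have "cls G M n F = \<zero>\<^bsub>Ext G M n\<^esub>" using F(3) by (intro cls_eq_zero) auto
    with that show False by (simp add: F(1) CLS_def)
  qed
  then have "{n. x n \<noteq> \<zero>\<^bsub>Ext G M n\<^esub>} \<subseteq> {..N}" by blast
  then have "finite {n. x n \<noteq> \<zero>\<^bsub>Ext G M n\<^esub>}"
    by (rule finite_subset) simp
  moreover have "x n \<in> carrier (Ext G M n)" for n
    using F(2) unfolding F(1) CLS_def carrier_Ext by (intro imageI) simp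
  ultimately show "x \<in> carrier (coh G M)"
    by (simp add: coh_def direct_sum_def)
next
  fix x assume "x \<in> carrier (coh G M)"
  then have x: "\<And>n. x n \<in> carrier (Ext G M n)" "finite {n. x n \<noteq> \<zero>\<^bsub>Ext G M n\<^esub>}"
    by (auto simp: coh_def direct_sum_def)
  have "\<exists>F. Z F \<and> x n = cls G M n F \<and> (x n = \<zero>\<^bsub>Ext G M n\<^esub> \<longrightarrow> F = (\<lambda>xs. 0))" for n
    using x(1)[of n] by (cases "x n = \<zero>\<^bsub>Ext G M n\<^esub>") (auto simp: carrier_Ext Ext_zero cocycle_zero)
  then obtain F where F: "\<And>n. Z (F n)" "\<And>n. x n = cls G M n (F n)"
    "\<And>n. x n = \<zero>\<^bsub>Ext G M n\<^esub> \<Longrightarrow> F n = (\<lambda>xs. 0)" by metis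
  define H where "H xs = (if xs = [] then 0 else F (length xs - 1) xs)" for xs
  obtain N where N: "\<And>n. x n \<noteq> \<zero>\<^bsub>Ext G M n\<^esub> \<Longrightarrow> n \<le> N"
    using x(2) by (auto simp: finite_nat_set_iff_bounded_le)
  have "H xs = 0" if "length xs > Suc N" for xs
  proof -
    have "x (length xs - 1) = \<zero>\<^bsub>Ext G M (length xs - 1)\<^esub>"
    proof (rule ccontr)
      assume "x (length xs - 1) \<noteq> \<zero>\<^bsub>Ext G M (length xs - 1)\<^esub>"
      then have "length xs - 1 \<le> N" by (rule N)
      with that show False by simp
    qed
    then show ?thesis using F(3) by (simp add: H_def)
  qed
  then have "bounded_degree H" by (auto simp: bounded_degree_def)
  moreover have "Z H"
    unfolding cocycle_def
  proof (intro conjI allI impI)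
    show "C H"
      using F(1) by (auto simp: cochain_def cocycle_def H_def)
    fix xs assume xs: "set xs \<subseteq> carrier G"
    have "cobd H xs = cobd (F (length xs - 2)) xs"
    proof (rule cobd_cong)
      fix ys :: "'g list" assume "Suc (length ys) = length xs"
      then have "length xs - 2 = length ys - 1" by simp
      then show "H ys = F (length xs - 2) ys"
        using cochainD(1)[OF cocycleD(1)[OF F(1)]] by (simp add: H_def)
    qed
    then show "cobd H xs = 0" using cocycleD(2)[OF F(1) xs] by simp
  qed
  moreover have "x = CLS G M H"
    unfolding CLS_def F(2)[abs_def] by (intro HOL.ext cls_cong) (auto simp: H_def tuples_def)
  ultimately show "x \<in> CLS G M ` {F. ZB F}" by auto
qed

lemma CLS_cong: "(\<And>xs. xs \<noteq> [] \<Longrightarrow> set xs \<subseteq> carrier G \<Longrightarrow> F xs = H xs) \<Longrightarrow> CLS G M F = CLS G M H"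
  unfolding CLS_def by (intro HOL.ext cls_cong) (auto dest: tuplesD)

lemma CLS_eq_iff:
  assumes "Z F" "Z H"
  shows "CLS G M F = CLS G M H
    \<longleftrightarrow> (\<exists>E. C E \<and> (\<forall>xs. xs \<noteq> [] \<longrightarrow> set xs \<subseteq> carrier G \<longrightarrow> F xs = H xs + cobd E xs))"
proof
  assume "CLS G M F = CLS G M H"
  then have "\<exists>E. C E \<and> (\<forall>xs\<in>tuples G n. F xs = H xs + cobd E xs)" for n
    using cls_eq_iff[OF assms, of n] by (simp add: CLS_def fun_eq_iff)
  then obtain E where E: "\<And>n. C (E n)" "\<And>n xs. xs \<in> tuples G n \<Longrightarrow> F xs = H xs + cobd (E n) xs"
    by metis
  define E' where "E' ys = E (length ys) ys" for ys
  have "C E'" using E(1) by (auto simp: cochain_def E'_def)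
  moreover have "F xs = H xs + cobd E' xs" if "xs \<noteq> []" "set xs \<subseteq> carrier G" for xs
  proof -
    have "cobd E' xs = cobd (E (length xs - 1)) xs"
      by (intro cobd_cong) (metis E'_def diff_Suc_1)
    with E(2)[of xs "length xs - 1"] that show ?thesis by (auto simp: tuples_def)
  qed
  ultimately show "\<exists>E. C E \<and> (\<forall>xs. xs \<noteq> [] \<longrightarrow> set xs \<subseteq> carrier G \<longrightarrow> F xs = H xs + cobd E xs)"
    by blast
next
  assume "\<exists>E. C E \<and> (\<forall>xs. xs \<noteq> [] \<longrightarrow> set xs \<subseteq> carrier G \<longrightarrow> F xs = H xs + cobd E xs)"
  then obtain E where E: "C E" "\<And>xs. xs \<noteq> [] \<Longrightarrow> set xs \<subseteq> carrier G \<Longrightarrow> F xs = H xs + cobd E xs"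
    by blast
  have "cls G M n F = cls G M n H" for n
    unfolding cls_eq_iff[OF assms] using E tuplesD by blast
  then show "CLS G M F = CLS G M H" by (simp add: CLS_def)
qed

lemma coh_zero: "\<zero>\<^bsub>coh G M\<^esub> = CLS G M (\<lambda>xs. 0)"
  by (simp add: coh_def direct_sum_def CLS_def Ext_zero)

lemma coh_add: "Z F \<Longrightarrow> Z H \<Longrightarrow> CLS G M F \<oplus>\<^bsub>coh G M\<^esub> CLS G M H = CLS G M (\<lambda>xs. F xs + H xs)"
  by (simp add: coh_def direct_sum_def CLS_def Ext_add)

lemma coh_smult: "Z F \<Longrightarrow> c \<odot>\<^bsub>coh G M\<^esub> CLS G M F = CLS G M (\<lambda>xs. c \<odot>\<^bsub>M\<^esub> F xs)"
  by (simp add: coh_def direct_sum_def CLS_def Ext_smult)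

lemma ZB_add: "ZB F \<Longrightarrow> ZB H \<Longrightarrow> ZB (\<lambda>xs. F xs + H xs)"
  by (simp add: cocycle_add bounded_degree_add)

lemma ZB_smult: "ZB F \<Longrightarrow> ZB (\<lambda>xs. c \<odot>\<^bsub>M\<^esub> F xs)"
  by (simp add: cocycle_smult bounded_degree_compose)

lemma ZB_component: "Z F \<Longrightarrow> ZB (component n F)"
  by (simp add: cocycle_component bounded_degree_component)

lemma kspace_coh: "kspace (coh G M)"
  by (rule kspace_presentation[OF vector_space_fun[OF vector_space_axioms],
        where Z = "{F. ZB F}" and q = "CLS G M"])
    (simp_all add: carrier_coh coh_zero coh_add coh_smult zero_fun_def plus_fun_def
      cocycle_zero bounded_degree_zero ZB_add ZB_smult)

lemma coh_finsum:
  assumes "finite I" "\<And>i. i \<in> I \<Longrightarrow> ZB (F i)"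
  shows "finsum (coh G M) (\<lambda>i. CLS G M (F i)) I = CLS G M (\<lambda>xs. \<Sum>i\<in>I. F i xs)"
  by (rule finsum_presentation[OF kspace_coh, where Q = "\<lambda>F. ZB F"])
    (use assms in \<open>auto simp: cocycle_zero cocycle_add bounded_degree_zero bounded_degree_add
      carrier_coh coh_zero coh_add\<close>)

lemma bounded_degree_cup:
  assumes "bounded_degree F" "bounded_degree (h :: 'g list \<Rightarrow> 'k)"
  shows "bounded_degree (cupM F h)"
proof -
  obtain N N' where N: "\<forall>xs. length xs > N \<longrightarrow> F xs = 0" "\<forall>xs. length xs > N' \<longrightarrow> h xs = 0"
    using assms by (auto simp: bounded_degree_def)
  have "h (drop m xs) \<odot>\<^bsub>M\<^esub> F (take (Suc m) xs) = 0"
    if "length xs > N + N'" "m < length xs" for m xs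
    using that N(1)[rule_format, of "take (Suc m) xs"] N(2)[rule_format, of "drop m xs"]
    by (cases "m \<ge> N") auto
  then have "cupM F h xs = 0" if "length xs > N + N'" for xs
    using that unfolding cup_eq_sum by (intro sum.neutral) auto
  then show ?thesis by (auto simp: bounded_degree_def)
qed

lemma ZB_cup:
  "ZB F \<Longrightarrow> cocycle G K h \<and> bounded_degree h \<Longrightarrow> ZB (cupM F h)"
  by (simp add: cocycle_cup bounded_degree_cup)

text \<open>On representatives the action of the cohomology ring is the cup product.\<close>
theorem coh_act_CLS:
  assumes F: "Z F" and h: "cocycle G K h"
  shows "coh_act G M (CLS G M F) (CLS G K h) = CLS G M (cupM F h)"
proof
  fix n
  have "coh_act G M (CLS G M F) (CLS G K h) n
      = (\<Oplus>\<^bsub>Ext G M n\<^esub>m\<in>{..n}. cls G M n (cupM (component m F) h))"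
    unfolding coh_act_def CLS_def
  proof (rule abelian_monoid.finsum_cong'[OF abelian_group.axioms(1)])
    show "abelian_group (Ext G M n)" using kspace_Ext by (rule module.axioms)
    fix m assume "m \<in> {..n}"
    then show "yoneda G M m (n - m) (cls G M m F) (cls G K (n - m) h) = cls G M n (cupM (component m F) h)"
      using yoneda_cls[OF F h, of m "n - m"] by simp
  qed (auto simp: carrier_Ext intro!: imageI cocycle_cup cocycle_component F h)
  also have "\<dots> = cls G M n (\<lambda>xs. \<Sum>m\<le>n. cupM (component m F) h xs)"
    using F h by (intro Ext_finsum) (auto intro: cocycle_cup cocycle_component)
  also have "\<dots> = cls G M n (cupM F h)"
  proof (rule cls_cong)
    fix xs assume xs: "xs \<in> tuples G n"
    have "cupM (component m F) h xs = h (drop m xs) \<odot>\<^bsub>M\<^esub> F (take (Suc m) xs)" if "m \<le> n" for m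
      using xs that by (intro cup_component[of _ _ "n - m"]) (auto simp: tuples_def)
    then show "(\<Sum>m\<le>n. cupM (component m F) h xs) = cupM F h xs"
      using xs unfolding cup_eq_sum[of _ F] by (intro sum.cong) (auto simp: tuples_def)
  qed
  finally show "coh_act G M (CLS G M F) (CLS G K h) n = CLS G M (cupM F h) n"
    by (simp add: CLS_def)
qed

lemma in_degree_cls:
  "in_degree (Ext G M) n (cls G M n F) = CLS G M (component n F)"
proof
  fix i
  show "in_degree (Ext G M) n (cls G M n F) i = CLS G M (component n F) i"
    by (auto simp: in_degree_def CLS_def Ext_zero component_def tuples_def intro!: cls_cong)
qed

lemma coh_degree0_eq: "coh_degree0 G M = (\<lambda>F. CLS G M (component 0 F)) ` {F. Z F}"
  by (simp add: coh_degree0_def carrier_Ext image_image in_degree_cls)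

end

lemma coh_map_CLS:
  assumes "gmod G M" "gmod_map G M M T" "cocycle G M F"
  shows "coh_map G M T (CLS G M F) = CLS G M (\<lambda>xs. T (F xs))"
  using Ext_map_cls[OF assms] by (simp add: coh_map_def CLS_def)

subsection \<open>Ring and module axioms\<close>

lemma coh_ring_simps [simp]:
  "carrier (coh_ring G) = carrier (coh G trivial_module)"
  "x \<oplus>\<^bsub>coh_ring G\<^esub> y = x \<oplus>\<^bsub>coh G trivial_module\<^esub> y"
  "\<zero>\<^bsub>coh_ring G\<^esub> = \<zero>\<^bsub>coh G trivial_module\<^esub>"
  "x \<otimes>\<^bsub>coh_ring G\<^esub> y = coh_act G trivial_module x y"
  "c \<odot>\<^bsub>coh_ring G\<^esub> x = c \<odot>\<^bsub>coh G trivial_module\<^esub> x"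
  by (simp_all add: coh_ring_def)

context gmod
begin

lemma cocycle_cup_unit: "cocycle G K cup_unit" "bounded_degree (cup_unit :: 'g list \<Rightarrow> 'k)"
proof -
  have "cobd (cup_unit :: 'g list \<Rightarrow> 'k) xs = 0" for xs :: "'g list"
  proof (cases "length xs = 2")
    case True
    then obtain x y where "xs = [x, y]" by (auto simp: length_Suc_conv numeral_2_eq_2)
    then show ?thesis by (simp add: cup_unit_def)
  next
    case False
    then have "cobd cup_unit xs = cobd (\<lambda>_. 0 :: 'k) xs"
      by (intro cobd_cong) (auto simp: cup_unit_def)
    then show ?thesis by simp
  qed
  then show "cocycle G K cup_unit"
    by (auto simp: cocycle_def cochain_def cup_unit_def)
  show "bounded_degree (cup_unit :: 'g list \<Rightarrow> 'k)"
    by (auto simp: bounded_degree_def cup_unit_def intro!: exI[of _ 1])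
qed

lemma Ext_one_eq: "Ext_one G = cls G K 0 cup_unit"
proof -
  have "restrict std_aug (carrier (P 0)) = to_cochain G K 0 cup_unit"
    by (auto simp: to_cochain_def std_aug_eq_lin tuples_def cup_unit_def fun_eq_iff
        intro!: vector_space.lin_cong[OF vector_space_mult])
  then show ?thesis by (simp add: Ext_one_def cls_def)
qed

lemma coh_ring_one: "\<one>\<^bsub>coh_ring G\<^esub> = CLS G K cup_unit"
proof -
  interpret K: gmod G K by (rule gmod_K)
  have "component 0 cup_unit = (cup_unit :: 'g list \<Rightarrow> 'k)"
    by (auto simp: component_def cup_unit_def)
  then show ?thesis
    by (simp add: coh_ring_def Ext_one_eq K.in_degree_cls)
qed

lemma coh_act_closed:
  "x \<in> carrier (coh G M) \<Longrightarrow> y \<in> carrier (coh G K) \<Longrightarrow> coh_act G M x y \<in> carrier (coh G M)"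
  using gmod.carrier_coh[OF gmod_K]
  by (auto simp: carrier_coh coh_act_CLS intro!: imageI ZB_cup)

lemma coh_act_add_left:
  assumes "x \<in> carrier (coh G M)" "x' \<in> carrier (coh G M)" "y \<in> carrier (coh G K)"
  shows "coh_act G M (x \<oplus>\<^bsub>coh G M\<^esub> x') y = coh_act G M x y \<oplus>\<^bsub>coh G M\<^esub> coh_act G M x' y"
proof -
  interpret K: gmod G K by (rule gmod_K)
  show ?thesis
    using assms by (auto simp: carrier_coh K.carrier_coh coh_add coh_act_CLS cocycle_add cocycle_cup cup_add_left[abs_def])
qed

lemma coh_act_add_right:
  assumes "x \<in> carrier (coh G M)" "y \<in> carrier (coh G K)" "y' \<in> carrier (coh G K)"
  shows "coh_act G M x (y \<oplus>\<^bsub>coh G K\<^esub> y') = coh_act G M x y \<oplus>\<^bsub>coh G M\<^esub> coh_act G M x y'"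
proof -
  interpret K: gmod G K by (rule gmod_K)
  show ?thesis
    using assms by (auto simp: carrier_coh K.carrier_coh coh_add K.coh_add coh_act_CLS K.cocycle_add cocycle_cup cup_add_right[abs_def])
qed

lemma coh_act_smult:
  assumes "x \<in> carrier (coh G M)" "y \<in> carrier (coh G K)"
  shows "coh_act G M (c \<odot>\<^bsub>coh G M\<^esub> x) y = c \<odot>\<^bsub>coh G M\<^esub> coh_act G M x y"
    "coh_act G M x (c \<odot>\<^bsub>coh G K\<^esub> y) = c \<odot>\<^bsub>coh G M\<^esub> coh_act G M x y"
proof -
  interpret K: gmod G K by (rule gmod_K)
  show "coh_act G M (c \<odot>\<^bsub>coh G M\<^esub> x) y = c \<odot>\<^bsub>coh G M\<^esub> coh_act G M x y"
    using assms by (auto simp: carrier_coh K.carrier_coh coh_smult coh_act_CLS cocycle_smult cocycle_cup cup_scale_left[abs_def])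
  show "coh_act G M x (c \<odot>\<^bsub>coh G K\<^esub> y) = c \<odot>\<^bsub>coh G M\<^esub> coh_act G M x y"
    using assms K.cocycle_smult[of _ c]
    by (auto simp: carrier_coh K.carrier_coh coh_smult K.coh_smult coh_act_CLS cocycle_cup cup_scale_right[abs_def])
qed

lemma coh_act_assoc:
  assumes "x \<in> carrier (coh G M)" "y \<in> carrier (coh G K)" "z \<in> carrier (coh G K)"
  shows "coh_act G M x (coh_act G K y z) = coh_act G M (coh_act G M x y) z"
proof -
  interpret K: gmod G K by (rule gmod_K)
  obtain F h k where F: "x = CLS G M F" "Z F" and h: "y = CLS G K h" "cocycle G K h"
    and k: "z = CLS G K k" "cocycle G K k"
    using assms by (auto simp: carrier_coh K.carrier_coh)
  have "cocycle G K (cup (*) h k)" using K.cocycle_cup[OF h(2) k(2)] by simp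
  moreover have "coh_act G K y z = CLS G K (cup (*) h k)"
    using K.coh_act_CLS[OF h(2) k(2)] h k by simp
  ultimately show ?thesis
    using F h k by (simp add: coh_act_CLS cocycle_cup cup_assoc[abs_def])
qed

lemma coh_act_one:
  assumes "x \<in> carrier (coh G M)"
  shows "coh_act G M x (CLS G K cup_unit) = x"
proof -
  obtain F where F: "x = CLS G M F" "Z F" using assms by (auto simp: carrier_coh)
  then have "coh_act G M x (CLS G K cup_unit) = CLS G M (cupM F cup_unit)"
    using cocycle_cup_unit by (simp add: coh_act_CLS)
  also have "\<dots> = CLS G M F"
    by (rule CLS_cong) (simp add: cup_cup_unit)
  finally show ?thesis by (simp add: F)
qed

theorem ring_coh_ring: "ring (coh_ring G :: ('k, _) module)"
proof -
  interpret K: gmod G K by (rule gmod_K)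
  interpret H: Module.module "ring_of_type_algebra :: 'k ring" "coh G K" by (rule K.kspace_coh)
  have one: "CLS G K cup_unit \<in> carrier (coh G K)"
    using cocycle_cup_unit by (auto simp: K.carrier_coh)
  have unit: "coh_act G K (CLS G K cup_unit) y = y" if y: "y \<in> carrier (coh G K)" for y
  proof -
    obtain h where h: "y = CLS G K h" "cocycle G K h" using y by (auto simp: K.carrier_coh)
    then have "coh_act G K (CLS G K cup_unit) y = CLS G K (cup (*) cup_unit h)"
      using cocycle_cup_unit by (simp add: K.coh_act_CLS)
    also have "\<dots> = CLS G K h"
      by (rule K.CLS_cong) (simp add: cup_unit_cup)
    finally show ?thesis by (simp add: h)
  qed
  show ?thesis
  proof (rule ringI)
    show "abelian_group (coh_ring G :: ('k, _) module)"
      by (rule abelian_groupI) (auto simp: H.M.add.m_ac intro: H.M.add.l_inv_ex)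
    show "Group.monoid (coh_ring G :: ('k, _) module)"
      by (rule Group.monoidI)
        (auto simp: coh_ring_one one unit K.coh_act_closed K.coh_act_one K.coh_act_assoc)
  qed (auto simp: K.coh_act_add_left K.coh_act_add_right)
qed

theorem right_module_coh: "right_module (coh_ring G) (coh G M) (coh_act G M)"
  using ring_coh_ring Module.module.axioms(2)[OF kspace_coh]
  by (auto simp: right_module_def coh_act_closed coh_act_add_left coh_act_add_right coh_act_assoc
      coh_ring_one coh_act_one)

end

section \<open>Cohomology of a module that is relatively free over its invariants\<close>

lemma cobd_sum: "cobd (\<lambda>ys. \<Sum>i\<in>I. F i ys) xs = (\<Sum>i\<in>I. cobd (F i) xs)"
  by (induction I rule: infinite_finite_induct) (auto simp: cobd_add)

definition constant_cocycle :: "'v::zero \<Rightarrow> 'g list \<Rightarrow> 'v" where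
  "constant_cocycle v xs = (if length xs = 1 then v else 0)"

lemma component_constant_cocycle: "component 0 (constant_cocycle v) = constant_cocycle v"
  by (auto simp: component_def constant_cocycle_def)

context gmod
begin

lemma cocycle_constant:
  assumes "v \<in> carrier M" "\<And>g. g \<in> carrier G \<Longrightarrow> gact M g v = v"
  shows "ZB (constant_cocycle v)"
proof -
  have "cobd (constant_cocycle v) xs = 0" for xs :: "'g list"
  proof (cases "length xs = 2")
    case True
    then obtain x y where "xs = [x, y]" by (auto simp: length_Suc_conv numeral_2_eq_2)
    then show ?thesis by (simp add: constant_cocycle_def)
  next
    case False
    then have "cobd (constant_cocycle v) xs = cobd (\<lambda>_. 0) xs"
      by (intro cobd_cong) (auto simp: constant_cocycle_def)
    then show ?thesis by simp
  qed
  moreover have "bounded_degree (constant_cocycle v)"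
    using bounded_degree_component[of 0 "constant_cocycle v"] by (simp add: component_constant_cocycle)
  ultimately show ?thesis
    using assms by (auto simp: cocycle_def cochain_def constant_cocycle_def)
qed

lemma degree_zero_invariant:
  assumes F: "Z F" and "x \<in> carrier G"
  shows "F [x] = F [\<one>\<^bsub>G\<^esub>]" "g \<in> carrier G \<Longrightarrow> gact M g (F [x]) = F [x]"
proof -
  have const: "F [y] = F [\<one>\<^bsub>G\<^esub>]" if "y \<in> carrier G" for y
  proof -
    have "cobd F [\<one>\<^bsub>G\<^esub>, y] = 0" using that by (intro cocycleD(2)[OF F]) auto
    then show ?thesis using cochainD(1)[OF cocycleD(1)[OF F]] by simp
  qed
  show "F [x] = F [\<one>\<^bsub>G\<^esub>]" by (rule const) fact
  show "gact M g (F [x]) = F [x]" if "g \<in> carrier G"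
    using cochainD(3)[OF cocycleD(1)[OF F] that, of "[x]"] const[of x] const[of "g \<otimes>\<^bsub>G\<^esub> x"] that assms(2)
    by simp
qed

end

text \<open>
  The identity of \<open>M\<close> is the sum of an endomorphism that factors through a trivial module, given
  by invariants \<open>u i\<close> and invariant functionals \<open>p i\<close>, and of the trace of a linear map \<open>t\<close>. By
  Higman's criterion the second summand factors through a projective module, so that it induces
  zero in positive degrees.
\<close>
locale trace_split = gmod G M
  for G :: "('g, 'l) monoid_scheme" and M :: "('k::field, 'v::ab_group_add, 'g) gmodule" +
  fixes I :: "'i set" and u :: "'i \<Rightarrow> 'v" and p :: "'i \<Rightarrow> 'v \<Rightarrow> 'k" and t :: "'v \<Rightarrow> 'v"
  assumes finite_G: "finite (carrier G)" and finite_I: "finite I"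
    and u_closed: "i \<in> I \<Longrightarrow> u i \<in> carrier M"
    and u_invariant: "i \<in> I \<Longrightarrow> g \<in> carrier G \<Longrightarrow> gact M g (u i) = u i"
    and p_map: "i \<in> I \<Longrightarrow> gmod_map G M trivial_module (p i)"
    and t_add: "t (x + y) = t x + t y" and t_smult: "t (c \<odot>\<^bsub>M\<^esub> x) = c \<odot>\<^bsub>M\<^esub> t x"
    and t_closed: "x \<in> carrier M \<Longrightarrow> t x \<in> carrier M"
    and trace: "x \<in> carrier M \<Longrightarrow>
      (\<Sum>g\<in>carrier G. gact M g (t (gact M (inv\<^bsub>G\<^esub> g) x))) = x - (\<Sum>i\<in>I. p i x \<odot>\<^bsub>M\<^esub> u i)"
begin

definition trace_homotopy :: "('g list \<Rightarrow> 'v) \<Rightarrow> 'g list \<Rightarrow> 'v" where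
  "trace_homotopy F xs = (if xs = [] then 0 else
     \<Sum>g\<in>carrier G. gact M g (t (gact M (inv\<^bsub>G\<^esub> g) (F (g # xs)))))"

lemma cochain_trace_homotopy:
  assumes F: "C F"
  shows "C (trace_homotopy F)"
  unfolding cochain_def
proof (intro conjI allI impI ballI)
  fix xs assume xs: "set xs \<subseteq> carrier G"
  show "trace_homotopy F xs \<in> carrier M"
    using xs cochainD(2)[OF F] by (auto simp: trace_homotopy_def t_closed intro!: sum_closed)
  fix a assume a: "a \<in> carrier G"
  have bij: "bij_betw (\<lambda>g. a \<otimes>\<^bsub>G\<^esub> g) (carrier G) (carrier G)"
    using a by (simp add: bij_betw_def G.inj_on_cmult G.surj_const_mult)
  have "gact M (a \<otimes>\<^bsub>G\<^esub> g) (t (gact M (inv\<^bsub>G\<^esub> (a \<otimes>\<^bsub>G\<^esub> g)) (F ((a \<otimes>\<^bsub>G\<^esub> g) # map ((\<otimes>\<^bsub>G\<^esub>) a) xs))))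
      = gact M a (gact M g (t (gact M (inv\<^bsub>G\<^esub> g) (F (g # xs)))))" if g: "g \<in> carrier G" for g
  proof -
    have Fc: "F (g # xs) \<in> carrier M" using xs g by (intro cochainD(2)[OF F]) auto
    have "F ((a \<otimes>\<^bsub>G\<^esub> g) # map ((\<otimes>\<^bsub>G\<^esub>) a) xs) = gact M a (F (g # xs))"
      using cochainD(3)[OF F a, of "g # xs"] xs g by simp
    moreover have "gact M (inv\<^bsub>G\<^esub> (a \<otimes>\<^bsub>G\<^esub> g)) (gact M a (F (g # xs))) = gact M (inv\<^bsub>G\<^esub> g) (F (g # xs))"
      using a g Fc by (simp add: act_mult[symmetric] G.inv_mult_group G.m_assoc)
    ultimately show ?thesis
      using a g Fc by (simp add: act_mult t_closed)
  qed
  moreover have "(\<Sum>g\<in>carrier G. gact M g (t (gact M (inv\<^bsub>G\<^esub> g) (F (g # map ((\<otimes>\<^bsub>G\<^esub>) a) xs)))))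
      = (\<Sum>g\<in>carrier G. gact M (a \<otimes>\<^bsub>G\<^esub> g)
          (t (gact M (inv\<^bsub>G\<^esub> (a \<otimes>\<^bsub>G\<^esub> g)) (F ((a \<otimes>\<^bsub>G\<^esub> g) # map ((\<otimes>\<^bsub>G\<^esub>) a) xs)))))"
    by (rule sum.reindex_bij_betw[OF bij, symmetric])
  ultimately show "trace_homotopy F (map ((\<otimes>\<^bsub>G\<^esub>) a) xs) = gact M a (trace_homotopy F xs)"
    using a by (simp add: trace_homotopy_def act_sum)
qed (simp add: trace_homotopy_def)

text \<open>
  The cocycle condition at \<open>g # xs\<close> expresses \<open>F xs\<close> as the coboundary of \<open>F (g # _)\<close> at \<open>xs\<close>.
  Applying the conjugate of \<open>t\<close> by \<open>g\<close> and summing over \<open>g\<close> produces the trace of \<open>t\<close> applied to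
  \<open>F xs\<close>. In degree \<open>0\<close> the argument breaks down, because the homotopy is set to zero on the empty
  list.
\<close>
lemma cobd_trace_homotopy:
  assumes F: "Z F" and xs: "set xs \<subseteq> carrier G" "length xs \<ge> 2"
  shows "cobd (trace_homotopy F) xs = F xs - (\<Sum>i\<in>I. p i (F xs) \<odot>\<^bsub>M\<^esub> u i)"
proof -
  let ?L = "\<lambda>g v. gact M g (t (gact M (inv\<^bsub>G\<^esub> g) v))"
  have t_diff: "t (x - y) = t x - t y" for x y
    using t_add[of "x - y" y] by (simp add: algebra_simps)
  have "cobd (trace_homotopy F) xs = cobd (\<lambda>ys. \<Sum>g\<in>carrier G. ?L g (F (g # ys))) xs"
    using xs by (intro cobd_cong) (auto simp: trace_homotopy_def)
  also have "\<dots> = (\<Sum>g\<in>carrier G. ?L g (cobd (\<lambda>ys. F (g # ys)) xs))"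
    unfolding cobd_sum
  proof (rule sum.cong)
    fix g assume "g \<in> carrier G"
    then show "cobd (\<lambda>ys. ?L g (F (g # ys))) xs = ?L g (cobd (\<lambda>ys. F (g # ys)) xs)"
      by (intro cobd_linear[where L = "?L g", symmetric]) (simp add: act_diff t_diff)
  qed simp
  also have "\<dots> = (\<Sum>g\<in>carrier G. ?L g (F xs))"
  proof (rule sum.cong)
    fix g assume "g \<in> carrier G"
    then have "cobd F (g # xs) = 0" using xs by (intro cocycleD(2)[OF F]) auto
    then show "?L g (cobd (\<lambda>ys. F (g # ys)) xs) = ?L g (F xs)" by simp
  qed simp
  also have "\<dots> = F xs - (\<Sum>i\<in>I. p i (F xs) \<odot>\<^bsub>M\<^esub> u i)"
    using cochainD(2)[OF cocycleD(1)[OF F] xs(1)] by (rule trace)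
  finally show ?thesis .
qed

lemma CLS_expansion:
  assumes F: "Z F" and deg0: "F [\<one>\<^bsub>G\<^esub>] = (\<Sum>i\<in>I. p i (F [\<one>\<^bsub>G\<^esub>]) \<odot>\<^bsub>M\<^esub> u i)"
  shows "CLS G M F = CLS G M (\<lambda>xs. \<Sum>i\<in>I. p i (F xs) \<odot>\<^bsub>M\<^esub> u i)"
proof -
  have "Z (\<lambda>xs. p i (F xs) \<odot>\<^bsub>M\<^esub> u i)" if i: "i \<in> I" for i
  proof (rule cocycle_map[OF _ F])
    show "gmod_map G M M (\<lambda>x. p i x \<odot>\<^bsub>M\<^esub> u i)"
      using p_map[OF i] u_closed[OF i] u_invariant[OF i]
      by (auto simp: gmod_map_def scale_left_distrib act_smult)
  qed
  then have Ze: "Z (\<lambda>xs. \<Sum>i\<in>I. p i (F xs) \<odot>\<^bsub>M\<^esub> u i)" by (rule cocycle_sum)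
  have eq: "F xs = (\<Sum>i\<in>I. p i (F xs) \<odot>\<^bsub>M\<^esub> u i) + cobd (trace_homotopy F) xs"
    if xs: "xs \<noteq> []" "set xs \<subseteq> carrier G" for xs
  proof (cases "length xs \<ge> 2")
    case True
    then show ?thesis using cobd_trace_homotopy[OF F xs(2)] by simp
  next
    case False
    then obtain x where "xs = [x]" using xs(1) by (cases xs) (auto simp: Suc_le_eq)
    then show ?thesis
      using degree_zero_invariant(1)[OF F, of x] deg0 xs(2) by (simp add: trace_homotopy_def)
  qed
  show ?thesis
    unfolding CLS_eq_iff[OF F Ze]
    by (intro exI[of _ "trace_homotopy F"] conjI allI impI eq cochain_trace_homotopy cocycleD(1)[OF F])
qed

definition gen :: "'i \<Rightarrow> nat \<Rightarrow> (('g list \<Rightarrow>\<^sub>0 'k) \<Rightarrow> 'v) set" where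
  "gen i = CLS G M (constant_cocycle (u i))"

lemma gen_cocycle: "i \<in> I \<Longrightarrow> ZB (constant_cocycle (u i))"
  by (rule cocycle_constant) (auto simp: u_closed u_invariant)

lemma gen_closed: "i \<in> I \<Longrightarrow> gen i \<in> carrier (coh G M)"
  using gen_cocycle by (auto simp: carrier_coh gen_def)

lemma gen_degree0: "i \<in> I \<Longrightarrow> gen i \<in> coh_degree0 G M"
  using gen_cocycle[of i] component_constant_cocycle[of "u i"]
  unfolding coh_degree0_eq gen_def by (metis (mono_tags, lifting) image_eqI mem_Collect_eq)

lemma gen_act:
  assumes "i \<in> I" "cocycle G K h"
  shows "coh_act G M (gen i) (CLS G K h) = CLS G M (\<lambda>xs. h xs \<odot>\<^bsub>M\<^esub> u i)"
proof -
  have "coh_act G M (gen i) (CLS G K h) = CLS G M (cupM (constant_cocycle (u i)) h)"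
    using gen_cocycle assms by (simp add: gen_def coh_act_CLS)
  also have "\<dots> = CLS G M (\<lambda>xs. h xs \<odot>\<^bsub>M\<^esub> u i)"
  proof (rule CLS_cong)
    fix xs :: "'g list" assume "xs \<noteq> []"
    then obtain x ys where "xs = x # ys" by (cases xs) auto
    then show "cupM (constant_cocycle (u i)) h xs = h xs \<odot>\<^bsub>M\<^esub> u i"
      by (simp add: cup_degree_zero constant_cocycle_def del: cup.simps(2))
  qed
  finally show ?thesis .
qed

lemma ZB_smult_u:
  assumes "i \<in> I" "cocycle G K h" "bounded_degree h"
  shows "ZB (\<lambda>xs. h xs \<odot>\<^bsub>M\<^esub> u i)"
proof -
  have "gmod_map G K M (\<lambda>c. c \<odot>\<^bsub>M\<^esub> u i)"
    using u_closed u_invariant assms(1) by (auto simp: gmod_map_def scale_left_distrib act_smult)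
  from cocycle_map[OF this] show ?thesis
    using assms bounded_degree_compose[of h "\<lambda>c. c \<odot>\<^bsub>M\<^esub> u i"] by simp
qed

lemma gen_combination:
  assumes "\<And>i. i \<in> I \<Longrightarrow> cocycle G K (h i) \<and> bounded_degree (h i)"
  shows "(\<Oplus>\<^bsub>coh G M\<^esub>i\<in>I. coh_act G M (gen i) (CLS G K (h i)))
    = CLS G M (\<lambda>xs. \<Sum>i\<in>I. h i xs \<odot>\<^bsub>M\<^esub> u i)"
proof -
  interpret V: Module.module "ring_of_type_algebra :: 'k ring" "coh G M" by (rule kspace_coh)
  have "(\<Oplus>\<^bsub>coh G M\<^esub>i\<in>I. coh_act G M (gen i) (CLS G K (h i)))
      = (\<Oplus>\<^bsub>coh G M\<^esub>i\<in>I. CLS G M (\<lambda>xs. h i xs \<odot>\<^bsub>M\<^esub> u i))"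
    using assms by (intro V.finsum_cong') (auto simp: gen_act carrier_coh ZB_smult_u intro!: imageI)
  also have "\<dots> = CLS G M (\<lambda>xs. \<Sum>i\<in>I. h i xs \<odot>\<^bsub>M\<^esub> u i)"
    using assms ZB_smult_u by (intro coh_finsum finite_I) auto
  finally show ?thesis .
qed

lemma ZB_p:
  assumes "i \<in> I" "ZB F"
  shows "cocycle G K (\<lambda>xs. p i (F xs)) \<and> bounded_degree (\<lambda>xs. p i (F xs))"
  using assms cocycle_map[OF p_map] gmod_map_diff(1)[OF p_map] by (simp add: bounded_degree_compose)

lemma coh_expansion:
  assumes F: "ZB F" and deg0: "F [\<one>\<^bsub>G\<^esub>] = (\<Sum>i\<in>I. p i (F [\<one>\<^bsub>G\<^esub>]) \<odot>\<^bsub>M\<^esub> u i)"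
  shows "CLS G M F = (\<Oplus>\<^bsub>coh G M\<^esub>i\<in>I. coh_act G M (gen i) (CLS G K (\<lambda>xs. p i (F xs))))"
  using CLS_expansion[of F] deg0 F ZB_p by (simp add: gen_combination)

text \<open>
  Up to its component of degree \<open>0\<close>, every class is a combination of the classes of the \<open>u i\<close>, which
  have degree \<open>0\<close> themselves.
\<close>
theorem coh_generated_by_degree0:
  "right_generated_by (coh_ring G) (coh G M) (coh_act G M) (coh_degree0 G M)"
proof -
  interpret V: Module.module "ring_of_type_algebra :: 'k ring" "coh G M" by (rule kspace_coh)
  interpret K: gmod G K by (rule gmod_K)
  have sub: "coh_degree0 G M \<subseteq> carrier (coh G M)"
    by (auto simp: coh_degree0_eq carrier_coh intro!: imageI ZB_component)
  have "x \<in> N" if x: "x \<in> carrier (coh G M)"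
    and N: "right_submodule (coh_ring G) (coh G M) (coh_act G M) N" "coh_degree0 G M \<subseteq> N" for x N
  proof -
    have add: "additive_subgroup N (coh G M)"
      and act: "\<And>y r. y \<in> N \<Longrightarrow> r \<in> carrier (coh G K) \<Longrightarrow> coh_act G M y r \<in> N"
      using N(1) by (auto simp: right_submodule_def)
    obtain F where F: "x = CLS G M F" "ZB F" using x by (auto simp: carrier_coh)
    define F' where "F' xs = F xs - component 0 F xs" for xs
    have F': "ZB F'"
      unfolding F'_def using F(2) ZB_component[of F 0]
      by (auto intro: cocycle_diff bounded_degree_pointwise[of _ _ "(-)"])
    have fin: "finsum (coh G M) f J \<in> N" if "finite J" "\<And>j. j \<in> J \<Longrightarrow> f j \<in> N" for f and J :: "'i set"
      using that
    proof (induction J rule: finite_induct)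
      case empty
      show ?case using additive_subgroup.zero_closed[OF add] by simp
    next
      case (insert j J)
      have c: "f \<in> J \<rightarrow> carrier (coh G M)" "f j \<in> carrier (coh G M)"
        using insert.prems additive_subgroup.a_subset[OF add] by auto
      show ?case
        using insert c additive_subgroup.a_closed[OF add] by (simp add: V.finsum_insert)
    qed
    have "F' [\<one>\<^bsub>G\<^esub>] = 0" by (simp add: F'_def component_def)
    then have "CLS G M F' = (\<Oplus>\<^bsub>coh G M\<^esub>i\<in>I. coh_act G M (gen i) (CLS G K (\<lambda>xs. p i (F' xs))))"
      using gmod_map_diff(1)[OF p_map] by (intro coh_expansion F') simp
    also have "\<dots> \<in> N"
      using gen_degree0 N(2) ZB_p[OF _ F']
      by (intro fin finite_I act) (auto simp: K.carrier_coh)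
    finally have "CLS G M F' \<in> N" .
    moreover have "CLS G M (component 0 F) \<in> N"
      using N(2) F(2) by (auto simp: coh_degree0_eq)
    moreover have "x = CLS G M (component 0 F) \<oplus>\<^bsub>coh G M\<^esub> CLS G M F'"
      using F' F ZB_component[of F 0] by (simp add: coh_add F'_def)
    ultimately show ?thesis using additive_subgroup.a_closed[OF add] by simp
  qed
  moreover have "right_submodule (coh_ring G) (coh G M) (coh_act G M) (carrier (coh G M))"
    by (auto simp: right_submodule_def coh_act_closed intro!: additive_subgroup.intro V.M.add.subgroup_self)
  ultimately show ?thesis
    using sub by (auto simp: right_generated_by_def hull_def)
qed

end

text \<open>
  If moreover the \<open>u i\<close> span the invariants and the \<open>p i\<close> are dual to them, then the expansion of a
  class in the \<open>u i\<close> also holds in degree \<open>0\<close> and is unique.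
\<close>
locale trace_free = trace_split G M I u p t
  for G :: "('g, 'l) monoid_scheme" and M :: "('k::field, 'v::ab_group_add, 'g) gmodule"
    and I :: "'i set" and u p t +
  assumes dual: "i \<in> I \<Longrightarrow> j \<in> I \<Longrightarrow> p i (u j) = (if i = j then 1 else 0)"
    and invariants: "v \<in> carrier M \<Longrightarrow> (\<And>g. g \<in> carrier G \<Longrightarrow> gact M g v = v) \<Longrightarrow>
      v = (\<Sum>i\<in>I. p i v \<odot>\<^bsub>M\<^esub> u i)"
begin

lemma deg0_expansion:
  assumes "Z F"
  shows "F [\<one>\<^bsub>G\<^esub>] = (\<Sum>i\<in>I. p i (F [\<one>\<^bsub>G\<^esub>]) \<odot>\<^bsub>M\<^esub> u i)"
  using degree_zero_invariant(2)[OF assms, of "\<one>\<^bsub>G\<^esub>"] cochainD(2)[OF cocycleD(1)[OF assms], of "[\<one>\<^bsub>G\<^esub>]"]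
  by (intro invariants) auto

lemma coh_expansion_exists:
  assumes "x \<in> carrier (coh G M)"
  obtains r where "\<And>i. i \<in> I \<Longrightarrow> r i \<in> carrier (coh G K)"
    "x = (\<Oplus>\<^bsub>coh G M\<^esub>i\<in>I. coh_act G M (gen i) (r i))"
proof -
  interpret K: gmod G K by (rule gmod_K)
  obtain F where F: "x = CLS G M F" "ZB F" using assms by (auto simp: carrier_coh)
  show ?thesis
  proof (rule that)
    show "x = (\<Oplus>\<^bsub>coh G M\<^esub>i\<in>I. coh_act G M (gen i) (CLS G K (\<lambda>xs. p i (F xs))))"
      unfolding F(1) using F(2) by (intro coh_expansion deg0_expansion) auto
  qed (use ZB_p F(2) in \<open>auto simp: K.carrier_coh\<close>)
qed

text \<open>
  The invariant functional \<open>p j\<close> maps cocycles to cocycles and coboundaries to coboundaries, and it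
  extracts the \<open>j\<close>-th coefficient.
\<close>
lemma coh_expansion_unique:
  assumes r: "\<And>i. i \<in> I \<Longrightarrow> r i \<in> carrier (coh G K)" and r': "\<And>i. i \<in> I \<Longrightarrow> r' i \<in> carrier (coh G K)"
    and eq: "(\<Oplus>\<^bsub>coh G M\<^esub>i\<in>I. coh_act G M (gen i) (r i)) = (\<Oplus>\<^bsub>coh G M\<^esub>i\<in>I. coh_act G M (gen i) (r' i))"
    and j: "j \<in> I"
  shows "r j = r' j"
proof -
  interpret K: gmod G K by (rule gmod_K)
  have "\<forall>i\<in>I. \<exists>h. (cocycle G K h \<and> bounded_degree h) \<and> r i = CLS G K h"
    "\<forall>i\<in>I. \<exists>h. (cocycle G K h \<and> bounded_degree h) \<and> r' i = CLS G K h"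
    using r r' by (auto simp: K.carrier_coh)
  then obtain h h' where h: "\<And>i. i \<in> I \<Longrightarrow> (cocycle G K (h i) \<and> bounded_degree (h i)) \<and> r i = CLS G K (h i)"
    and h': "\<And>i. i \<in> I \<Longrightarrow> (cocycle G K (h' i) \<and> bounded_degree (h' i)) \<and> r' i = CLS G K (h' i)"
    by metis
  interpret V: Module.module "ring_of_type_algebra :: 'k ring" "coh G M" by (rule kspace_coh)
  have comb: "(\<Oplus>\<^bsub>coh G M\<^esub>i\<in>I. coh_act G M (gen i) (s i)) = CLS G M (\<lambda>xs. \<Sum>i\<in>I. k i xs \<odot>\<^bsub>M\<^esub> u i)"
    if k: "\<And>i. i \<in> I \<Longrightarrow> (cocycle G K (k i) \<and> bounded_degree (k i)) \<and> s i = CLS G K (k i)" for s k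
  proof -
    have "(\<Oplus>\<^bsub>coh G M\<^esub>i\<in>I. coh_act G M (gen i) (s i))
        = (\<Oplus>\<^bsub>coh G M\<^esub>i\<in>I. coh_act G M (gen i) (CLS G K (k i)))"
      using k by (intro V.finsum_cong') (auto intro!: coh_act_closed gen_closed simp: K.carrier_coh)
    then show ?thesis using k by (simp add: gen_combination)
  qed
  have Zs: "Z (\<lambda>xs. \<Sum>i\<in>I. k i xs \<odot>\<^bsub>M\<^esub> u i)"
    if "\<And>i. i \<in> I \<Longrightarrow> cocycle G K (k i) \<and> bounded_degree (k i)" for k
    using that ZB_smult_u by (intro cocycle_sum) auto
  obtain E where E: "C E" "\<And>xs. xs \<noteq> [] \<Longrightarrow> set xs \<subseteq> carrier G \<Longrightarrow>
      (\<Sum>i\<in>I. h i xs \<odot>\<^bsub>M\<^esub> u i) = (\<Sum>i\<in>I. h' i xs \<odot>\<^bsub>M\<^esub> u i) + cobd E xs"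
  proof -
    have "CLS G M (\<lambda>xs. \<Sum>i\<in>I. h i xs \<odot>\<^bsub>M\<^esub> u i) = CLS G M (\<lambda>xs. \<Sum>i\<in>I. h' i xs \<odot>\<^bsub>M\<^esub> u i)"
      using eq comb[OF h] comb[OF h'] by simp
    then show thesis
      using that CLS_eq_iff[OF Zs[of h] Zs[of h']] h h' by blast
  qed
  have pj: "p j (x + y) = p j x + p j y" "p j (c \<odot>\<^bsub>M\<^esub> x) = c * p j x" for x y c
    using p_map[OF j] by (auto simp: gmod_map_def)
  have p_sum: "p j (sum f A) = (\<Sum>i\<in>A. p j (f i))" for f and A :: "'i set"
    using gmod_map_diff(1)[OF p_map[OF j]] by (induction A rule: infinite_finite_induct) (auto simp: pj)
  have p_comb: "p j (\<Sum>i\<in>I. k i \<odot>\<^bsub>M\<^esub> u i) = k j" for k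
  proof -
    have "p j (\<Sum>i\<in>I. k i \<odot>\<^bsub>M\<^esub> u i) = (\<Sum>i\<in>I. if i = j then k j else 0)"
      unfolding p_sum using dual j by (intro sum.cong) (auto simp: pj)
    then show ?thesis using j finite_I by simp
  qed
  have "h j xs = h' j xs + cobd (\<lambda>ys. p j (E ys)) xs" if "xs \<noteq> []" "set xs \<subseteq> carrier G" for xs
    using arg_cong[OF E(2)[OF that], of "p j"]
    by (simp add: pj p_comb cobd_gmod_map[OF p_map[OF j]])
  moreover have "cochain G K (\<lambda>ys. p j (E ys))" by (rule cochain_map[OF p_map[OF j] E(1)])
  ultimately have "CLS G K (h j) = CLS G K (h' j)"
    using K.CLS_eq_iff[of "h j" "h' j"] h[OF j] h'[OF j] by blast
  then show ?thesis using h[OF j] h'[OF j] by simp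
qed

end



theorem right_free_of_rank_coh:
  fixes M :: "('k::field, 'v::ab_group_add, 'g) gmodule"
  assumes "trace_free G M {..<n :: nat} u p t"
  shows "right_free_of_rank (coh_ring G) (coh G M) (coh_act G M) n"
proof -
  interpret trace_free G M "{..<n}" u p t by fact
  have "\<exists>!r. r \<in> {..<n} \<rightarrow>\<^sub>E carrier (coh_ring G) \<and>
      x = (\<Oplus>\<^bsub>coh G M\<^esub>i\<in>{..<n}. coh_act G M (gen i) (r i))" if x: "x \<in> carrier (coh G M)" for x
  proof -
    interpret V: Module.module "ring_of_type_algebra :: 'k ring" "coh G M" by (rule kspace_coh)
    obtain r where r: "\<And>i. i < n \<Longrightarrow> r i \<in> carrier (coh G K)"
      "x = (\<Oplus>\<^bsub>coh G M\<^esub>i\<in>{..<n}. coh_act G M (gen i) (r i))"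
      using coh_expansion_exists[OF x] by auto
    show ?thesis
    proof (rule ex1I[of _ "restrict r {..<n}"])
      have "(\<Oplus>\<^bsub>coh G M\<^esub>i\<in>{..<n}. coh_act G M (gen i) (r i))
          = (\<Oplus>\<^bsub>coh G M\<^esub>i\<in>{..<n}. coh_act G M (gen i) (restrict r {..<n} i))"
        using r(1) by (intro V.finsum_cong') (auto intro!: coh_act_closed gen_closed)
      with r show "restrict r {..<n} \<in> {..<n} \<rightarrow>\<^sub>E carrier (coh_ring G) \<and>
          x = (\<Oplus>\<^bsub>coh G M\<^esub>i\<in>{..<n}. coh_act G M (gen i) (restrict r {..<n} i))" by auto
    next
      fix r' assume r': "r' \<in> {..<n} \<rightarrow>\<^sub>E carrier (coh_ring G) \<and>
          x = (\<Oplus>\<^bsub>coh G M\<^esub>i\<in>{..<n}. coh_act G M (gen i) (r' i))"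
      show "r' = restrict r {..<n}"
      proof
        fix i
        show "r' i = restrict r {..<n} i"
          using coh_expansion_unique[of r' r i] r r' by (cases "i < n") (auto simp: PiE_def extensional_def)
      qed
    qed
  qed
  then show ?thesis
    unfolding right_free_of_rank_def using right_module_coh gen_closed by (intro conjI bexI[of _ gen]) auto
qed

section \<open>Tensor products with a finite-dimensional space\<close>

lemma free_space_simps [simp]:
  "carrier (free_space B) = {p. keys p \<subseteq> B}"
  "x \<oplus>\<^bsub>free_space B\<^esub> y = x + y" "\<zero>\<^bsub>free_space B\<^esub> = 0" "c \<odot>\<^bsub>free_space B\<^esub> x = pm_scale c x"
  by (simp_all add: free_space_def)

lemma kspace_free: "kspace (free_space B :: ('k::field, 'x \<Rightarrow>\<^sub>0 'k) module)"
  by (rule kspace_presentation[OF vector_space_pm_scale,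
        where Z = "{p. keys p \<subseteq> B}" and q = "\<lambda>p. p"])
    (simp_all add: keys_add_subset keys_pm_scale_subset)

lemma free_space_induct [consumes 1, case_names zero single add]:
  fixes p :: "'x \<Rightarrow>\<^sub>0 'k::field"
  assumes "keys p \<subseteq> B" "P 0"
    and "\<And>x c. x \<in> B \<Longrightarrow> P (single x c)"
    and "\<And>p q. keys p \<subseteq> B \<Longrightarrow> keys q \<subseteq> B \<Longrightarrow> P p \<Longrightarrow> P q \<Longrightarrow> P (p + q)"
  shows "P p"
proof -
  have "keys (\<Sum>x\<in>A. single x (lookup p x)) \<subseteq> B \<and>
      P (\<Sum>x\<in>A. single x (lookup p x))"
    if "finite A" "A \<subseteq> keys p" for A
    using that
  proof (induction A rule: finite_induct)
    case (insert x A)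
    have "keys (single x (lookup p x)) \<subseteq> B"
      using insert.prems assms(1) by auto
    moreover have "P (single x (lookup p x))"
      using insert.prems assms(1) by (intro assms(3)) auto
    ultimately show ?case
      using insert by (simp add: keys_add_subset assms(4))
  qed (simp add: assms)
  from this[of "keys p"] show ?thesis
    using lin_pm_single[of p] by (simp add: lin_def)
qed

text \<open>Linear extension with values in a space whose addition is not that of its type.\<close>
definition lin_in :: "('k::field, 'w, 'm) module_scheme \<Rightarrow> ('x \<Rightarrow> 'w) \<Rightarrow> ('x \<Rightarrow>\<^sub>0 'k) \<Rightarrow> 'w" where
  "lin_in W f p = (\<Oplus>\<^bsub>W\<^esub>x\<in>keys p. lookup p x \<odot>\<^bsub>W\<^esub> f x)"

locale lin_ext =
  fixes W :: "('k::field, 'w, 'm) module_scheme" and B :: "'x set" and f :: "'x \<Rightarrow> 'w"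
  assumes W: "kspace W" and f: "x \<in> B \<Longrightarrow> f x \<in> carrier W"
begin

sublocale W: Module.module "ring_of_type_algebra :: 'k ring" W by (rule W)

lemma smult_f: "x \<in> B \<Longrightarrow> c \<odot>\<^bsub>W\<^esub> f x \<in> carrier W"
  using f by (simp add: W.smult_closed)

lemma superset:
  assumes "finite A" "keys p \<subseteq> A" "A \<subseteq> B"
  shows "lin_in W f p = (\<Oplus>\<^bsub>W\<^esub>x\<in>A. lookup p x \<odot>\<^bsub>W\<^esub> f x)"
  unfolding lin_in_def using assms smult_f W.smult_l_null f
  by (intro W.M.add.finprod_mono_neutral_cong_left) (auto simp: in_keys_iff subset_iff)

lemma closed:
  assumes "keys p \<subseteq> B"
  shows "lin_in W f p \<in> carrier W"
  unfolding lin_in_def using assms smult_f by (intro W.M.finsum_closed) auto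

lemma add:
  assumes "keys p \<subseteq> B" "keys q \<subseteq> B"
  shows "lin_in W f (p + q) = lin_in W f p \<oplus>\<^bsub>W\<^esub> lin_in W f q"
proof -
  let ?A = "keys p \<union> keys q"
  have sub: "keys (p + q) \<subseteq> ?A" by (rule Poly_Mapping.keys_add)
  have "lin_in W f (p + q)
      = (\<Oplus>\<^bsub>W\<^esub>x\<in>?A. lookup p x \<odot>\<^bsub>W\<^esub> f x \<oplus>\<^bsub>W\<^esub> lookup q x \<odot>\<^bsub>W\<^esub> f x)"
    using assms sub smult_f f W.smult_l_distr
    by (subst superset[of ?A]) (auto simp: lookup_add intro!: W.M.finsum_cong')
  also have "\<dots> = lin_in W f p \<oplus>\<^bsub>W\<^esub> lin_in W f q"
    using assms smult_f
    by (subst (1 2) superset[of ?A]) (auto intro!: W.M.finsum_addf)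
  finally show ?thesis .
qed

lemma scale:
  assumes "keys p \<subseteq> B"
  shows "lin_in W f (pm_scale c p) = c \<odot>\<^bsub>W\<^esub> lin_in W f p"
proof -
  have "lin_in W f (pm_scale c p)
      = (\<Oplus>\<^bsub>W\<^esub>x\<in>keys p. c \<odot>\<^bsub>W\<^esub> (lookup p x \<odot>\<^bsub>W\<^esub> f x))"
    using assms smult_f f W.smult_assoc1 keys_pm_scale[of c p]
    by (subst superset[of "keys p"]) (auto intro!: W.M.finsum_cong' W.smult_closed)
  also have "\<dots> = c \<odot>\<^bsub>W\<^esub> lin_in W f p"
    unfolding lin_in_def using assms smult_f
    by (intro W.finsum_smult_ldistr[symmetric]) auto
  finally show ?thesis .
qed

lemma zero: "lin_in W f 0 = \<zero>\<^bsub>W\<^esub>"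
  by (simp add: lin_in_def)

lemma single:
  assumes "x \<in> B"
  shows "lin_in W f (single x c) = c \<odot>\<^bsub>W\<^esub> f x"
  using superset[of "{x}" "single x c"] assms smult_f[OF assms, of c]
  by (simp add: W.M.finsum_insert)

lemma diff:
  assumes "keys p \<subseteq> B" "keys q \<subseteq> B"
  shows "lin_in W f p = lin_in W f (p - q) \<oplus>\<^bsub>W\<^esub> lin_in W f q"
  using add[of "p - q" q] keys_diff_subset[OF assms] assms(2) by simp

lemma sum:
  assumes "finite I" "\<And>i. i \<in> I \<Longrightarrow> keys (g i) \<subseteq> B"
  shows "keys (sum g I) \<subseteq> B"
    "lin_in W f (sum g I) = (\<Oplus>\<^bsub>W\<^esub>i\<in>I. lin_in W f (g i))"
proof -
  have "keys (sum g I) \<subseteq> B \<and> lin_in W f (sum g I) = (\<Oplus>\<^bsub>W\<^esub>i\<in>I. lin_in W f (g i))"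
    using assms
  proof (induction I rule: finite_induct)
    case (insert i I)
    then have c: "(\<lambda>i. lin_in W f (g i)) \<in> I \<rightarrow> carrier W" "lin_in W f (g i) \<in> carrier W"
      using closed by auto
    from insert show ?case
      by (auto simp: W.M.finsum_insert[OF insert(1,2) c] add keys_add_subset)
  qed (simp add: zero)
  then show "keys (sum g I) \<subseteq> B"
    "lin_in W f (sum g I) = (\<Oplus>\<^bsub>W\<^esub>i\<in>I. lin_in W f (g i))" by auto
qed

end

lemma lin_in_linear_map:
  assumes "lin_ext W B f" "lin_ext W' B' f'" "linear_map W W' \<theta>"
    and "\<And>x. x \<in> B \<Longrightarrow> s x \<in> B' \<and> f' (s x) = \<theta> (f x)"
    and p: "keys p \<subseteq> B"
  shows "lin_in W' f' (pm_push s p) = \<theta> (lin_in W f p)"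
proof -
  interpret f: lin_ext W B f by fact
  interpret f': lin_ext W' B' f' by fact
  have \<theta>: "\<And>x y. x \<in> carrier W \<Longrightarrow> y \<in> carrier W \<Longrightarrow> \<theta> (x \<oplus>\<^bsub>W\<^esub> y) = \<theta> x \<oplus>\<^bsub>W'\<^esub> \<theta> y"
    "\<And>c x. x \<in> carrier W \<Longrightarrow> \<theta> (c \<odot>\<^bsub>W\<^esub> x) = c \<odot>\<^bsub>W'\<^esub> \<theta> x"
    using assms(3) by (auto simp: linear_map_def)
  have push: "keys (pm_push s q) \<subseteq> B'" if "keys q \<subseteq> B" for q :: "_ \<Rightarrow>\<^sub>0 'b"
    using keys_pm_push[of s q] that assms(4) by blast
  show ?thesis
    using p
  proof (induction p rule: free_space_induct)
    case zero
    have "\<theta> \<zero>\<^bsub>W\<^esub> = \<zero>\<^bsub>W'\<^esub>"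
      using \<theta>(2)[of "\<zero>\<^bsub>W\<^esub>" 0] assms(3) f'.W.smult_l_null[of "\<theta> \<zero>\<^bsub>W\<^esub>"] f.W.smult_l_null[of "\<zero>\<^bsub>W\<^esub>"]
      by (auto simp: linear_map_def)
    then show ?case by (simp add: f.zero f'.zero)
  next
    case (single x c)
    then show ?case using assms(4) f.f \<theta>(2) by (simp add: f.single f'.single)
  next
    case (add p q)
    then show ?case by (simp add: pm_push_add f.add f'.add push \<theta>(1) f.closed)
  qed
qed

subsection \<open>The kernel of the canonical projection onto the tensor product\<close>

lemma tensor_kernel_mem:
  "p \<in> tensor_kernel U V \<longleftrightarrow> (\<forall>W. submodule W (ring_of_type_algebra :: 'k::field ring)
     (free_space (carrier U \<times> carrier V)) \<longrightarrow> tensor_relations U V \<subseteq> W \<longrightarrow> p \<in> W)"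
  by (auto simp: tensor_kernel_def hull_def)

lemma submodule_free_closed:
  assumes "submodule W (ring_of_type_algebra :: 'k::field ring) (free_space B)"
  shows "0 \<in> W" "p \<in> W \<Longrightarrow> q \<in> W \<Longrightarrow> p + q \<in> W" "p \<in> W \<Longrightarrow> pm_scale c p \<in> W"
    "p \<in> W \<Longrightarrow> keys p \<subseteq> B"
proof -
  interpret Q: quotient_of_space "free_space B" W
    by (rule quotient_of_space.intro[OF kspace_free assms])
  show "0 \<in> W" "p \<in> W \<Longrightarrow> q \<in> W \<Longrightarrow> p + q \<in> W" "p \<in> W \<Longrightarrow> pm_scale c p \<in> W"
    "p \<in> W \<Longrightarrow> keys p \<subseteq> B"
    using Q.U_closed(1) Q.U_closed(2)[of p q] Q.U_closed(3)[of p c] Q.U_carrier[of p] by auto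
qed

locale tensor_pair =
  fixes U :: "('k::field, 'u, 'm) module_scheme" and V :: "('k, 'v, 'n) module_scheme"
  assumes U: "kspace U" and V: "kspace V"
begin

sublocale U: Module.module "ring_of_type_algebra :: 'k ring" U by (rule U)
sublocale V: Module.module "ring_of_type_algebra :: 'k ring" V by (rule V)

abbreviation "B \<equiv> carrier U \<times> carrier V"
abbreviation "N \<equiv> tensor_kernel U V"

lemma relations_subset: "p \<in> tensor_relations U V \<Longrightarrow> keys p \<subseteq> B"
  by (auto simp: tensor_relations_def U.smult_closed V.smult_closed
      dest!: subsetD[OF keys_diff] split: if_splits)

lemma N_closed:
  "0 \<in> N" "p \<in> N \<Longrightarrow> q \<in> N \<Longrightarrow> p + q \<in> N" "p \<in> N \<Longrightarrow> pm_scale c p \<in> N"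
  "p \<in> N \<Longrightarrow> keys p \<subseteq> B"
proof -
  show "0 \<in> N" "p \<in> N \<Longrightarrow> q \<in> N \<Longrightarrow> p + q \<in> N" "p \<in> N \<Longrightarrow> pm_scale c p \<in> N"
    unfolding tensor_kernel_mem using submodule_free_closed(1-3) by blast+
  have "submodule {p. keys p \<subseteq> B} (ring_of_type_algebra :: 'k ring) (free_space B)"
    by (rule kspace_submoduleI[OF kspace_free]) (simp_all add: keys_add_subset keys_pm_scale_subset)
  then show "p \<in> N \<Longrightarrow> keys p \<subseteq> B"
    using relations_subset unfolding tensor_kernel_mem by blast
qed

lemma N_submodule: "submodule N (ring_of_type_algebra :: 'k ring) (free_space B)"
proof (rule kspace_submoduleI[OF kspace_free])
  show "N \<subseteq> carrier (free_space B)"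
    by (rule subsetI) (simp add: N_closed(4))
qed (simp_all add: N_closed)

sublocale Q: quotient_of_space "free_space B" N
  by (rule quotient_of_space.intro[OF kspace_free N_submodule])

lemma N_diff: "p \<in> N \<Longrightarrow> q \<in> N \<Longrightarrow> p - q \<in> N"
  using N_closed(2)[of p "pm_scale (-1) q"] N_closed(3)[of q "-1"] pm.scale_minus_left[of 1 q] by simp

lemma coset_eq:
  assumes "keys p \<subseteq> B" "keys q \<subseteq> B"
  shows "N +>\<^bsub>free_space B\<^esub> p = N +>\<^bsub>free_space B\<^esub> q \<longleftrightarrow> p - q \<in> N"
  using Q.coset_eq_iff[of p q] assms by (auto simp: algebra_simps intro: bexI[of _ "p - q"])

lemma rel:
  assumes "u \<in> carrier U" "v \<in> carrier V"
  shows "u' \<in> carrier U \<Longrightarrow> single (u \<oplus>\<^bsub>U\<^esub> u', v) 1 - single (u, v) 1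
        - single (u', v) 1 \<in> N"
    and "v' \<in> carrier V \<Longrightarrow> single (u, v \<oplus>\<^bsub>V\<^esub> v') 1 - single (u, v) 1
        - single (u, v') 1 \<in> N"
    and "single (c \<odot>\<^bsub>U\<^esub> u, v) 1 - single (u, v) c \<in> N"
    and "single (u, c \<odot>\<^bsub>V\<^esub> v) 1 - single (u, v) c \<in> N"
  using assms unfolding tensor_kernel_mem tensor_relations_def by blast+

lemma single_zero:
  "v \<in> carrier V \<Longrightarrow> single (\<zero>\<^bsub>U\<^esub>, v) 1 \<in> N"
  "u \<in> carrier U \<Longrightarrow> single (u, \<zero>\<^bsub>V\<^esub>) 1 \<in> N"
  using rel(3)[of "\<zero>\<^bsub>U\<^esub>" v 0] rel(4)[of u "\<zero>\<^bsub>V\<^esub>" 0] U.smult_l_null V.smult_l_null by auto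

lemma single_sum:
  assumes "finite I" "\<And>i. i \<in> I \<Longrightarrow> x i \<in> carrier U" "v \<in> carrier V"
  shows "single (\<Oplus>\<^bsub>U\<^esub>i\<in>I. x i, v) 1 - (\<Sum>i\<in>I. single (x i, v) 1) \<in> N"
  using assms
proof (induction I rule: finite_induct)
  case empty
  then show ?case by (simp add: single_zero)
next
  case (insert i I)
  have c: "x \<in> I \<rightarrow> carrier U" "x i \<in> carrier U" using insert.prems by auto
  have "single (x i \<oplus>\<^bsub>U\<^esub> finsum U x I, v) 1 - single (x i, v) 1
      - single (finsum U x I, v) 1 \<in> N"
    using c insert.prems by (intro rel) auto
  from N_closed(2)[OF this insert.IH] insert show ?case
    by (simp add: U.M.finsum_insert[OF insert(1,2) c] algebra_simps)
qed

end

text \<open>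
  Let \<open>U\<close> be spanned by finitely many \<open>b i\<close>. A bilinear map \<open>\<beta>\<close> on \<open>U \<times> V\<close> induces an isomorphism
  on \<open>U \<otimes> V\<close> as soon as every element of the target is a unique combination of values
  \<open>\<beta> (b i) (v i)\<close>: modulo the tensor relations every element is of the form \<open>\<Sum>i. b i \<otimes> v i\<close>.
\<close>
locale tensor_presentation = tensor_pair U V
  for U :: "('k::field, 'u, 'm) module_scheme" and V :: "('k, 'v, 'n) module_scheme" +
  fixes W :: "('k, 'w, 'o) module_scheme" and \<beta> :: "'u \<Rightarrow> 'v \<Rightarrow> 'w" and I :: "'i set" and b :: "'i \<Rightarrow> 'u"
  assumes W: "kspace W"
    and \<beta>_closed: "u \<in> carrier U \<Longrightarrow> v \<in> carrier V \<Longrightarrow> \<beta> u v \<in> carrier W"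
    and \<beta>_add_left: "u \<in> carrier U \<Longrightarrow> u' \<in> carrier U \<Longrightarrow> v \<in> carrier V \<Longrightarrow>
      \<beta> (u \<oplus>\<^bsub>U\<^esub> u') v = \<beta> u v \<oplus>\<^bsub>W\<^esub> \<beta> u' v"
    and \<beta>_add_right: "u \<in> carrier U \<Longrightarrow> v \<in> carrier V \<Longrightarrow> v' \<in> carrier V \<Longrightarrow>
      \<beta> u (v \<oplus>\<^bsub>V\<^esub> v') = \<beta> u v \<oplus>\<^bsub>W\<^esub> \<beta> u v'"
    and \<beta>_smult_left: "u \<in> carrier U \<Longrightarrow> v \<in> carrier V \<Longrightarrow> \<beta> (c \<odot>\<^bsub>U\<^esub> u) v = c \<odot>\<^bsub>W\<^esub> \<beta> u v"
    and \<beta>_smult_right: "u \<in> carrier U \<Longrightarrow> v \<in> carrier V \<Longrightarrow> \<beta> u (c \<odot>\<^bsub>V\<^esub> v) = c \<odot>\<^bsub>W\<^esub> \<beta> u v"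
    and I: "finite I" and b: "i \<in> I \<Longrightarrow> b i \<in> carrier U"
    and span: "u \<in> carrier U \<Longrightarrow> \<exists>c. u = (\<Oplus>\<^bsub>U\<^esub>i\<in>I. c i \<odot>\<^bsub>U\<^esub> b i)"
    and expand: "w \<in> carrier W \<Longrightarrow> \<exists>r. r \<in> I \<rightarrow> carrier V \<and> w = (\<Oplus>\<^bsub>W\<^esub>i\<in>I. \<beta> (b i) (r i))"
    and unique: "r \<in> I \<rightarrow> carrier V \<Longrightarrow> (\<Oplus>\<^bsub>W\<^esub>i\<in>I. \<beta> (b i) (r i)) = \<zero>\<^bsub>W\<^esub> \<Longrightarrow> i \<in> I \<Longrightarrow> r i = \<zero>\<^bsub>V\<^esub>"
begin

abbreviation "\<beta>_lin \<equiv> lin_in W (\<lambda>(u, v). \<beta> u v)"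

sublocale L: lin_ext W B "\<lambda>(u, v). \<beta> u v"
  by (rule lin_ext.intro[OF W]) (use \<beta>_closed in auto)

lemma \<beta>_lin_N:
  assumes "p \<in> N"
  shows "\<beta>_lin p = \<zero>\<^bsub>W\<^esub>"
proof -
  let ?W = "{p. keys p \<subseteq> B \<and> \<beta>_lin p = \<zero>\<^bsub>W\<^esub>}"
  have "submodule ?W (ring_of_type_algebra :: 'k ring) (free_space B)"
    by (rule kspace_submoduleI[OF kspace_free])
      (simp_all add: L.zero L.add L.scale L.W.smult_r_null[simplified] keys_add_subset keys_pm_scale_subset
        Collect_mono_iff)
  moreover have "tensor_relations U V \<subseteq> ?W"
  proof
    fix p assume p: "p \<in> tensor_relations U V"
    have diff: "\<beta>_lin (q - r) = \<zero>\<^bsub>W\<^esub>"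
      if "keys q \<subseteq> B" "keys r \<subseteq> B" "\<beta>_lin q = \<beta>_lin r" for q r
      using L.diff[OF that(1,2)] that(3) L.closed[OF keys_diff_subset[OF that(1,2)]] L.closed[OF that(2)]
      by (metis L.W.M.add.r_cancel_one')
    have s: "keys (single (u, v) c) \<subseteq> B"
      if "u \<in> carrier U" "v \<in> carrier V" for u v c
      using that by (auto split: if_splits)
    have "\<beta>_lin p = \<zero>\<^bsub>W\<^esub>"
      using p unfolding tensor_relations_def diff_diff_eq
      by (elim UnE CollectE exE conjE; hypsubst; intro diff)
        (simp_all add: s keys_add_subset L.add L.single \<beta>_closed \<beta>_add_left \<beta>_add_right
          \<beta>_smult_left \<beta>_smult_right U.smult_closed V.smult_closed L.W.smult_one[simplified])
    then show "p \<in> ?W" using relations_subset[OF p] by simp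
  qed
  ultimately show ?thesis using assms unfolding tensor_kernel_mem by blast
qed

text \<open>
  Modulo the tensor relations, \<open>u \<otimes> v\<close> equals \<open>\<Sum>i. b i \<otimes> a i v\<close> if \<open>u = \<Sum>i. a i b i\<close>, and terms with the
  same \<open>b i\<close> can be collected.
\<close>
lemma normal_form:
  assumes "keys p \<subseteq> B"
  shows "\<exists>v. v \<in> I \<rightarrow> carrier V \<and> p - (\<Sum>i\<in>I. single (b i, v i) 1) \<in> N"
  using assms
proof (induction p rule: free_space_induct)
  case zero
  have "(\<Sum>i\<in>J. single (b i, \<zero>\<^bsub>V\<^esub>) 1) \<in> N" if "finite J" "J \<subseteq> I" for J
    using that by (induction J rule: finite_induct) (auto simp: N_closed single_zero b)
  then show ?case
    using N_diff[OF N_closed(1)] I by (intro exI[of _ "\<lambda>_. \<zero>\<^bsub>V\<^esub>"]) auto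
next
  case (single x c)
  then obtain u v where x: "x = (u, v)" "u \<in> carrier U" "v \<in> carrier V" by auto
  obtain a where a: "u = (\<Oplus>\<^bsub>U\<^esub>i\<in>I. a i \<odot>\<^bsub>U\<^esub> b i)" using span[OF x(2)] by auto
  let ?v = "\<lambda>i. (c * a i) \<odot>\<^bsub>V\<^esub> v"
  have "single (u, v) 1 - (\<Sum>i\<in>I. single (a i \<odot>\<^bsub>U\<^esub> b i, v) 1) \<in> N"
    unfolding a using b x(3) by (intro single_sum I) (auto simp: U.smult_closed)
  from N_closed(3)[OF this, of c]
  have 1: "single x c - (\<Sum>i\<in>I. single (a i \<odot>\<^bsub>U\<^esub> b i, v) c) \<in> N"
    by (simp add: x(1) pm.scale_right_diff_distrib pm.scale_sum_right)
  have "(\<Sum>i\<in>J. single (a i \<odot>\<^bsub>U\<^esub> b i, v) c) - (\<Sum>i\<in>J. single (b i, ?v i) 1) \<in> N"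
    if "finite J" "J \<subseteq> I" for J
    using that
  proof (induction J rule: finite_induct)
    case (insert i J)
    have "single (a i \<odot>\<^bsub>U\<^esub> b i, v) c - single (b i, v) (c * a i) \<in> N"
      using N_closed(3)[OF rel(3)[of "b i" v "a i"], of c] insert.prems b x(3)
      by (simp add: pm.scale_right_diff_distrib)
    moreover have "single (b i, ?v i) 1 - single (b i, v) (c * a i) \<in> N"
      using insert.prems b x(3) by (intro rel) auto
    ultimately have "single (a i \<odot>\<^bsub>U\<^esub> b i, v) c - single (b i, ?v i) 1 \<in> N"
      using N_diff by fastforce
    with insert show ?case by (simp add: add_diff_add N_closed(2))
  qed (simp add: N_closed)
  from N_closed(2)[OF 1 this[OF I]]
  show ?case using x(3) by (intro exI[of _ ?v]) (auto simp: V.smult_closed)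
next
  case (add p q)
  then obtain v w where v: "v \<in> I \<rightarrow> carrier V" "p - (\<Sum>i\<in>I. single (b i, v i) 1) \<in> N"
    and w: "w \<in> I \<rightarrow> carrier V" "q - (\<Sum>i\<in>I. single (b i, w i) 1) \<in> N" by auto
  let ?s = "\<lambda>i. single (b i, v i \<oplus>\<^bsub>V\<^esub> w i) 1 - single (b i, v i) 1
        - single (b i, w i) 1"
  have "(\<Sum>i\<in>J. ?s i) \<in> N" if "finite J" "J \<subseteq> I" for J
    using that
  proof (induction J rule: finite_induct)
    case (insert i J)
    then have "?s i \<in> N" using v(1) w(1) b by (intro rel) auto
    with insert N_closed(2) show ?case by simp
  qed (simp add: N_closed)
  from N_diff[OF N_closed(2)[OF v(2) w(2)] this[OF I]]
  have "p + q - (\<Sum>i\<in>I. single (b i, v i \<oplus>\<^bsub>V\<^esub> w i) 1) \<in> N"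
    by (simp add: sum_subtractf sum.distrib algebra_simps)
  then show ?case using v(1) w(1) by (intro exI[of _ "\<lambda>i. v i \<oplus>\<^bsub>V\<^esub> w i"]) auto
qed

lemma \<beta>_lin_normal_form:
  assumes "v \<in> I \<rightarrow> carrier V"
  shows "keys (\<Sum>i\<in>I. single (b i, v i) (1 :: 'k)) \<subseteq> B"
    "\<beta>_lin (\<Sum>i\<in>I. single (b i, v i) 1) = (\<Oplus>\<^bsub>W\<^esub>i\<in>I. \<beta> (b i) (v i))"
proof -
  have s: "keys (single (b i, v i) (1 :: 'k)) \<subseteq> B" if "i \<in> I" for i
    using assms b that by auto
  show "keys (\<Sum>i\<in>I. single (b i, v i) (1 :: 'k)) \<subseteq> B"
    using s by (intro L.sum I) auto
  have "\<beta>_lin (\<Sum>i\<in>I. single (b i, v i) 1)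
      = (\<Oplus>\<^bsub>W\<^esub>i\<in>I. \<beta>_lin (single (b i, v i) 1))"
    using s by (intro L.sum I) auto
  also have "\<dots> = (\<Oplus>\<^bsub>W\<^esub>i\<in>I. \<beta> (b i) (v i))"
    using assms b
    by (intro L.W.M.finsum_cong') (auto simp: L.single \<beta>_closed L.W.smult_one[simplified] Pi_iff)
  finally show "\<beta>_lin (\<Sum>i\<in>I. single (b i, v i) 1) = (\<Oplus>\<^bsub>W\<^esub>i\<in>I. \<beta> (b i) (v i))" .
qed

text \<open>
  An element in normal form is sent to zero only if all its coefficients \<open>v i\<close> vanish. So the tensor
  relations generate the whole kernel, although they were only known to be contained in it.
\<close>
lemma \<beta>_lin_kernel:
  assumes p: "keys p \<subseteq> B" and 0: "\<beta>_lin p = \<zero>\<^bsub>W\<^esub>"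
  shows "p \<in> N"
proof -
  obtain v where v: "v \<in> I \<rightarrow> carrier V" "p - (\<Sum>i\<in>I. single (b i, v i) 1) \<in> N"
    using normal_form[OF p] by auto
  note nf = \<beta>_lin_normal_form[OF v(1)]
  have "(\<Oplus>\<^bsub>W\<^esub>i\<in>I. \<beta> (b i) (v i)) = \<zero>\<^bsub>W\<^esub>"
    using L.diff[OF p nf(1)] \<beta>_lin_N[OF v(2)] L.closed[OF nf(1)] 0 nf(2) by simp
  then have v0: "v i = \<zero>\<^bsub>V\<^esub>" if "i \<in> I" for i using unique v(1) that by blast
  have "(\<Sum>i\<in>J. single (b i, v i) 1) \<in> N" if "finite J" "J \<subseteq> I" for J
    using that by (induction J rule: finite_induct) (auto simp: N_closed single_zero b v0)
  from N_closed(2)[OF v(2) this[OF I]] show ?thesis by simp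
qed

definition tensor_iso :: "('u \<times> 'v \<Rightarrow>\<^sub>0 'k) set \<Rightarrow> 'w" where
  "tensor_iso T = \<beta>_lin (SOME p. p \<in> T)"

lemma coset_closed:
  assumes "keys p \<subseteq> B" "q \<in> N +>\<^bsub>free_space B\<^esub> p"
  shows "keys q \<subseteq> B" "\<beta>_lin q = \<beta>_lin p"
proof -
  obtain n where n: "n \<in> N" "q = n + p" using assms(2) by (auto simp: Q.mem_coset)
  show "keys q \<subseteq> B" unfolding n(2) by (rule keys_add_subset[OF N_closed(4)[OF n(1)] assms(1)])
  show "\<beta>_lin q = \<beta>_lin p"
    unfolding n(2) using assms(1) N_closed(4)[OF n(1)] \<beta>_lin_N[OF n(1)] L.closed[OF assms(1)]
    by (simp add: L.add)
qed

lemma mem_own_coset: "p \<in> N +>\<^bsub>free_space B\<^esub> p"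
  using N_closed(1) by (auto simp: Q.mem_coset intro!: bexI[of _ 0])

lemma tensor_iso_coset:
  assumes "keys p \<subseteq> B"
  shows "tensor_iso (N +>\<^bsub>free_space B\<^esub> p) = \<beta>_lin p"
  unfolding tensor_iso_def by (rule coset_closed(2)[OF assms]) (rule someI, rule mem_own_coset)

lemma carrier_tensor:
  "carrier (tensor_product U V) = (\<lambda>p. N +>\<^bsub>free_space B\<^esub> p) ` {p. keys p \<subseteq> B}"
  by (simp add: tensor_product_def Q.carrier_quotient)

lemma tensor_iso_pure:
  "u \<in> carrier U \<Longrightarrow> v \<in> carrier V \<Longrightarrow> tensor_iso (pure_tensor U V u v) = \<beta> u v"
  unfolding pure_tensor_def
  by (subst tensor_iso_coset) (auto simp: L.single \<beta>_closed L.W.smult_one[simplified])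

theorem linear_iso_tensor_iso: "linear_iso (tensor_product U V) W tensor_iso"
  unfolding linear_iso_def
proof
  show "linear_map (tensor_product U V) W tensor_iso"
    unfolding linear_map_def
    by (auto simp: carrier_tensor tensor_iso_coset L.closed L.add L.scale
        Q.add_quotient[folded tensor_product_def] Q.smult_quotient[folded tensor_product_def]
        keys_add_subset keys_pm_scale_subset)
  show "bij_betw tensor_iso (carrier (tensor_product U V)) (carrier W)"
    unfolding bij_betw_def
  proof
    show "inj_on tensor_iso (carrier (tensor_product U V))"
    proof (rule inj_onI)
      fix s t assume "s \<in> carrier (tensor_product U V)" "t \<in> carrier (tensor_product U V)"
        and eq: "tensor_iso s = tensor_iso t"
      then obtain p q where p: "keys p \<subseteq> B" "s = N +>\<^bsub>free_space B\<^esub> p"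
        and q: "keys q \<subseteq> B" "t = N +>\<^bsub>free_space B\<^esub> q"
        by (auto simp: carrier_tensor)
      have "\<beta>_lin p = \<beta>_lin q" using eq p q by (simp add: tensor_iso_coset)
      then have "\<beta>_lin (p - q) = \<zero>\<^bsub>W\<^esub>"
        using L.diff[OF p(1) q(1)] L.closed[OF keys_diff_subset[OF p(1) q(1)]] L.closed[OF q(1)]
        by (metis L.W.M.add.r_cancel_one')
      then show "s = t"
        using p q by (simp add: coset_eq \<beta>_lin_kernel keys_diff_subset)
    qed
    show "tensor_iso ` carrier (tensor_product U V) = carrier W"
    proof (intro subset_antisym subsetI)
      fix w assume "w \<in> carrier W"
      then obtain v where v: "v \<in> I \<rightarrow> carrier V" "w = (\<Oplus>\<^bsub>W\<^esub>i\<in>I. \<beta> (b i) (v i))"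
        using expand by blast
      note nf = \<beta>_lin_normal_form[OF v(1)]
      have "w = tensor_iso (N +>\<^bsub>free_space B\<^esub> (\<Sum>i\<in>I. single (b i, v i) 1))"
        using nf v(2) by (simp add: tensor_iso_coset)
      then show "w \<in> tensor_iso ` carrier (tensor_product U V)"
        using nf(1) by (auto simp: carrier_tensor)
    qed (auto simp: carrier_tensor tensor_iso_coset L.closed)
  qed
qed

text \<open>
  It suffices to compare the two sides on pairs. That the map on the tensor product does not depend
  on representatives follows from the description of \<^const>\<open>tensor_kernel\<close> as the kernel of \<open>\<beta>_lin\<close>.
\<close>
theorem tensor_iso_equivariant:
  assumes S: "\<And>u. u \<in> carrier U \<Longrightarrow> S u \<in> carrier U" and T: "\<And>v. v \<in> carrier V \<Longrightarrow> T v \<in> carrier V"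
    and \<theta>: "linear_map W W \<theta>"
    and eq: "\<And>u v. u \<in> carrier U \<Longrightarrow> v \<in> carrier V \<Longrightarrow> \<beta> (S u) (T v) = \<theta> (\<beta> u v)"
    and t: "t \<in> carrier (tensor_product U V)"
  shows "tensor_iso (tensor_map U V S T t) = \<theta> (tensor_iso t)"
proof -
  obtain p where p: "keys p \<subseteq> B" "t = N +>\<^bsub>free_space B\<^esub> p"
    using t by (auto simp: carrier_tensor)
  let ?push = "pm_push (map_prod S T)"
  have push: "\<beta>_lin (?push q) = \<theta> (\<beta>_lin q)" if "keys q \<subseteq> B" for q
    by (rule lin_in_linear_map[OF L.lin_ext_axioms L.lin_ext_axioms \<theta> _ that]) (use S T eq in auto)
  have "map_prod S T ` B \<subseteq> B" using S T by auto
  then have push_closed: "keys (?push q) \<subseteq> B" if "keys q \<subseteq> B" for q :: "_ \<Rightarrow>\<^sub>0 'k"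
    using keys_pm_push[of "map_prod S T" q] that by blast
  have "N +>\<^bsub>free_space B\<^esub> ?push q = N +>\<^bsub>free_space B\<^esub> ?push p" if "q \<in> t" for q
  proof -
    note q = coset_closed[OF p(1), of q] that[unfolded p(2)]
    have c: "keys (?push q) \<subseteq> B" "keys (?push p) \<subseteq> B"
      using q p push_closed by auto
    have "\<beta>_lin (?push q) = \<beta>_lin (?push p)"
      using q p by (simp add: push)
    then have "\<beta>_lin (?push q - ?push p) = \<zero>\<^bsub>W\<^esub>"
      using L.diff[OF c] L.closed[OF keys_diff_subset[OF c]] L.closed[OF c(2)]
      by (metis L.W.M.add.r_cancel_one')
    then show ?thesis
      using c by (simp add: coset_eq \<beta>_lin_kernel keys_diff_subset)
  qed
  then have "tensor_map U V S T t = (\<Union>q\<in>t. N +>\<^bsub>free_space B\<^esub> ?push p)"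
    unfolding tensor_map_def by (rule SUP_cong[OF refl])
  moreover have "t \<noteq> {}" using mem_own_coset unfolding p(2) by (metis empty_iff)
  ultimately have "tensor_map U V S T t = N +>\<^bsub>free_space B\<^esub> ?push p"
    by simp
  then show ?thesis
    using p push push_closed by (simp add: tensor_iso_coset)
qed

end

section \<open>The action isomorphism\<close>

lemma gmod_map_compose_cup:
  assumes "gmod_map G M M T"
  shows "T (cup (module.smult M) F h xs) = cup (module.smult M) (\<lambda>ys. T (F ys)) h xs"
  by (rule cup_linear) (use assms in \<open>auto simp: gmod_map_def\<close>)

abbreviation (in gmod)
  "HK \<equiv> (coh_ring G :: ('k, nat \<Rightarrow> (('g list \<Rightarrow>\<^sub>0 'k) \<Rightarrow> 'k) set) module)"

lemma (in gmod) kspace_coh_ring: "kspace HK"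
proof -
  interpret K: gmod G K by (rule gmod_K)
  show ?thesis
    by (rule kspace_presentation[OF vector_space_fun[OF vector_space_mult],
          where Z = "{F. K.ZB F}" and q = "CLS G K"])
      (simp_all add: K.carrier_coh K.coh_zero K.coh_add K.coh_smult zero_fun_def plus_fun_def
        K.cocycle_zero bounded_degree_zero K.ZB_add K.ZB_smult[simplified])
qed

lemma (in gmod) coh_map_linear:
  assumes T: "gmod_map G M M T"
  shows "linear_map (coh G M) (coh G M) (coh_map G M T)"
proof -
  have ZB: "ZB (\<lambda>xs. T (F xs))" if "ZB F" for F
    using that cocycle_map[OF T] bounded_degree_compose[of F T] gmod_map_diff(1)[OF T] by simp
  have T': "T (x + y) = T x + T y" "T (c \<odot>\<^bsub>M\<^esub> x) = c \<odot>\<^bsub>M\<^esub> T x" for x y c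
    using T by (auto simp: gmod_map_def)
  note CLS = coh_map_CLS[OF gmod_axioms T]
  show ?thesis
    unfolding linear_map_def
  proof (intro conjI ballI allI funcsetI)
    fix x assume "x \<in> carrier (coh G M)"
    then obtain F where F: "x = CLS G M F" "ZB F" by (auto simp: carrier_coh)
    show "coh_map G M T x \<in> carrier (coh G M)"
      using F ZB by (auto simp: carrier_coh CLS)
    show "coh_map G M T (c \<odot>\<^bsub>coh G M\<^esub> x) = c \<odot>\<^bsub>coh G M\<^esub> coh_map G M T x" for c
      using F ZB[OF F(2)] by (simp add: coh_smult CLS cocycle_smult T')
    fix y assume "y \<in> carrier (coh G M)"
    then obtain H where H: "y = CLS G M H" "ZB H" by (auto simp: carrier_coh)
    show "coh_map G M T (x \<oplus>\<^bsub>coh G M\<^esub> y) = coh_map G M T x \<oplus>\<^bsub>coh G M\<^esub> coh_map G M T y"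
      using F H ZB[OF F(2)] ZB[OF H(2)] by (simp add: coh_add CLS cocycle_add T')
  qed
qed

lemma (in gmod) in_degree_zero_obtain:
  assumes "x \<in> carrier (Ext G M 0)"
  obtains F where "Z F" "x = cls G M 0 F" "in_degree (Ext G M) 0 x = CLS G M (component 0 F)"
  using assms that in_degree_cls[of 0] by (auto simp: carrier_Ext)

text \<open>
  The classes of the \<open>u i\<close> span the cohomology in degree \<open>0\<close>, and the existence and uniqueness of
  expansions is what \<^locale>\<open>tensor_presentation\<close> asks for.
\<close>
lemma (in trace_free) tensor_presentation_coh:
  "tensor_presentation (Ext G M 0) HK (coh G M)
     (\<lambda>x h. coh_act G M (in_degree (Ext G M) 0 x) h) I (\<lambda>i. cls G M 0 (constant_cocycle (u i)))"
proof (intro tensor_presentation.intro tensor_pair.intro tensor_presentation_axioms.intro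
    kspace_Ext kspace_coh_ring kspace_coh finite_I)
  interpret K: gmod G K by (rule gmod_K)
  interpret KV: Module.module "ring_of_type_algebra :: 'k ring" "coh G K" by (rule K.kspace_coh)
  interpret V: Module.module "ring_of_type_algebra :: 'k ring" "coh G M" by (rule kspace_coh)
  let ?\<beta> = "\<lambda>x. coh_act G M (in_degree (Ext G M) 0 x)"
  let ?b = "\<lambda>i. cls G M 0 (constant_cocycle (u i))"
  have deg: "in_degree (Ext G M) 0 x \<in> carrier (coh G M)" if "x \<in> carrier (Ext G M 0)" for x
    using that by (elim in_degree_zero_obtain) (auto simp: carrier_coh ZB_component)
  have deg_b: "in_degree (Ext G M) 0 (?b i) = gen i" for i
    by (simp add: in_degree_cls component_constant_cocycle gen_def)
  fix x h assume x: "x \<in> carrier (Ext G M 0)" and h: "h \<in> carrier HK"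
  show "?\<beta> x h \<in> carrier (coh G M)" using deg x h by (simp add: coh_act_closed)
  obtain F where F: "Z F" "x = cls G M 0 F" using x by (auto simp: carrier_Ext)
  have comp_add: "component 0 (\<lambda>xs. F xs + H xs) = (\<lambda>xs. component 0 F xs + component 0 H xs)" for F H :: "'g list \<Rightarrow> 'v"
    by (auto simp: component_def)
  have comp_smult: "component 0 (\<lambda>xs. c \<odot>\<^bsub>M\<^esub> F xs) = (\<lambda>xs. c \<odot>\<^bsub>M\<^esub> component 0 F xs)" for c F
    by (auto simp: component_def)
  show "?\<beta> (x \<oplus>\<^bsub>Ext G M 0\<^esub> x') h = ?\<beta> x h \<oplus>\<^bsub>coh G M\<^esub> ?\<beta> x' h" if x': "x' \<in> carrier (Ext G M 0)" for x'
  proof -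
    obtain H where H: "Z H" "x' = cls G M 0 H" using x' by (auto simp: carrier_Ext)
    have "in_degree (Ext G M) 0 (x \<oplus>\<^bsub>Ext G M 0\<^esub> x')
        = in_degree (Ext G M) 0 x \<oplus>\<^bsub>coh G M\<^esub> in_degree (Ext G M) 0 x'"
      using F H by (simp add: Ext_add in_degree_cls coh_add cocycle_component comp_add)
    then show ?thesis using deg x x' h by (simp add: coh_act_add_left)
  qed
  show "?\<beta> (c \<odot>\<^bsub>Ext G M 0\<^esub> x) h = c \<odot>\<^bsub>coh G M\<^esub> ?\<beta> x h" for c
  proof -
    have "in_degree (Ext G M) 0 (c \<odot>\<^bsub>Ext G M 0\<^esub> x) = c \<odot>\<^bsub>coh G M\<^esub> in_degree (Ext G M) 0 x"
      using F by (simp add: Ext_smult in_degree_cls coh_smult cocycle_component comp_smult)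
    then show ?thesis using deg x h by (simp add: coh_act_smult)
  qed
  show "?\<beta> x (h \<oplus>\<^bsub>HK\<^esub> h') = ?\<beta> x h \<oplus>\<^bsub>coh G M\<^esub> ?\<beta> x h'" if "h' \<in> carrier HK" for h'
    using deg x h that by (simp add: coh_act_add_right)
  show "?\<beta> x (c \<odot>\<^bsub>HK\<^esub> h) = c \<odot>\<^bsub>coh G M\<^esub> ?\<beta> x h" for c
    using deg x h by (simp add: coh_act_smult)
next
  let ?b = "\<lambda>i. cls G M 0 (constant_cocycle (u i))"
  show b: "?b i \<in> carrier (Ext G M 0)" if "i \<in> I" for i
    using gen_cocycle that by (auto simp: carrier_Ext)
  fix x assume x: "x \<in> carrier (Ext G M 0)"
  interpret E: Module.module "ring_of_type_algebra :: 'k ring" "Ext G M 0" by (rule kspace_Ext)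
  obtain F where F: "Z F" "x = cls G M 0 F" using x by (auto simp: carrier_Ext)
  let ?c = "\<lambda>i. p i (F [\<one>\<^bsub>G\<^esub>])"
  have "x = cls G M 0 (\<lambda>xs. \<Sum>i\<in>I. ?c i \<odot>\<^bsub>M\<^esub> constant_cocycle (u i) xs)"
    unfolding F(2)
  proof (rule cls_cong)
    fix xs assume "xs \<in> tuples G 0"
    then obtain y where "xs = [y]" "y \<in> carrier G" by (auto simp: tuples_def length_Suc_conv)
    then show "F xs = (\<Sum>i\<in>I. ?c i \<odot>\<^bsub>M\<^esub> constant_cocycle (u i) xs)"
      using degree_zero_invariant(1)[OF F(1), of y] deg0_expansion[OF F(1)]
      by (simp add: constant_cocycle_def)
  qed
  also have "\<dots> = (\<Oplus>\<^bsub>Ext G M 0\<^esub>i\<in>I. cls G M 0 (\<lambda>xs. ?c i \<odot>\<^bsub>M\<^esub> constant_cocycle (u i) xs))"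
    using gen_cocycle by (intro Ext_finsum[symmetric] finite_I cocycle_smult) auto
  also have "\<dots> = (\<Oplus>\<^bsub>Ext G M 0\<^esub>i\<in>I. ?c i \<odot>\<^bsub>Ext G M 0\<^esub> ?b i)"
    using gen_cocycle b by (intro E.M.finsum_cong') (auto simp: Ext_smult)
  finally show "\<exists>c. x = (\<Oplus>\<^bsub>Ext G M 0\<^esub>i\<in>I. c i \<odot>\<^bsub>Ext G M 0\<^esub> ?b i)"
    by (intro exI[of _ ?c])
next
  have deg_b: "in_degree (Ext G M) 0 (cls G M 0 (constant_cocycle (u i))) = gen i" for i
    by (simp add: in_degree_cls component_constant_cocycle gen_def)
  fix w assume "w \<in> carrier (coh G M)"
  then obtain r where "\<And>i. i \<in> I \<Longrightarrow> r i \<in> carrier (coh G K)"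
    "w = (\<Oplus>\<^bsub>coh G M\<^esub>i\<in>I. coh_act G M (gen i) (r i))"
    by (rule coh_expansion_exists) blast
  then show "\<exists>r. r \<in> I \<rightarrow> carrier HK \<and> w = (\<Oplus>\<^bsub>coh G M\<^esub>i\<in>I.
      coh_act G M (in_degree (Ext G M) 0 (cls G M 0 (constant_cocycle (u i)))) (r i))"
    unfolding deg_b by (intro exI[of _ r]) auto
next
  interpret K: gmod G K by (rule gmod_K)
  interpret KV: Module.module "ring_of_type_algebra :: 'k ring" "coh G K" by (rule K.kspace_coh)
  interpret V: Module.module "ring_of_type_algebra :: 'k ring" "coh G M" by (rule kspace_coh)
  have deg_b: "in_degree (Ext G M) 0 (cls G M 0 (constant_cocycle (u i))) = gen i" for i
    by (simp add: in_degree_cls component_constant_cocycle gen_def)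
  fix r i assume r: "r \<in> I \<rightarrow> carrier HK" and i: "i \<in> I"
    and 0: "(\<Oplus>\<^bsub>coh G M\<^esub>i\<in>I.
      coh_act G M (in_degree (Ext G M) 0 (cls G M 0 (constant_cocycle (u i)))) (r i)) = \<zero>\<^bsub>coh G M\<^esub>"
  have act0: "coh_act G M (gen j) \<zero>\<^bsub>coh G K\<^esub> = \<zero>\<^bsub>coh G M\<^esub>" if "j \<in> I" for j
    using coh_act_smult(2)[OF gen_closed[OF that] KV.M.zero_closed, of 0]
      V.smult_l_null[OF coh_act_closed[OF gen_closed[OF that] KV.M.zero_closed]]
      KV.smult_l_null[OF KV.M.zero_closed] by simp
  have "(\<Oplus>\<^bsub>coh G M\<^esub>i\<in>I. coh_act G M (gen i) \<zero>\<^bsub>coh G K\<^esub>) = (\<Oplus>\<^bsub>coh G M\<^esub>i\<in>I. \<zero>\<^bsub>coh G M\<^esub>)"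
    by (rule V.M.finsum_cong') (auto simp: act0)
  then have "(\<Oplus>\<^bsub>coh G M\<^esub>i\<in>I. coh_act G M (gen i) (r i))
      = (\<Oplus>\<^bsub>coh G M\<^esub>i\<in>I. coh_act G M (gen i) \<zero>\<^bsub>coh G K\<^esub>)"
    using 0 unfolding deg_b by simp
  then show "r i = \<zero>\<^bsub>HK\<^esub>"
    using coh_expansion_unique[of r "\<lambda>_. \<zero>\<^bsub>coh G K\<^esub>" i] r i by auto
qed

theorem (in trace_free) action_isomorphism:
  obtains \<Phi> where
    "linear_iso (tensor_product (Ext G M 0) HK) (coh G M) \<Phi>"
    "\<And>x h. x \<in> carrier (Ext G M 0) \<Longrightarrow> h \<in> carrier HK \<Longrightarrow>
       \<Phi> (pure_tensor (Ext G M 0) HK x h) = coh_act G M (in_degree (Ext G M) 0 x) h"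
    "\<And>x h h'. x \<in> carrier (Ext G M 0) \<Longrightarrow> h \<in> carrier HK \<Longrightarrow> h' \<in> carrier HK \<Longrightarrow>
       \<Phi> (pure_tensor (Ext G M 0) HK x (h \<otimes>\<^bsub>HK\<^esub> h'))
         = coh_act G M (\<Phi> (pure_tensor (Ext G M 0) HK x h)) h'"
    "\<And>T t. gmod_map G M M T \<Longrightarrow> t \<in> carrier (tensor_product (Ext G M 0) HK) \<Longrightarrow>
       \<Phi> (tensor_map (Ext G M 0) HK (Ext_map G M T 0) id t) = coh_map G M T (\<Phi> t)"
proof -
  interpret K: gmod G K by (rule gmod_K)
  interpret tensor_presentation "Ext G M 0" HK "coh G M"
    "\<lambda>x h. coh_act G M (in_degree (Ext G M) 0 x) h" I "\<lambda>i. cls G M 0 (constant_cocycle (u i))"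
    by (rule tensor_presentation_coh)
  have deg: "in_degree (Ext G M) 0 x \<in> carrier (coh G M)" if "x \<in> carrier (Ext G M 0)" for x
    using that by (elim in_degree_zero_obtain) (auto simp: carrier_coh ZB_component)
  show thesis
  proof (rule that[of tensor_iso])
    show "linear_iso (tensor_product (Ext G M 0) HK) (coh G M) tensor_iso"
      by (rule linear_iso_tensor_iso)
    show pure: "tensor_iso (pure_tensor (Ext G M 0) HK x h) = coh_act G M (in_degree (Ext G M) 0 x) h"
      if "x \<in> carrier (Ext G M 0)" "h \<in> carrier HK" for x h
      using that by (rule tensor_iso_pure)
    show "tensor_iso (pure_tensor (Ext G M 0) HK x (h \<otimes>\<^bsub>HK\<^esub> h'))
         = coh_act G M (tensor_iso (pure_tensor (Ext G M 0) HK x h)) h'"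
      if "x \<in> carrier (Ext G M 0)" "h \<in> carrier HK" "h' \<in> carrier HK" for x h h'
      using that deg by (simp add: tensor_iso_pure K.coh_act_closed coh_act_assoc)
    fix T t assume T: "gmod_map G M M T"
      and t: "t \<in> carrier (tensor_product (Ext G M 0) HK)"
    note Tcls = Ext_map_cls[OF gmod_axioms T]
    show "tensor_iso (tensor_map (Ext G M 0) HK (Ext_map G M T 0) id t) = coh_map G M T (tensor_iso t)"
    proof (rule tensor_iso_equivariant[OF _ _ coh_map_linear[OF T] _ t])
      fix x assume "x \<in> carrier (Ext G M 0)"
      then obtain F where F: "Z F" "x = cls G M 0 F" by (auto simp: carrier_Ext)
      show "Ext_map G M T 0 x \<in> carrier (Ext G M 0)"
        using F by (auto simp: Tcls carrier_Ext cocycle_map[OF T])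
      fix h assume "h \<in> carrier HK"
      then obtain k where k: "h = CLS G K k" "cocycle G K k" by (auto simp: K.carrier_coh)
      have "(\<lambda>ys. T (component 0 F ys)) = component 0 (\<lambda>xs. T (F xs))"
        using gmod_map_diff(1)[OF T] by (auto simp: component_def)
      then show "coh_act G M (in_degree (Ext G M) 0 (Ext_map G M T 0 x)) (id h)
          = coh_map G M T (coh_act G M (in_degree (Ext G M) 0 x) h)"
        using F k by (simp add: Tcls in_degree_cls coh_act_CLS cocycle_component cocycle_map[OF T]
            coh_map_CLS[OF gmod_axioms T] cocycle_cup gmod_map_compose_cup[OF T])
    qed simp
  qed
qed

section \<open>Commuting pairs in the symmetric group on three letters\<close>

text \<open>
  One-line notation for the permutations of \<open>{1, 2, 3}\<close>, in which products and equations between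
  permutations are evaluated by rewriting.
\<close>
definition perm3 :: "nat \<Rightarrow> nat \<Rightarrow> nat \<Rightarrow> nat \<Rightarrow> nat" where
  "perm3 a b c n = (if n = 1 then a else if n = 2 then b else if n = 3 then c else n)"

lemma perm3_apply [simp]:
  "perm3 a b c (Suc 0) = a" "perm3 a b c 2 = b" "perm3 a b c 3 = c"
  by (simp_all add: perm3_def)

lemma perm3_comp [simp]:
  "perm3 a b c \<circ> perm3 d e f = perm3 (perm3 a b c d) (perm3 a b c e) (perm3 a b c f)"
  by (rule HOL.ext)
    (simp add: perm3_def[of d e f] perm3_def[of "perm3 a b c d"], simp add: perm3_def)

lemma perm3_eq_iff [simp]: "perm3 a b c = perm3 d e f \<longleftrightarrow> a = d \<and> b = e \<and> c = f"
  by (metis perm3_apply)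

lemma perm3_id: "perm3 (Suc 0) 2 3 = id"
  by (auto simp: perm3_def fun_eq_iff)

definition \<epsilon> :: "nat \<Rightarrow> nat" where "\<epsilon> = perm3 1 2 3"
definition rot :: "nat \<Rightarrow> nat" where "rot = perm3 2 3 1"
definition rot' :: "nat \<Rightarrow> nat" where "rot' = perm3 3 1 2"
definition \<tau>1 :: "nat \<Rightarrow> nat" where "\<tau>1 = perm3 1 3 2"
definition \<tau>2 :: "nat \<Rightarrow> nat" where "\<tau>2 = perm3 3 2 1"
definition \<tau>3 :: "nat \<Rightarrow> nat" where "\<tau>3 = perm3 2 1 3"

lemmas S3_defs = \<epsilon>_def rot_def rot'_def \<tau>1_def \<tau>2_def \<tau>3_def

lemma S3_neq [simp]:
  "\<epsilon> \<noteq> rot" "\<epsilon> \<noteq> rot'" "\<epsilon> \<noteq> \<tau>1" "\<epsilon> \<noteq> \<tau>2" "\<epsilon> \<noteq> \<tau>3"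
  "rot \<noteq> \<epsilon>" "rot \<noteq> rot'" "rot \<noteq> \<tau>1" "rot \<noteq> \<tau>2" "rot \<noteq> \<tau>3"
  "rot' \<noteq> \<epsilon>" "rot' \<noteq> rot" "rot' \<noteq> \<tau>1" "rot' \<noteq> \<tau>2" "rot' \<noteq> \<tau>3"
  "\<tau>1 \<noteq> \<epsilon>" "\<tau>1 \<noteq> rot" "\<tau>1 \<noteq> rot'" "\<tau>1 \<noteq> \<tau>2" "\<tau>1 \<noteq> \<tau>3"
  "\<tau>2 \<noteq> \<epsilon>" "\<tau>2 \<noteq> rot" "\<tau>2 \<noteq> rot'" "\<tau>2 \<noteq> \<tau>1" "\<tau>2 \<noteq> \<tau>3"
  "\<tau>3 \<noteq> \<epsilon>" "\<tau>3 \<noteq> rot" "\<tau>3 \<noteq> rot'" "\<tau>3 \<noteq> \<tau>1" "\<tau>3 \<noteq> \<tau>2"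
  by (simp_all add: S3_defs)

lemma group_S3: "group S3"
  by (rule sym_group_is_group)

lemma carrier_S3: "carrier S3 = {\<epsilon>, rot, rot', \<tau>1, \<tau>2, \<tau>3}"
proof -
  have "p \<in> {\<epsilon>, rot, rot', \<tau>1, \<tau>2, \<tau>3}" if p: "p permutes {1..3}" for p
  proof -
    have "p 1 \<in> {1..3}" "p 2 \<in> {1..3}" "p 3 \<in> {1..3}"
      using permutes_in_image[OF p] by auto
    then have v: "p 1 \<in> {1, 2, 3}" "p 2 \<in> {1, 2, 3}" "p 3 \<in> {1, 2, 3}" by auto
    have d: "p 1 \<noteq> p 2" "p 1 \<noteq> p 3" "p 2 \<noteq> p 3"
      using permutes_inj[OF p] by (simp_all add: inj_eq[OF permutes_inj[OF p]])
    have "p = perm3 (p 1) (p 2) (p 3)"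
      using permutes_not_in[OF p] by (auto simp: perm3_def fun_eq_iff)
    moreover have "perm3 a b c \<in> {\<epsilon>, rot, rot', \<tau>1, \<tau>2, \<tau>3}"
      if "a \<in> {1, 2, 3}" "b \<in> {1, 2, 3}" "c \<in> {1, 2, 3}" "a \<noteq> b" "a \<noteq> c" "b \<noteq> c" for a b c
      using that unfolding insert_iff empty_iff
      by (elim disjE FalseE; hypsubst) (simp_all add: S3_defs)
    from this[OF v d] have "perm3 (p 1) (p 2) (p 3) \<in> {\<epsilon>, rot, rot', \<tau>1, \<tau>2, \<tau>3}" .
    ultimately show ?thesis by simp
  qed
  then have sub: "carrier S3 \<subseteq> {\<epsilon>, rot, rot', \<tau>1, \<tau>2, \<tau>3}"
    by (intro subsetI) (simp only: sym_group_carrier)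
  have "card (carrier S3) = 6"
    using card_permutations[of "{1..3 :: nat}" 3] by (simp add: sym_group_def fact_numeral)
  moreover have "card {\<epsilon>, rot, rot', \<tau>1, \<tau>2, \<tau>3} = 6"
    by simp
  ultimately show ?thesis using sub by (intro card_subset_eq) auto
qed

lemma S3_one: "\<one>\<^bsub>S3\<^esub> = \<epsilon>"
  by (simp add: sym_group_one \<epsilon>_def perm3_id)

lemma S3_mult [simp]:
  "\<epsilon> \<otimes>\<^bsub>S3\<^esub> \<epsilon> = \<epsilon>" "\<epsilon> \<otimes>\<^bsub>S3\<^esub> rot = rot" "\<epsilon> \<otimes>\<^bsub>S3\<^esub> rot' = rot'"
  "\<epsilon> \<otimes>\<^bsub>S3\<^esub> \<tau>1 = \<tau>1" "\<epsilon> \<otimes>\<^bsub>S3\<^esub> \<tau>2 = \<tau>2" "\<epsilon> \<otimes>\<^bsub>S3\<^esub> \<tau>3 = \<tau>3"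
  "rot \<otimes>\<^bsub>S3\<^esub> \<epsilon> = rot" "rot \<otimes>\<^bsub>S3\<^esub> rot = rot'" "rot \<otimes>\<^bsub>S3\<^esub> rot' = \<epsilon>"
  "rot \<otimes>\<^bsub>S3\<^esub> \<tau>1 = \<tau>3" "rot \<otimes>\<^bsub>S3\<^esub> \<tau>2 = \<tau>1" "rot \<otimes>\<^bsub>S3\<^esub> \<tau>3 = \<tau>2"
  "rot' \<otimes>\<^bsub>S3\<^esub> \<epsilon> = rot'" "rot' \<otimes>\<^bsub>S3\<^esub> rot = \<epsilon>" "rot' \<otimes>\<^bsub>S3\<^esub> rot' = rot"
  "rot' \<otimes>\<^bsub>S3\<^esub> \<tau>1 = \<tau>2" "rot' \<otimes>\<^bsub>S3\<^esub> \<tau>2 = \<tau>3" "rot' \<otimes>\<^bsub>S3\<^esub> \<tau>3 = \<tau>1"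
  "\<tau>1 \<otimes>\<^bsub>S3\<^esub> \<epsilon> = \<tau>1" "\<tau>1 \<otimes>\<^bsub>S3\<^esub> rot = \<tau>2" "\<tau>1 \<otimes>\<^bsub>S3\<^esub> rot' = \<tau>3"
  "\<tau>1 \<otimes>\<^bsub>S3\<^esub> \<tau>1 = \<epsilon>" "\<tau>1 \<otimes>\<^bsub>S3\<^esub> \<tau>2 = rot" "\<tau>1 \<otimes>\<^bsub>S3\<^esub> \<tau>3 = rot'"
  "\<tau>2 \<otimes>\<^bsub>S3\<^esub> \<epsilon> = \<tau>2" "\<tau>2 \<otimes>\<^bsub>S3\<^esub> rot = \<tau>3" "\<tau>2 \<otimes>\<^bsub>S3\<^esub> rot' = \<tau>1"
  "\<tau>2 \<otimes>\<^bsub>S3\<^esub> \<tau>1 = rot'" "\<tau>2 \<otimes>\<^bsub>S3\<^esub> \<tau>2 = \<epsilon>" "\<tau>2 \<otimes>\<^bsub>S3\<^esub> \<tau>3 = rot"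
  "\<tau>3 \<otimes>\<^bsub>S3\<^esub> \<epsilon> = \<tau>3" "\<tau>3 \<otimes>\<^bsub>S3\<^esub> rot = \<tau>1" "\<tau>3 \<otimes>\<^bsub>S3\<^esub> rot' = \<tau>2"
  "\<tau>3 \<otimes>\<^bsub>S3\<^esub> \<tau>1 = rot" "\<tau>3 \<otimes>\<^bsub>S3\<^esub> \<tau>2 = rot'" "\<tau>3 \<otimes>\<^bsub>S3\<^esub> \<tau>3 = \<epsilon>"
  by (simp_all add: sym_group_mult S3_defs)

lemma S3_inv [simp]:
  "inv\<^bsub>S3\<^esub> \<epsilon> = \<epsilon>" "inv\<^bsub>S3\<^esub> rot = rot'" "inv\<^bsub>S3\<^esub> rot' = rot"
  "inv\<^bsub>S3\<^esub> \<tau>1 = \<tau>1" "inv\<^bsub>S3\<^esub> \<tau>2 = \<tau>2" "inv\<^bsub>S3\<^esub> \<tau>3 = \<tau>3"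
  by (rule group.inv_equality[OF group_S3]; simp add: carrier_S3 S3_one)+

lemma carrier_A3: "carrier (alt_group 3) = {\<epsilon>, rot, rot'}"
proof -
  have \<tau>: "\<tau>1 = Transposition.transpose 2 3" "\<tau>2 = Transposition.transpose 1 3" "\<tau>3 = Transposition.transpose 1 2"
    by (auto simp: S3_defs perm3_def Transposition.transpose_def fun_eq_iff)
  have rot: "rot = Transposition.transpose 1 2 \<circ> Transposition.transpose 2 3" "rot' = Transposition.transpose 2 3 \<circ> Transposition.transpose 1 2"
    by (auto simp: S3_defs perm3_def Transposition.transpose_def fun_eq_iff)
  have "evenperm \<epsilon>" by (simp add: S3_one[symmetric] sym_group_one)
  moreover have "evenperm rot" "evenperm rot'"
    unfolding rot by (simp_all add: evenperm_comp permutation_swap_id evenperm_swap)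
  moreover have "\<not> evenperm \<tau>1" "\<not> evenperm \<tau>2" "\<not> evenperm \<tau>3"
    unfolding \<tau> by (simp_all add: evenperm_swap)
  ultimately have "p \<in> carrier S3 \<and> evenperm p \<longleftrightarrow> p \<in> {\<epsilon>, rot, rot'}" for p
    by (auto simp: carrier_S3)
  then show ?thesis
    unfolding sym_group_carrier by (intro Set.set_eqI) (simp only: alt_group_carrier)
qed

subsection \<open>The three parts of the set of commuting pairs\<close>

lemma generate_S3_eqI:
  assumes "subgroup H S3" "a \<in> H" "b \<in> H" "H \<subseteq> generate S3 {a, b}"
  shows "generate S3 {a, b} = H"
  using group.generate_subgroup_incl[OF group_S3, of "{a, b}" H] assms by auto

lemma subgroup_S3: "subgroup {\<epsilon>} S3" "subgroup {\<epsilon>, \<tau>1} S3" "subgroup {\<epsilon>, \<tau>2} S3"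
  "subgroup {\<epsilon>, \<tau>3} S3" "subgroup {\<epsilon>, rot, rot'} S3"
  by (rule group.subgroupI[OF group_S3]; auto simp: carrier_S3)+

lemma generate_transposition:
  assumes "subgroup {\<epsilon>, x} S3" "a \<in> {\<epsilon>, x}" "b \<in> {\<epsilon>, x}" "(a, b) \<noteq> (\<epsilon>, \<epsilon>)"
  shows "generate S3 {a, b} = {\<epsilon>, x}"
proof (rule generate_S3_eqI[OF assms(1-3)])
  have "\<epsilon> \<in> generate S3 {a, b}" using generate.one[of S3] by (simp add: S3_one)
  moreover have "x \<in> generate S3 {a, b}" using assms by (auto intro: generate.incl)
  ultimately show "{\<epsilon>, x} \<subseteq> generate S3 {a, b}" by simp
qed

lemma generate_rotation:
  assumes "a \<in> {\<epsilon>, rot, rot'}" "b \<in> {\<epsilon>, rot, rot'}" "(a, b) \<noteq> (\<epsilon>, \<epsilon>)"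
  shows "generate S3 {a, b} = {\<epsilon>, rot, rot'}"
proof (rule generate_S3_eqI[OF subgroup_S3(5) assms(1,2)])
  have e: "\<epsilon> \<in> generate S3 {a, b}" using generate.one[of S3] by (simp add: S3_one)
  have "rot \<in> generate S3 {a, b} \<or> rot' \<in> generate S3 {a, b}"
    using assms by (auto intro: generate.incl)
  then have "rot \<in> generate S3 {a, b}" "rot' \<in> generate S3 {a, b}"
    using generate.eng[of rot S3 "{a, b}" rot] generate.eng[of rot' S3 "{a, b}" rot'] by auto
  with e show "{\<epsilon>, rot, rot'} \<subseteq> generate S3 {a, b}" by simp
qed

lemma Omega1_eq: "Omega1 = {(\<epsilon>, \<epsilon>)} \<union> (\<Union>x\<in>{\<tau>1, \<tau>2, \<tau>3}. {(x, \<epsilon>), (\<epsilon>, x), (x, x)})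
    \<union> ({\<epsilon>, rot, rot'} \<times> {\<epsilon>, rot, rot'} - {(\<epsilon>, \<epsilon>)})"
proof (rule Set.set_eqI)
  fix w :: perm_pair
  obtain a b where w: "w = (a, b)" by (cases w)
  show "w \<in> Omega1 \<longleftrightarrow> w \<in> {(\<epsilon>, \<epsilon>)} \<union> (\<Union>x\<in>{\<tau>1, \<tau>2, \<tau>3}. {(x, \<epsilon>), (\<epsilon>, x), (x, x)})
    \<union> ({\<epsilon>, rot, rot'} \<times> {\<epsilon>, rot, rot'} - {(\<epsilon>, \<epsilon>)})"
  proof (cases "a \<in> carrier S3 \<and> b \<in> carrier S3")
    case True
    then show ?thesis
      unfolding w carrier_S3 insert_iff empty_iff
      by (elim conjE disjE FalseE; hypsubst) (simp_all add: Omega1_def carrier_S3)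
  next
    case False
    then show ?thesis by (auto simp: w Omega1_def carrier_S3)
  qed
qed

lemma generate_pair:
  "generate S3 {\<epsilon>} = {\<epsilon>}"
  "x \<in> {\<tau>1, \<tau>2, \<tau>3} \<Longrightarrow> (a, b) \<in> {(x, \<epsilon>), (\<epsilon>, x), (x, x)} \<Longrightarrow> generate S3 {a, b} = {\<epsilon>, x}"
  "(a, b) \<in> {\<epsilon>, rot, rot'} \<times> {\<epsilon>, rot, rot'} - {(\<epsilon>, \<epsilon>)} \<Longrightarrow> generate S3 {a, b} = {\<epsilon>, rot, rot'}"
proof -
  have "generate S3 {\<epsilon>, \<epsilon>} = {\<epsilon>}"
    using generate.one[of S3] by (intro generate_S3_eqI subgroup_S3) (auto simp: S3_one)
  then show "generate S3 {\<epsilon>} = {\<epsilon>}" by simp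
  show "generate S3 {a, b} = {\<epsilon>, x}"
    if "x \<in> {\<tau>1, \<tau>2, \<tau>3}" "(a, b) \<in> {(x, \<epsilon>), (\<epsilon>, x), (x, x)}"
  proof (rule generate_transposition)
    show "subgroup {\<epsilon>, x} S3" using that(1) subgroup_S3 by auto
    have "x \<noteq> \<epsilon>" using that(1) by auto
    then show "a \<in> {\<epsilon>, x}" "b \<in> {\<epsilon>, x}" "(a, b) \<noteq> (\<epsilon>, \<epsilon>)" using that(2) by auto
  qed
  show "generate S3 {a, b} = {\<epsilon>, rot, rot'}"
    if "(a, b) \<in> {\<epsilon>, rot, rot'} \<times> {\<epsilon>, rot, rot'} - {(\<epsilon>, \<epsilon>)}"
    using that by (intro generate_rotation) auto
qed

lemma O1_eq: "O1 = {(\<epsilon>, \<epsilon>)}"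
  and O2_eq: "O2 = (\<Union>x\<in>{\<tau>1, \<tau>2, \<tau>3}. {(x, \<epsilon>), (\<epsilon>, x), (x, x)})"
  and O3_eq: "O3 = {\<epsilon>, rot, rot'} \<times> {\<epsilon>, rot, rot'} - {(\<epsilon>, \<epsilon>)}"
proof -
  let ?gen = "\<lambda>w. generate S3 {fst w, snd w}"
  let ?O2 = "\<Union>x\<in>{\<tau>1, \<tau>2, \<tau>3}. {(x, \<epsilon>), (\<epsilon>, x), (x, x)}"
  let ?O3 = "{\<epsilon>, rot, rot'} \<times> {\<epsilon>, rot, rot'} - {(\<epsilon>, \<epsilon>)}"
  have select: "\<Omega> = A \<union> B \<union> C \<Longrightarrow> (\<And>w. w \<in> A \<Longrightarrow> Q w) \<Longrightarrow> (\<And>w. w \<in> B \<Longrightarrow> \<not> Q w) \<Longrightarrow>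
      (\<And>w. w \<in> C \<Longrightarrow> \<not> Q w) \<Longrightarrow> {w \<in> \<Omega>. Q w} = A" for \<Omega> A B C :: "perm_pair set" and Q
    by blast
  have card: "card {\<epsilon>, rot, rot'} = 3" by simp
  have 1: "?gen w = {\<epsilon>}" if "w \<in> {(\<epsilon>, \<epsilon>)}" for w
    using that by (simp add: generate_pair(1))
  have 2: "card (?gen w) = 2" if w: "w \<in> ?O2" for w
  proof -
    obtain x where x: "x \<in> {\<tau>1, \<tau>2, \<tau>3}" "(fst w, snd w) \<in> {(x, \<epsilon>), (\<epsilon>, x), (x, x)}"
      using w by auto
    then have "x \<noteq> \<epsilon>" by auto
    then show ?thesis using generate_pair(2)[OF x] by simp
  qed
  have 3: "?gen w = {\<epsilon>, rot, rot'}" if "w \<in> ?O3" for w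
    using generate_pair(3)[of "fst w" "snd w"] that by simp
  have "O1 = {w \<in> Omega1. ?gen w = {\<epsilon>}}"
    unfolding O1_def S3_one by (rule Collect_cong) (simp split: prod.split)
  also have "\<dots> = {(\<epsilon>, \<epsilon>)}"
  proof (rule select[OF Omega1_eq])
    show "?gen w \<noteq> {\<epsilon>}" if "w \<in> ?O2" for w using 2[OF that] by auto
    show "?gen w \<noteq> {\<epsilon>}" if "w \<in> ?O3" for w using 3[OF that] by (simp add: set_eq_iff[of "{\<epsilon>, rot, rot'}"] exI[of _ rot])
  qed (rule 1)
  finally show "O1 = {(\<epsilon>, \<epsilon>)}" .
  have "O2 = {w \<in> Omega1. card (?gen w) = 2}"
    unfolding O2_def by (rule Collect_cong) (simp split: prod.split)
  also have "\<dots> = ?O2"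
  proof (rule select)
    show "Omega1 = ?O2 \<union> {(\<epsilon>, \<epsilon>)} \<union> ?O3" unfolding Omega1_eq by (simp only: Un_ac)
    show "card (?gen w) \<noteq> 2" if "w \<in> {(\<epsilon>, \<epsilon>)}" for w using 1[OF that] by simp
    show "card (?gen w) \<noteq> 2" if "w \<in> ?O3" for w using 3[OF that] card by simp
  qed (rule 2)
  finally show "O2 = ?O2" .
  have "O3 = {w \<in> Omega1. ?gen w = {\<epsilon>, rot, rot'}}"
    unfolding O3_def carrier_A3 by (rule Collect_cong) (simp split: prod.split)
  also have "\<dots> = ?O3"
  proof (rule select)
    show "Omega1 = ?O3 \<union> {(\<epsilon>, \<epsilon>)} \<union> ?O2" unfolding Omega1_eq by (simp only: Un_ac)
    show "?gen w \<noteq> {\<epsilon>, rot, rot'}" if "w \<in> {(\<epsilon>, \<epsilon>)}" for w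
      using 1[OF that] card by fastforce
    show "?gen w \<noteq> {\<epsilon>, rot, rot'}" if "w \<in> ?O2" for w
      using 2[OF that] card by fastforce
  qed (rule 3)
  finally show "O3 = ?O3" .
qed

section \<open>Modules with cohomology in degree zero only\<close>

text \<open>
  A cocycle has a constant value in degree \<open>0\<close>, as its coboundary at a pair is the difference of the
  two values.
\<close>
lemma (in gmod) coh_aug_CLS:
  assumes "cocycle G K k"
  shows "coh_aug G (CLS G K k) = k [\<one>\<^bsub>G\<^esub>]"
proof -
  interpret K: gmod G K by (rule gmod_K)
  have zero: "xs \<in> tuples G 0 \<Longrightarrow> \<exists>y\<in>carrier G. xs = [y]" for xs
    by (auto simp: tuples_def length_Suc_conv)
  have smult: "c \<odot>\<^bsub>Ext G K 0\<^esub> Ext_one G = cls G K 0 (\<lambda>xs. c * cup_unit xs)" for c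
    using K.Ext_smult[OF cocycle_cup_unit(1), of 0 c] by (simp add: Ext_one_eq)
  have Z: "cocycle G K (\<lambda>xs. c * cup_unit xs)" for c
    using K.cocycle_smult[OF cocycle_cup_unit(1), of c] by simp
  have "cls G K 0 k = cls G K 0 (\<lambda>xs. c * cup_unit xs) \<longleftrightarrow> c = k [\<one>\<^bsub>G\<^esub>]" for c
  proof
    assume "cls G K 0 k = cls G K 0 (\<lambda>xs. c * cup_unit xs)"
    then obtain E where "cochain G K E" "\<forall>xs\<in>tuples G 0. k xs = c * cup_unit xs + cobd E xs"
      unfolding K.cls_eq_iff[OF assms Z] by blast
    moreover have "[\<one>\<^bsub>G\<^esub>] \<in> tuples G 0" by (simp add: tuples_def)
    ultimately have "k [\<one>\<^bsub>G\<^esub>] = c * cup_unit [\<one>\<^bsub>G\<^esub>] + cobd E [\<one>\<^bsub>G\<^esub>]" "E [] = 0"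
      by (auto simp: cochain_def)
    then show "c = k [\<one>\<^bsub>G\<^esub>]" by (simp add: cup_unit_def)
  next
    assume c: "c = k [\<one>\<^bsub>G\<^esub>]"
    show "cls G K 0 k = cls G K 0 (\<lambda>xs. c * cup_unit xs)"
    proof (rule K.cls_cong)
      fix xs assume "xs \<in> tuples G 0"
      then obtain y where "xs = [y]" "y \<in> carrier G" using zero by blast
      then show "k xs = c * cup_unit xs"
        using K.degree_zero_invariant(1)[OF assms, of y] c by (simp add: cup_unit_def)
    qed
  qed
  then show ?thesis
    unfolding coh_aug_def smult by (simp add: CLS_def)
qed

context trace_split
begin

lemma CLS_eq_component_zero:
  assumes I: "I = {}" and F: "ZB F"
  shows "CLS G M F = CLS G M (component 0 F)"
proof -
  interpret V: Module.module "ring_of_type_algebra :: 'k ring" "coh G M" by (rule kspace_coh)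
  let ?F' = "\<lambda>xs. F xs - component 0 F xs"
  have Z: "Z ?F'" "Z (component 0 F)"
    using F cocycle_component cocycle_diff by auto
  have "CLS G M ?F' = \<zero>\<^bsub>coh G M\<^esub>"
    using CLS_expansion[OF Z(1)] by (simp add: I component_def coh_zero)
  moreover have "CLS G M F = CLS G M (component 0 F) \<oplus>\<^bsub>coh G M\<^esub> CLS G M ?F'"
    using Z by (simp add: coh_add)
  ultimately show ?thesis
    using F ZB_component[of F 0] by (simp add: carrier_coh)
qed

theorem coh_concentrated_in_degree0:
  assumes "I = {}"
  shows "carrier (coh G M) = coh_degree0 G M"
  using CLS_eq_component_zero[OF assms] ZB_component
  by (auto simp: carrier_coh coh_degree0_eq image_iff)

theorem trivial_coh_module:
  assumes I: "I = {}"
  shows "trivial_coh_module G M"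
  unfolding trivial_coh_module_def
proof (intro ballI)
  interpret K: gmod G K by (rule gmod_K)
  fix x h assume "x \<in> carrier (coh G M)" "h \<in> carrier HK"
  then obtain F k where F: "x = CLS G M F" "ZB F" and k: "h = CLS G K k" "cocycle G K k \<and> bounded_degree k"
    by (auto simp: carrier_coh K.carrier_coh)
  let ?c = "k [\<one>\<^bsub>G\<^esub>]"
  have "coh_act G M x h = CLS G M (cupM F k)" using F k by (simp add: coh_act_CLS)
  also have "\<dots> = CLS G M (component 0 (cupM F k))"
    using F k by (intro CLS_eq_component_zero[OF I] ZB_cup) auto
  also have "\<dots> = CLS G M (component 0 (\<lambda>xs. ?c \<odot>\<^bsub>M\<^esub> F xs))"
  proof (rule CLS_cong)
    fix xs assume "xs \<noteq> []" "set xs \<subseteq> carrier G"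
    then show "component 0 (cupM F k) xs = component 0 (\<lambda>xs. ?c \<odot>\<^bsub>M\<^esub> F xs) xs"
      using K.degree_zero_invariant(1)[of k "hd xs"] k
      by (cases xs) (auto simp: component_def)
  qed
  also have "\<dots> = CLS G M (\<lambda>xs. ?c \<odot>\<^bsub>M\<^esub> F xs)"
    using F by (intro CLS_eq_component_zero[OF I, symmetric] ZB_smult)
  also have "\<dots> = coh_aug G h \<odot>\<^bsub>coh G M\<^esub> x"
    using F k by (simp add: coh_aug_CLS coh_smult)
  finally show "coh_act G M x h = coh_aug G h \<odot>\<^bsub>coh G M\<^esub> x" .
qed

end

section \<open>The modules of commuting pairs\<close>

lemma pm_char2:
  assumes "CHAR('k::field) = 2"
  shows "(p :: 'x \<Rightarrow>\<^sub>0 'k) + p = 0" "- p = p"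
proof -
  have "(1 :: 'k) + 1 = 0"
    using of_nat_CHAR[where 'a = 'k] assms by simp
  then have "c + c = 0" for c :: 'k
    by (metis distrib_left mult.right_neutral mult_zero_right)
  then show 1: "p + p = 0"
    by (intro poly_mapping_eqI) (simp add: lookup_add)
  then show "- p = p" by (simp add: neg_eq_iff_add_eq_0)
qed

lemma three_eq_one:
  assumes "CHAR('k::field) = 2"
  shows "(3 :: 'k) = 1"
proof -
  have "(2 :: 'k) = 0" using of_nat_CHAR[where 'a = 'k] assms by simp
  moreover have "(3 :: 'k) = 2 + 1" by simp
  ultimately show ?thesis by simp
qed

definition conj_stable :: "perm_pair set \<Rightarrow> bool" where
  "conj_stable B \<longleftrightarrow> B \<subseteq> Omega1 \<and> (\<forall>g\<in>carrier S3. \<forall>w\<in>B. conj_pair g w \<in> B)"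

lemma M1_simps [simp]:
  "carrier (M1 B) = {p. keys p \<subseteq> B}"
  "x \<oplus>\<^bsub>M1 B\<^esub> y = x + y" "\<zero>\<^bsub>M1 B\<^esub> = 0" "module.smult (M1 B) = pm_scale"
  "gact (M1 B) g = pm_push (conj_pair g)"
  by (simp_all add: M1_def)

lemma conj_pair_mult:
  assumes "g \<in> carrier S3" "h \<in> carrier S3" "w \<in> Omega1"
  shows "conj_pair (g \<otimes>\<^bsub>S3\<^esub> h) w = conj_pair g (conj_pair h w)"
proof -
  interpret group S3 by (rule group_S3)
  show ?thesis
    using assms by (auto simp: conj_pair_def Omega1_def m_assoc inv_mult_group simp del: sym_group_inv_equality)
qed

lemma conj_pair_one: "w \<in> Omega1 \<Longrightarrow> conj_pair \<one>\<^bsub>S3\<^esub> w = w"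
  using group.is_monoid[OF group_S3]
  by (auto simp: conj_pair_def Omega1_def monoid.inv_one[OF group.is_monoid[OF group_S3]] simp del: sym_group_inv_equality)

lemma gmod_M1:
  assumes "conj_stable B"
  shows "gmod S3 (M1 B :: ('k::field, perm_pair \<Rightarrow>\<^sub>0 'k, nat \<Rightarrow> nat) gmodule)"
  unfolding M1_def using assms
  by (intro gmod_permutation group_S3 conj_pair_mult conj_pair_one) (auto simp: conj_stable_def)

lemma conj_pair_simp:
  "conj_pair g (a, b) = (g \<otimes>\<^bsub>S3\<^esub> a \<otimes>\<^bsub>S3\<^esub> inv\<^bsub>S3\<^esub> g, g \<otimes>\<^bsub>S3\<^esub> b \<otimes>\<^bsub>S3\<^esub> inv\<^bsub>S3\<^esub> g)"
  by (simp add: conj_pair_def)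

declare sym_group_inv_equality [simp del]

text \<open>
  The orbits on the pairs that generate a subgroup of order two are indexed by \<open>0\<close>, \<open>1\<close> and \<open>2\<close>. Index
  \<open>3\<close> is used for the orbit of the trivial pair.
\<close>
definition pair_orbit :: "nat \<Rightarrow> perm_pair set" where
  "pair_orbit i = (if i = 0 then {(\<tau>1, \<epsilon>), (\<tau>2, \<epsilon>), (\<tau>3, \<epsilon>)}
     else if i = 1 then {(\<epsilon>, \<tau>1), (\<epsilon>, \<tau>2), (\<epsilon>, \<tau>3)}
     else if i = 2 then {(\<tau>1, \<tau>1), (\<tau>2, \<tau>2), (\<tau>3, \<tau>3)}
     else {(\<epsilon>, \<epsilon>)})"

lemma lessThan_unfold: "{..<3 :: nat} = {0, 1, 2}" "{..<4 :: nat} = {0, 1, 2, 3}"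
  by auto

lemma O2_orbits: "O2 = (\<Union>i\<in>{..<3}. pair_orbit i)"
  by (auto simp: O2_eq lessThan_unfold pair_orbit_def)

lemma O1_orbit: "O1 = pair_orbit 3"
  by (simp add: O1_eq pair_orbit_def)

lemma Omega1_parts: "Omega1 = O1 \<union> O2 \<union> O3"
  by (simp only: Omega1_eq O1_eq O2_eq O3_eq)

lemma orbit_conj_iff:
  assumes "g \<in> carrier S3" "w \<in> Omega1"
  shows "conj_pair g w \<in> pair_orbit i \<longleftrightarrow> w \<in> pair_orbit i"
proof -
  interpret group S3 by (rule group_S3)
  have stable: "conj_pair g w \<in> pair_orbit i" if "g \<in> carrier S3" "w \<in> pair_orbit i" for g w
    using that unfolding carrier_S3 pair_orbit_def
    by (auto simp: conj_pair_simp split: if_splits)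
  have "w = conj_pair (inv\<^bsub>S3\<^esub> g) (conj_pair g w)"
    using assms conj_pair_mult[of "inv\<^bsub>S3\<^esub> g" g w] by (simp add: conj_pair_one)
  then show ?thesis
    using stable[of g w] stable[of "inv\<^bsub>S3\<^esub> g" "conj_pair g w"] assms by auto
qed

lemma orbit_transitive:
  assumes "x \<in> pair_orbit i" "y \<in> pair_orbit i"
  shows "\<exists>g\<in>carrier S3. conj_pair g x = y"
  using assms unfolding pair_orbit_def carrier_S3
  by (auto simp: conj_pair_simp split: if_splits)

lemma pair_orbit_facts:
  "finite (pair_orbit i)" "pair_orbit i \<subseteq> Omega1"
  "CHAR('k::field) = 2 \<Longrightarrow> (of_nat (card (pair_orbit i)) :: 'k) = 1"
proof -
  show "finite (pair_orbit i)" by (simp add: pair_orbit_def)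
  show "pair_orbit i \<subseteq> Omega1" by (auto simp: pair_orbit_def Omega1_def carrier_S3)
  assume "CHAR('k) = 2"
  then have "(3 :: 'k) = 1" by (rule three_eq_one)
  moreover have "card (pair_orbit i) = 3 \<or> card (pair_orbit i) = 1" by (simp add: pair_orbit_def)
  ultimately show "(of_nat (card (pair_orbit i)) :: 'k) = 1" by auto
qed

lemma conj_stable_parts: "conj_stable Omega1" "conj_stable O1" "conj_stable O2" "conj_stable O3"
proof -
  have "conj_pair g w \<in> Omega1" if "g \<in> carrier S3" "w \<in> Omega1" for g w
    using that unfolding carrier_S3 Omega1_eq by (auto simp: conj_pair_simp)
  then show "conj_stable Omega1" by (simp add: conj_stable_def)
  show "conj_stable O1"
    using pair_orbit_facts(2)[of 3] orbit_conj_iff[of _ _ 3] unfolding O1_orbit conj_stable_def by blast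
  show "conj_stable O2"
    using pair_orbit_facts(2) orbit_conj_iff unfolding O2_orbits conj_stable_def by blast
  have "conj_pair g w \<in> O3" if "g \<in> carrier S3" "w \<in> O3" for g w
    using that unfolding carrier_S3 O3_eq by (auto simp: conj_pair_simp)
  then show "conj_stable O3" by (auto simp: conj_stable_def O3_def)
qed

definition orbit_sum :: "'x set \<Rightarrow> ('x \<Rightarrow>\<^sub>0 'k::field)" where
  "orbit_sum A = (\<Sum>x\<in>A. single x 1)"

definition orbit_coeff :: "'x set \<Rightarrow> ('x \<Rightarrow>\<^sub>0 'k::field) \<Rightarrow> 'k" where
  "orbit_coeff A = lin (*) (\<lambda>x. if x \<in> A then 1 else 0)"

text \<open>
  On the transpositions the group acts doubly transitively, so that the trace of the matrix unit
  with entry at two distinct transpositions is the matrix of all off-diagonal entries, which is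
  the identity minus the all-one matrix in characteristic \<open>2\<close>. On the generating pairs of the
  alternating group every stabilizer has the odd order \<open>3\<close>, and the trace of the projection onto
  orbit representatives is the identity.
\<close>
definition trace_kernel :: "perm_pair \<Rightarrow> (perm_pair \<Rightarrow>\<^sub>0 'k::field)" where
  "trace_kernel w =
     (if w = (\<tau>2, \<epsilon>) then single (\<tau>1, \<epsilon>) 1
      else if w = (\<epsilon>, \<tau>2) then single (\<epsilon>, \<tau>1) 1
      else if w = (\<tau>2, \<tau>2) then single (\<tau>1, \<tau>1) 1
      else if w \<in> {(rot, \<epsilon>), (\<epsilon>, rot), (rot, rot), (rot, rot')} then single w 1
      else 0)"

definition trace_map :: "(perm_pair \<Rightarrow>\<^sub>0 'k::field) \<Rightarrow> (perm_pair \<Rightarrow>\<^sub>0 'k)" where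
  "trace_map = lin pm_scale trace_kernel"

text \<open>
  Both sides are computed at each of the 18 commuting pairs. For a transposition, the two group elements
  that carry it to \<open>\<tau>2\<close> contribute the other two members of its orbit; for a generating pair of the
  alternating group, three equal terms add up to a single one.
\<close>
lemma trace_kernel_trace:
  assumes char: "CHAR('k::field) = 2" and w: "w \<in> Omega1"
  shows "(\<Sum>g\<in>carrier S3. pm_push (conj_pair g) (trace_kernel (conj_pair (inv\<^bsub>S3\<^esub> g) w)))
    = (single w 1 - (\<Sum>i\<in>{..<4}. if w \<in> pair_orbit i then orbit_sum (pair_orbit i) else 0)
        :: perm_pair \<Rightarrow>\<^sub>0 'k)"
proof -
  have neg: "- (a :: perm_pair \<Rightarrow>\<^sub>0 'k) = a" for a
    by (rule pm_char2[OF char])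
  have O2: ?thesis if "w \<in> pair_orbit 0 \<union> pair_orbit 1 \<union> pair_orbit 2"
  proof -
    have "w = (\<tau>1, \<epsilon>) \<or> w = (\<tau>2, \<epsilon>) \<or> w = (\<tau>3, \<epsilon>) \<or> w = (\<epsilon>, \<tau>1) \<or> w = (\<epsilon>, \<tau>2) \<or> w = (\<epsilon>, \<tau>3)
        \<or> w = (\<tau>1, \<tau>1) \<or> w = (\<tau>2, \<tau>2) \<or> w = (\<tau>3, \<tau>3)"
      using that by (auto simp: pair_orbit_def)
    then show ?thesis
      unfolding carrier_S3
      by (elim disjE; hypsubst)
        (simp_all add: trace_kernel_def conj_pair_simp lessThan_unfold pair_orbit_def orbit_sum_def neg)
  qed
  have O3: ?thesis if "w \<in> O3"
  proof -
    have "w = (\<epsilon>, rot) \<or> w = (\<epsilon>, rot') \<or> w = (rot, \<epsilon>) \<or> w = (rot, rot) \<or> w = (rot, rot')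
        \<or> w = (rot', \<epsilon>) \<or> w = (rot', rot) \<or> w = (rot', rot')"
      using that by (auto simp: O3_eq)
    then show ?thesis
      unfolding carrier_S3
      by (elim disjE; hypsubst)
        (simp_all add: trace_kernel_def conj_pair_simp lessThan_unfold pair_orbit_def
          single_add[symmetric] three_eq_one[OF char])
  qed
  have O1: ?thesis if "w \<in> pair_orbit 3"
    using that unfolding carrier_S3 by (simp add: pair_orbit_def trace_kernel_def conj_pair_simp lessThan_unfold orbit_sum_def)
  from w have "w \<in> pair_orbit 0 \<union> pair_orbit 1 \<union> pair_orbit 2 \<or> w \<in> O3 \<or> w \<in> pair_orbit 3"
    unfolding Omega1_parts O2_orbits O1_orbit lessThan_unfold by blast
  then show ?thesis using O1 O2 O3 by blast
qed

lemma orbit_coeff_linear: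
  "orbit_coeff A (x + y) = orbit_coeff A x + orbit_coeff A y"
  "orbit_coeff A (pm_scale c x) = c * orbit_coeff A x"
  by (simp_all add: orbit_coeff_def vector_space.lin_add[OF vector_space_mult]
      vector_space.lin_scale[OF vector_space_mult])

lemma gmod_map_orbit_coeff:
  assumes "conj_stable B"
  shows "gmod_map S3 (M1 B) (trivial_module :: ('k::field, 'k, nat \<Rightarrow> nat) gmodule)
    (orbit_coeff (pair_orbit i))"
proof -
  have "orbit_coeff (pair_orbit i) (pm_push (conj_pair g) x) = orbit_coeff (pair_orbit i) x"
    if "g \<in> carrier S3" "keys x \<subseteq> B" for g and x :: "perm_pair \<Rightarrow>\<^sub>0 'k"
    unfolding orbit_coeff_def lin_pm_push[OF vector_space_mult]
    using that assms orbit_conj_iff[OF that(1)]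
    by (intro vector_space.lin_cong[OF vector_space_mult]) (auto simp: conj_stable_def subset_iff)
  then show ?thesis by (simp add: gmod_map_def orbit_coeff_linear)
qed

lemma conj_pair_inverse:
  assumes "g \<in> carrier S3" "w \<in> Omega1"
  shows "conj_pair (inv\<^bsub>S3\<^esub> g) (conj_pair g w) = w"
proof -
  interpret group S3 by (rule group_S3)
  show ?thesis
    using assms conj_pair_mult[of "inv\<^bsub>S3\<^esub> g" g w] by (simp add: conj_pair_one)
qed

lemma orbit_sum_invariant:
  assumes g: "g \<in> carrier S3"
  shows "pm_push (conj_pair g) (orbit_sum (pair_orbit i)) = orbit_sum (pair_orbit i)"
proof -
  have "inj_on (conj_pair g) (pair_orbit i)"
    by (rule inj_on_inverseI[where g = "conj_pair (inv\<^bsub>S3\<^esub> g)"])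
      (rule conj_pair_inverse[OF g subsetD[OF pair_orbit_facts(2)]])
  moreover have "conj_pair g ` pair_orbit i \<subseteq> pair_orbit i"
    using pair_orbit_facts(2)[of i] orbit_conj_iff[OF g, of _ i] by blast
  ultimately have bij: "bij_betw (conj_pair g) (pair_orbit i) (pair_orbit i)"
    by (simp add: bij_betw_def endo_inj_surj pair_orbit_facts(1))
  have "pm_push (conj_pair g) (orbit_sum (pair_orbit i))
      = (\<Sum>x\<in>pair_orbit i. single (conj_pair g x) 1)"
    by (simp add: orbit_sum_def pm_push_eq_lin pm.lin_sum)
  also have "\<dots> = orbit_sum (pair_orbit i)"
    unfolding orbit_sum_def by (rule sum.reindex_bij_betw[OF bij])
  finally show ?thesis .
qed

lemma pair_orbit_disjoint:
  assumes "i < 4" "j < 4" "x \<in> pair_orbit i" "x \<in> pair_orbit j"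
  shows "i = j"
proof -
  have "k = (if x = (\<epsilon>, \<epsilon>) then 3 else if snd x = \<epsilon> then 0 else if fst x = \<epsilon> then 1 else 2)"
    if "k < 4" "x \<in> pair_orbit k" for k
  proof -
    have "k = 0 \<or> k = 1 \<or> k = 2 \<or> k = 3" using that(1) by auto
    then show ?thesis
      using that(2) by (elim disjE; hypsubst) (auto simp: pair_orbit_def)
  qed
  from this[OF assms(1,3)] this[OF assms(2,4)] show ?thesis by simp
qed

lemma keys_orbit_sum: "keys (orbit_sum A) \<subseteq> A"
proof (cases "finite A")
  case True
  have "(\<Sum>x\<in>D. single x 1) \<in> {q :: _ \<Rightarrow>\<^sub>0 'b::field. keys q \<subseteq> A}" if "finite D" "D \<subseteq> A" for D
    using that by (induction D rule: finite_induct) (simp_all add: keys_add_subset)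
  from this[OF True] show ?thesis by (simp add: orbit_sum_def)
qed (simp add: orbit_sum_def)

lemma (in vector_space) lin_fun_sum:
  "lin scale (\<lambda>x. \<Sum>i\<in>I. F i x) p = (\<Sum>i\<in>I. lin scale (F i) p)"
proof -
  have "lin scale (\<lambda>x. 0) p = 0" by (simp add: lin_def)
  then show ?thesis
    by (induction I rule: infinite_finite_induct) (simp_all add: lin_fun_add)
qed

lemma trace_kernel_closed:
  assumes "conj_stable B" "w \<in> B"
  shows "keys (trace_kernel w) \<subseteq> B"
proof -
  have "conj_pair \<tau>3 w \<in> B" using assms by (simp add: conj_stable_def carrier_S3)
  then show ?thesis using assms(2) by (auto simp: trace_kernel_def conj_pair_simp split: if_splits)
qed

text \<open>
  The function \<open>j\<close> selects the orbits that lie in \<open>B\<close>, so that the trace identity for all commuting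
  pairs can be used for each of the three parts.
\<close>
lemma trace_split_M1:
  fixes B :: "perm_pair set" and j :: "'i \<Rightarrow> nat"
  assumes char: "CHAR('k::field) = 2" and B: "conj_stable B"
    and I: "finite I" "inj_on j I" "j ` I \<subseteq> {..<4}"
    and orbits: "\<And>i. i \<in> I \<Longrightarrow> pair_orbit (j i) \<subseteq> B"
      "\<And>i. i < 4 \<Longrightarrow> i \<notin> j ` I \<Longrightarrow> pair_orbit i \<inter> B = {}"
  shows "trace_split S3 (M1 B :: ('k, _, _) gmodule) I (\<lambda>i. orbit_sum (pair_orbit (j i)))
    (\<lambda>i. orbit_coeff (pair_orbit (j i))) trace_map"
proof (intro trace_split.intro trace_split_axioms.intro gmod_M1 B)
  show "finite (carrier S3)" by (simp add: carrier_S3)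
  show "finite I" by fact
  show "orbit_sum (pair_orbit (j i)) \<in> carrier (M1 B)" if "i \<in> I" for i
    using keys_orbit_sum[of "pair_orbit (j i)"] orbits(1)[OF that] by auto
  show "gact (M1 B) g (orbit_sum (pair_orbit (j i))) = orbit_sum (pair_orbit (j i))"
    if "g \<in> carrier S3" for g i
    using orbit_sum_invariant[OF that] by simp
  show "gmod_map S3 (M1 B) trivial_module (orbit_coeff (pair_orbit (j i)))" for i
    by (rule gmod_map_orbit_coeff[OF B])
  show "trace_map (x + y) = trace_map x + trace_map y" for x y
    by (simp add: trace_map_def pm.lin_add)
  show "trace_map (c \<odot>\<^bsub>M1 B\<^esub> x) = c \<odot>\<^bsub>M1 B\<^esub> trace_map x" for c x
    by (simp add: trace_map_def pm.lin_scale)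
  fix x :: "perm_pair \<Rightarrow>\<^sub>0 'k" assume "x \<in> carrier (M1 B)"
  then have x: "keys x \<subseteq> B" by simp
  have "trace_map x \<in> {q. keys q \<subseteq> B}"
    unfolding trace_map_def
    by (rule pm.lin_closed)
      (use subsetD[OF x] in \<open>simp_all add: keys_add_subset keys_pm_scale_subset trace_kernel_closed[OF B]\<close>)
  then show "trace_map x \<in> carrier (M1 B)" by simp
  have push: "pm_push (conj_pair g) (trace_map (pm_push (conj_pair h) x))
      = lin pm_scale (\<lambda>w. pm_push (conj_pair g) (trace_kernel (conj_pair h w))) x" for g h
    unfolding trace_map_def lin_pm_push[OF vector_space_pm_scale]
    by (rule linear_lin[OF vector_space_pm_scale vector_space_pm_scale])
      (simp_all add: pm_push_add pm_push_scale)
  have coeff: "pm_scale (orbit_coeff A x) (v :: perm_pair \<Rightarrow>\<^sub>0 'k)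
      = lin pm_scale (\<lambda>w. if w \<in> A then v else 0) x" for A v
  proof -
    have "pm_scale (orbit_coeff A x) v = lin pm_scale (\<lambda>w. pm_scale (if w \<in> A then 1 else 0) v) x"
      unfolding orbit_coeff_def
      by (rule linear_lin[OF vector_space_mult vector_space_pm_scale]) (simp_all add: pm.scale_left_distrib)
    then show ?thesis by (simp add: if_distrib if_distribR cong: if_cong)
  qed
  have "(\<Sum>g\<in>carrier S3. gact (M1 B) g (trace_map (gact (M1 B) (inv\<^bsub>S3\<^esub> g) x)))
      = lin pm_scale (\<lambda>w. \<Sum>g\<in>carrier S3. pm_push (conj_pair g) (trace_kernel (conj_pair (inv\<^bsub>S3\<^esub> g) w))) x"
    by (simp add: push pm.lin_fun_sum)
  also have "\<dots> = lin pm_scale (\<lambda>w. single w 1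
      - (\<Sum>i\<in>I. if w \<in> pair_orbit (j i) then orbit_sum (pair_orbit (j i)) else 0)) x"
  proof (rule pm.lin_cong)
    fix w assume "w \<in> keys x"
    then have w: "w \<in> B" "w \<in> Omega1" using x B by (auto simp: conj_stable_def)
    have "(\<Sum>i\<in>{..<4}. if w \<in> pair_orbit i then orbit_sum (pair_orbit i) else 0)
        = (\<Sum>i\<in>j ` I. if w \<in> pair_orbit i then orbit_sum (pair_orbit i) else (0 :: _ \<Rightarrow>\<^sub>0 'k))"
      using I orbits(2) w(1) by (intro sum.mono_neutral_right) auto
    also have "\<dots> = (\<Sum>i\<in>I. if w \<in> pair_orbit (j i) then orbit_sum (pair_orbit (j i)) else 0)"
      using I(2) by (simp add: sum.reindex)
    finally show "(\<Sum>g\<in>carrier S3. pm_push (conj_pair g) (trace_kernel (conj_pair (inv\<^bsub>S3\<^esub> g) w)))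
        = (single w 1
          - (\<Sum>i\<in>I. if w \<in> pair_orbit (j i) then orbit_sum (pair_orbit (j i)) else 0) :: _ \<Rightarrow>\<^sub>0 'k)"
      using trace_kernel_trace[OF char w(2)] by simp
  qed
  also have "\<dots> = x - (\<Sum>i\<in>I. orbit_coeff (pair_orbit (j i)) x \<odot>\<^bsub>M1 B\<^esub> orbit_sum (pair_orbit (j i)))"
    by (simp add: pm.lin_fun_diff pm.lin_fun_sum coeff)
  finally show "(\<Sum>g\<in>carrier S3. gact (M1 B) g (trace_map (gact (M1 B) (inv\<^bsub>S3\<^esub> g) x)))
      = x - (\<Sum>i\<in>I. orbit_coeff (pair_orbit (j i)) x \<odot>\<^bsub>M1 B\<^esub> orbit_sum (pair_orbit (j i)))" .
qed

lemma orbit_coeff_eq_sum: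
  assumes "finite A"
  shows "orbit_coeff A v = (\<Sum>x\<in>A. lookup v x)"
proof -
  have "orbit_coeff A v = (\<Sum>x\<in>keys v \<inter> A. lookup v x)"
    unfolding orbit_coeff_def lin_def by (simp add: sum.inter_restrict if_distrib cong: if_cong)
  also have "\<dots> = (\<Sum>x\<in>A. lookup v x)"
    using assms by (intro sum.mono_neutral_left) (auto simp: in_keys_iff)
  finally show ?thesis .
qed

lemma lookup_orbit_sum:
  assumes "finite A"
  shows "lookup (orbit_sum A) x = (if x \<in> A then 1 else 0)"
  using assms by (simp add: orbit_sum_def lookup_sum lookup_single when_def)

text \<open>
  Orbits have odd size, hence the sum of the coefficients of an orbit sum is one. This makes coefficient
  sums dual to orbit sums.
\<close>
lemma trace_free_M1:
  fixes B :: "perm_pair set" and j :: "'i \<Rightarrow> nat"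
  assumes char: "CHAR('k::field) = 2" and B: "conj_stable B"
    and I: "finite I" "inj_on j I" "j ` I \<subseteq> {..<4}"
    and orbits: "B = (\<Union>i\<in>I. pair_orbit (j i))"
  shows "trace_free S3 (M1 B :: ('k, _, _) gmodule) I (\<lambda>i. orbit_sum (pair_orbit (j i)))
    (\<lambda>i. orbit_coeff (pair_orbit (j i))) trace_map"
proof (intro trace_free.intro trace_free_axioms.intro trace_split_M1 char B I)
  show "pair_orbit (j i) \<subseteq> B" if "i \<in> I" for i using that orbits by auto
  show "pair_orbit i \<inter> B = {}" if "i < 4" "i \<notin> j ` I" for i
  proof -
    have "x \<notin> pair_orbit (j k)" if x: "x \<in> pair_orbit i" and k: "k \<in> I" for x k
      using pair_orbit_disjoint[of i "j k" x] x k I(3) \<open>i < 4\<close> \<open>i \<notin> j ` I\<close> by blast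
    then show ?thesis unfolding orbits by blast
  qed
  have disj: "x \<in> pair_orbit (j i) \<Longrightarrow> x \<in> pair_orbit (j k) \<Longrightarrow> i = k" if "i \<in> I" "k \<in> I" for i k x
    using pair_orbit_disjoint[of "j i" "j k" x] that I(2,3) by (auto dest: inj_onD)
  show "orbit_coeff (pair_orbit (j i)) (orbit_sum (pair_orbit (j k)) :: _ \<Rightarrow>\<^sub>0 'k) = (if i = k then 1 else 0)"
    if ik: "i \<in> I" "k \<in> I" for i k
  proof (cases "i = k")
    case True
    then show ?thesis
      using pair_orbit_facts(3)[OF char, of "j k"]
      by (simp add: orbit_coeff_eq_sum lookup_orbit_sum pair_orbit_facts(1))
  next
    case False
    then have "(if x \<in> pair_orbit (j k) then 1 else 0) = (0 :: 'k)" if x: "x \<in> pair_orbit (j i)" for x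
      using disj[OF ik x] by (cases "x \<in> pair_orbit (j k)") simp_all
    with False show ?thesis
      by (simp add: orbit_coeff_eq_sum lookup_orbit_sum pair_orbit_facts(1))
  qed
  fix v :: "perm_pair \<Rightarrow>\<^sub>0 'k"
  assume v: "v \<in> carrier (M1 B)" and inv: "\<And>g. g \<in> carrier S3 \<Longrightarrow> gact (M1 B) g v = v"
  have const: "lookup v x = lookup v y"
    if i: "i \<in> I" and xy: "x \<in> pair_orbit (j i)" "y \<in> pair_orbit (j i)" for i x y
  proof -
    obtain g where g: "g \<in> carrier S3" "conj_pair g x = y" using orbit_transitive[OF xy] by auto
    have "inj_on (conj_pair g) Omega1"
      by (rule inj_on_inverseI[where g = "conj_pair (inv\<^bsub>S3\<^esub> g)"]) (rule conj_pair_inverse[OF g(1)])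
    then have "lookup (pm_push (conj_pair g) v) (conj_pair g x) = lookup v x"
      using v B xy pair_orbit_facts(2)[of "j i"] by (intro lookup_pm_push[where B = Omega1]) (auto simp: conj_stable_def)
    then show ?thesis using inv[OF g(1)] g(2) by simp
  qed
  show "v = (\<Sum>i\<in>I. orbit_coeff (pair_orbit (j i)) v \<odot>\<^bsub>M1 B\<^esub> orbit_sum (pair_orbit (j i)))"
  proof (rule poly_mapping_eqI)
    fix x
    show "lookup v x = lookup
        (\<Sum>i\<in>I. orbit_coeff (pair_orbit (j i)) v \<odot>\<^bsub>M1 B\<^esub> orbit_sum (pair_orbit (j i))) x"
    proof (cases "x \<in> B")
      case False
      then have "lookup v x = 0" using v by (auto simp: in_keys_iff)
      with False show ?thesis
        by (auto simp: lookup_sum lookup_orbit_sum pair_orbit_facts(1) orbits intro!: sum.neutral)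
    next
      case True
      then obtain k where k: "k \<in> I" "x \<in> pair_orbit (j k)" by (auto simp: orbits)
      have "orbit_coeff (pair_orbit (j k)) v = (\<Sum>y\<in>pair_orbit (j k). lookup v x)"
        unfolding orbit_coeff_eq_sum[OF pair_orbit_facts(1)] using const[OF k(1) _ k(2)] by (intro sum.cong) auto
      then have coeff: "orbit_coeff (pair_orbit (j k)) v = lookup v x"
        using pair_orbit_facts(3)[OF char, of "j k"] by simp
      have "lookup (\<Sum>i\<in>I. orbit_coeff (pair_orbit (j i)) v \<odot>\<^bsub>M1 B\<^esub> orbit_sum (pair_orbit (j i))) x
          = (\<Sum>i\<in>I. if i = k then lookup v x else 0)"
        unfolding lookup_sum
      proof (rule sum.cong)
        fix i assume i: "i \<in> I"
        have "x \<in> pair_orbit (j i) \<longleftrightarrow> i = k" using disj[OF i k(1) _ k(2)] k(2) by blast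
        then show "lookup (orbit_coeff (pair_orbit (j i)) v \<odot>\<^bsub>M1 B\<^esub> orbit_sum (pair_orbit (j i))) x
            = (if i = k then lookup v x else 0)"
          using coeff by (simp add: lookup_orbit_sum pair_orbit_facts(1))
      qed simp
      then show ?thesis using k(1) I(1) by simp
    qed
  qed
qed

section \<open>The action of the modular group\<close>

context group
begin

lemma conj_int_pow:
  assumes "g \<in> carrier G" "x \<in> carrier G"
  shows "g \<otimes> x [^] (k :: int) \<otimes> inv g = (g \<otimes> x \<otimes> inv g) [^] k"
proof -
  have "(\<lambda>x. g \<otimes> x \<otimes> inv g) \<in> hom G G"
  proof (rule homI)
    fix x y assume "x \<in> carrier G" "y \<in> carrier G"
    then show "g \<otimes> (x \<otimes> y) \<otimes> inv g = (g \<otimes> x \<otimes> inv g) \<otimes> (g \<otimes> y \<otimes> inv g)"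
      using assms(1) by (metis inv_closed inv_solve_right m_assoc m_closed)
  qed (use assms in auto)
  from hom_int_pow[OF this assms(2) is_group is_group] show ?thesis .
qed

lemma commute_int_pow:
  assumes "x \<in> carrier G" "y \<in> carrier G" "x \<otimes> y = y \<otimes> x"
  shows "x \<otimes> y [^] (k :: int) = y [^] k \<otimes> x"
proof -
  have "x \<otimes> y \<otimes> inv x = y" using assms by (simp add: inv_solve_right')
  then have "x \<otimes> y [^] k \<otimes> inv x = y [^] k"
    using conj_int_pow[OF assms(1,2), of k] by simp
  then show ?thesis using assms by (metis inv_solve_right' int_pow_closed m_closed)
qed

lemma commute_int_pow_int_pow:
  assumes "x \<in> carrier G" "y \<in> carrier G" "x \<otimes> y = y \<otimes> x"
  shows "x [^] (i :: int) \<otimes> y [^] (k :: int) = y [^] k \<otimes> x [^] i"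
  using commute_int_pow[of "y [^] k" x i] commute_int_pow[OF assms, of k] assms by simp

lemma int_pow_pair_mult:
  assumes xy: "x \<in> carrier G" "y \<in> carrier G" "x \<otimes> y = y \<otimes> x"
  shows "(x [^] (p :: int) \<otimes> y [^] (q :: int)) \<otimes> (x [^] (r :: int) \<otimes> y [^] (s :: int))
    = x [^] (p + r) \<otimes> y [^] (q + s)"
proof -
  have "(x [^] p \<otimes> y [^] q) \<otimes> (x [^] r \<otimes> y [^] s) = x [^] p \<otimes> (y [^] q \<otimes> x [^] r) \<otimes> y [^] s"
    using xy by (simp add: m_assoc)
  also have "y [^] q \<otimes> x [^] r = x [^] r \<otimes> y [^] q"
    using commute_int_pow_int_pow[OF xy] by simp
  finally show ?thesis
    using xy by (simp add: m_assoc int_pow_mult)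
qed

lemma int_pow_pair_pow:
  assumes xy: "x \<in> carrier G" "y \<in> carrier G" "x \<otimes> y = y \<otimes> x"
  shows "(x [^] (p :: int) \<otimes> y [^] (q :: int)) [^] (k :: int) = x [^] (p * k) \<otimes> y [^] (q * k)"
  using commute_int_pow_int_pow[OF xy, of p q] commute_int_pow_int_pow[OF xy, of "p * k" "q * k"] xy
  by (simp add: int_pow_mult_distrib int_pow_pow)

end

interpretation S3: group S3 by (rule group_S3)

lemma matrix_pair_simp:
  "matrix_pair A (a, b) = (a [^]\<^bsub>S3\<^esub> A$1$1 \<otimes>\<^bsub>S3\<^esub> b [^]\<^bsub>S3\<^esub> A$1$2,
     a [^]\<^bsub>S3\<^esub> A$2$1 \<otimes>\<^bsub>S3\<^esub> b [^]\<^bsub>S3\<^esub> A$2$2)"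
  by (simp add: matrix_pair_def)

lemma Omega1_iff: "(a, b) \<in> Omega1 \<longleftrightarrow>
    a \<in> carrier S3 \<and> b \<in> carrier S3 \<and> a \<otimes>\<^bsub>S3\<^esub> b = b \<otimes>\<^bsub>S3\<^esub> a"
  by (simp add: Omega1_def)

lemma matrix_pair_closed: "w \<in> Omega1 \<Longrightarrow> matrix_pair A w \<in> Omega1"
  by (cases w) (simp add: matrix_pair_simp Omega1_iff S3.int_pow_pair_mult add.commute)

lemma matrix_pair_mult:
  "w \<in> Omega1 \<Longrightarrow> matrix_pair A (matrix_pair B w) = matrix_pair (A ** B) w"
  by (cases w)
    (simp add: matrix_pair_simp Omega1_iff S3.int_pow_pair_pow S3.int_pow_pair_mult
      matrix_matrix_mult_def UNIV_2 mult.commute)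

lemma matrix_pair_one: "w \<in> Omega1 \<Longrightarrow> matrix_pair (mat 1) w = w"
  by (cases w) (simp add: matrix_pair_simp Omega1_iff mat_def)

lemma matrix_pair_conj:
  assumes "g \<in> carrier S3" "w \<in> Omega1"
  shows "matrix_pair A (conj_pair g w) = conj_pair g (matrix_pair A w)"
proof -
  have "g \<otimes>\<^bsub>S3\<^esub> (x \<otimes>\<^bsub>S3\<^esub> y) \<otimes>\<^bsub>S3\<^esub> inv\<^bsub>S3\<^esub> g
      = (g \<otimes>\<^bsub>S3\<^esub> x \<otimes>\<^bsub>S3\<^esub> inv\<^bsub>S3\<^esub> g) \<otimes>\<^bsub>S3\<^esub> (g \<otimes>\<^bsub>S3\<^esub> y \<otimes>\<^bsub>S3\<^esub> inv\<^bsub>S3\<^esub> g)"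
    if "x \<in> carrier S3" "y \<in> carrier S3" for x y
    using assms(1) that by (metis S3.inv_closed S3.inv_solve_right S3.m_assoc S3.m_closed)
  then show ?thesis
    using assms by (cases w) (simp add: matrix_pair_simp conj_pair_simp Omega1_iff S3.conj_int_pow)
qed

lemma generate_matrix_pair:
  assumes "w \<in> Omega1"
  shows "generate S3 {fst (matrix_pair A w), snd (matrix_pair A w)} \<subseteq> generate S3 {fst w, snd w}"
proof -
  obtain a b where w: "w = (a, b)" by (cases w)
  have ab: "{a, b} \<subseteq> carrier S3" using assms by (simp add: w Omega1_iff)
  have sub: "subgroup (generate S3 {a, b}) S3" by (rule S3.generate_is_subgroup[OF ab])
  have "a \<in> generate S3 {a, b}" "b \<in> generate S3 {a, b}" by (auto intro: generate.incl)
  then have "a [^]\<^bsub>S3\<^esub> k \<otimes>\<^bsub>S3\<^esub> b [^]\<^bsub>S3\<^esub> l \<in> generate S3 {a, b}" for k l :: int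
    using S3.subgroup_int_pow_closed[OF sub] subgroup.m_closed[OF sub] by blast
  then have "{fst (matrix_pair A w), snd (matrix_pair A w)} \<subseteq> generate S3 {a, b}"
    by (simp add: w matrix_pair_simp)
  from S3.generate_subgroup_incl[OF this sub] show ?thesis by (simp add: w)
qed

subsection \<open>Invertible matrices\<close>

text \<open>
  \<^const>\<open>matrix_inv\<close> picks some two-sided inverse; as inverses are unique, it is the adjugate matrix.
\<close>
lemma adjugate:
  fixes A :: "int^2^2"
  assumes A: "A \<in> SL2Z"
  shows "matrix_inv (transpose A) ** transpose A = mat 1"
    "transpose A ** matrix_inv (transpose A) = mat 1"
    "matrix_inv (transpose A) $ 1 $ 1 = A$2$2" "matrix_inv (transpose A) $ 1 $ 2 = - A$2$1"
    "matrix_inv (transpose A) $ 2 $ 1 = - A$1$2" "matrix_inv (transpose A) $ 2 $ 2 = A$1$1"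
proof -
  let ?T = "transpose A"
  define N :: "int^2^2" where
    "N = (\<chi> i j. if i = 1 then (if j = 1 then A$2$2 else - A$2$1) else (if j = 1 then - A$1$2 else A$1$1))"
  have det: "A$1$1 * A$2$2 - A$1$2 * A$2$1 = 1" using A by (simp add: SL2Z_def det_2)
  have TN: "?T ** N = mat 1" "N ** ?T = mat 1"
    using det by (simp_all add: vec_eq_iff forall_2 matrix_matrix_mult_def UNIV_2 transpose_def N_def mat_def algebra_simps)
  then have "?T ** matrix_inv ?T = mat 1 \<and> matrix_inv ?T ** ?T = mat 1"
    unfolding matrix_inv_def by (rule someI[of _ N, OF conjI])
  then show 1: "?T ** matrix_inv ?T = mat 1" "matrix_inv ?T ** ?T = mat 1" by auto
  have "matrix_inv ?T = matrix_inv ?T ** (?T ** N)" by (simp add: TN)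
  also have "\<dots> = N" by (simp add: matrix_mul_assoc 1)
  finally show "matrix_inv ?T $ 1 $ 1 = A$2$2" "matrix_inv ?T $ 1 $ 2 = - A$2$1"
    "matrix_inv ?T $ 2 $ 1 = - A$1$2" "matrix_inv ?T $ 2 $ 2 = A$1$1"
    by (simp_all add: N_def)
qed

abbreviation sl2_pair :: "int^2^2 \<Rightarrow> perm_pair \<Rightarrow> perm_pair" where
  "sl2_pair A \<equiv> matrix_pair (matrix_inv (transpose A))"

lemma sl2_pair_inverse:
  assumes "A \<in> SL2Z" "w \<in> Omega1"
  shows "matrix_pair (transpose A) (sl2_pair A w) = w" "sl2_pair A (matrix_pair (transpose A) w) = w"
  using assms adjugate(1,2)[OF assms(1)] by (simp_all add: matrix_pair_mult matrix_pair_one)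

text \<open>
  The entries of each pair are words in the entries of the other.
\<close>
lemma generate_sl2_pair:
  assumes "A \<in> SL2Z" "w \<in> Omega1"
  shows "generate S3 {fst (sl2_pair A w), snd (sl2_pair A w)} = generate S3 {fst w, snd w}"
  using generate_matrix_pair[OF assms(2)] generate_matrix_pair[OF matrix_pair_closed[OF assms(2)], of "transpose A"]
    sl2_pair_inverse(1)[OF assms] by (metis subset_antisym)

lemma sl2_pair_parts:
  assumes A: "A \<in> SL2Z" and B: "B \<in> {Omega1, O1, O2, O3}" and w: "w \<in> B"
  shows "sl2_pair A w \<in> B"
proof -
  have parts: "O1 = {w \<in> Omega1. generate S3 {fst w, snd w} = {\<one>\<^bsub>S3\<^esub>}}"
    "O2 = {w \<in> Omega1. card (generate S3 {fst w, snd w}) = 2}"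
    "O3 = {w \<in> Omega1. generate S3 {fst w, snd w} = carrier (alt_group 3)}"
    unfolding O1_def O2_def O3_def by (rule Collect_cong; simp split: prod.split)+
  have w1: "w \<in> Omega1" using B w by (auto simp: parts)
  then have "sl2_pair A w \<in> Omega1" by (rule matrix_pair_closed)
  with w1 show ?thesis
    using B w unfolding parts insert_iff empty_iff
    by (elim disjE FalseE) (simp_all add: generate_sl2_pair[OF A w1])
qed

lemma sl2_pair_bij:
  assumes A: "A \<in> SL2Z" and B: "B \<in> {Omega1, O1, O2, O3}" and fin: "finite B"
  shows "bij_betw (sl2_pair A) B B"
proof -
  have "B \<subseteq> Omega1" using B conj_stable_parts by (auto simp: conj_stable_def)
  then have "inj_on (sl2_pair A) B"
    using sl2_pair_inverse(1)[OF A]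
    by (intro inj_on_inverseI[where g = "matrix_pair (transpose A)"]) blast
  moreover have "sl2_pair A ` B \<subseteq> B" using sl2_pair_parts[OF A B] by blast
  ultimately show ?thesis using fin by (simp add: bij_betw_def endo_inj_surj)
qed

lemma gmod_map_sl2_act:
  assumes A: "A \<in> SL2Z" and B: "B \<in> {Omega1, O1, O2, O3}"
  shows "gmod_map S3 (M1 B :: ('k::field, _, _) gmodule) (M1 B) (sl2_act A)"
proof -
  have sub: "B \<subseteq> Omega1" using B conj_stable_parts by (auto simp: conj_stable_def)
  have "keys (sl2_act A x) \<subseteq> B" if "keys x \<subseteq> B" for x :: "perm_pair \<Rightarrow>\<^sub>0 'k"
    using keys_pm_push[of "sl2_pair A" x] that sl2_pair_parts[OF A B] unfolding sl2_act_def by blast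
  moreover have "sl2_act A (pm_push (conj_pair g) x) = pm_push (conj_pair g) (sl2_act A x)"
    if "g \<in> carrier S3" "keys x \<subseteq> B" for g and x :: "perm_pair \<Rightarrow>\<^sub>0 'k"
    unfolding sl2_act_def pm_push_push
    using that sub matrix_pair_conj by (intro pm_push_cong) blast
  ultimately show ?thesis
    by (simp add: gmod_map_def) (simp add: sl2_act_def pm_push_add pm_push_scale)
qed

subsection \<open>Lines in the plane over the field with three elements\<close>

text \<open>
  The logarithm to the base \<^const>\<open>rot\<close> on the alternating group.
\<close>
definition lg :: "(nat \<Rightarrow> nat) \<Rightarrow> 3" where
  "lg x = (if x = rot then 1 else if x = rot' then 2 else 0)"

definition unlg :: "3 \<Rightarrow> nat \<Rightarrow> nat" where
  "unlg c = (if c = 1 then rot else if c = 2 then rot' else \<epsilon>)"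

lemma cases_3: "(c :: 3) = 0 \<or> c = 1 \<or> c = 2"
  using exhaust_3[of c] by auto

lemma lg_unlg: "lg (unlg c) = c" "unlg c \<in> {\<epsilon>, rot, rot'}"
  using cases_3[of c] by (auto simp: lg_def unlg_def)

lemma lg_inj: "x \<in> {\<epsilon>, rot, rot'} \<Longrightarrow> y \<in> {\<epsilon>, rot, rot'} \<Longrightarrow> lg x = lg y \<Longrightarrow> x = y"
  by (auto simp: lg_def)

lemma lg_mult: "x \<in> {\<epsilon>, rot, rot'} \<Longrightarrow> y \<in> {\<epsilon>, rot, rot'} \<Longrightarrow> lg (x \<otimes>\<^bsub>S3\<^esub> y) = lg x + lg y"
  unfolding insert_iff empty_iff by (elim disjE FalseE; hypsubst) (simp_all add: lg_def)

lemma lg_conj: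
  assumes "g \<in> carrier S3"
  obtains c :: 3 where "c * c = 1"
    "\<And>x. x \<in> {\<epsilon>, rot, rot'} \<Longrightarrow> lg (g \<otimes>\<^bsub>S3\<^esub> x \<otimes>\<^bsub>S3\<^esub> inv\<^bsub>S3\<^esub> g) = c * lg x"
proof -
  define c :: 3 where "c = (if g \<in> {\<epsilon>, rot, rot'} then 1 else 2)"
  have "lg (g \<otimes>\<^bsub>S3\<^esub> x \<otimes>\<^bsub>S3\<^esub> inv\<^bsub>S3\<^esub> g) = c * lg x" if "x \<in> {\<epsilon>, rot, rot'}" for x
    using assms that unfolding carrier_S3 insert_iff empty_iff
    by (elim disjE FalseE; hypsubst) (simp_all add: lg_def c_def)
  moreover have "c * c = 1" by (simp add: c_def)
  ultimately show thesis using that by blast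
qed

lemma lg_int_pow:
  assumes x: "x \<in> {\<epsilon>, rot, rot'}"
  shows "x [^]\<^bsub>S3\<^esub> (k :: int) \<in> {\<epsilon>, rot, rot'}" "lg (x [^]\<^bsub>S3\<^esub> k) = of_int k * lg x"
proof -
  have xc: "x \<in> carrier S3" using x by (auto simp: carrier_S3)
  show mem: "x [^]\<^bsub>S3\<^esub> k \<in> {\<epsilon>, rot, rot'}" for k :: int
    by (rule S3.subgroup_int_pow_closed[OF subgroup_S3(5) x])
  have step: "lg (x [^]\<^bsub>S3\<^esub> (k + 1)) = lg (x [^]\<^bsub>S3\<^esub> k) + lg x" for k :: int
    using lg_mult[OF mem x, of k] xc by (simp add: S3.int_pow_mult)
  show "lg (x [^]\<^bsub>S3\<^esub> k) = of_int k * lg x"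
  proof (induction k rule: int_induct[where k = 0])
    case base
    show ?case by (simp add: S3_one lg_def)
  next
    case (step1 i)
    then show ?case using step[of i] by (simp add: algebra_simps)
  next
    case (step2 i)
    then show ?case using step[of "i - 1"] by (simp add: algebra_simps)
  qed
qed

text \<open>
  The vector attached to \<open>(a, b)\<close> is \<open>(b, - a)\<close> in additive notation, because the matrix
  \<open>J = (0 1; -1 0)\<close> conjugates the action through \<open>(A\<^sup>T)\<^sup>-\<^sup>1\<close> into the one through \<open>A\<close>.
\<close>
definition wvec :: "perm_pair \<Rightarrow> 3^2" where
  "wvec w = (\<chi> i. if i = 1 then lg (snd w) else - lg (fst w))"

definition line_of :: "perm_pair \<Rightarrow> (3^2) set" where
  "line_of w = {c *s wvec w | c. True}"

lemma O3_iff: "(a, b) \<in> O3 \<longleftrightarrow>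
    a \<in> {\<epsilon>, rot, rot'} \<and> b \<in> {\<epsilon>, rot, rot'} \<and> (a, b) \<noteq> (\<epsilon>, \<epsilon>)"
  by (auto simp: O3_eq)

lemma wvec_nonzero:
  assumes "w \<in> O3"
  shows "wvec w \<noteq> 0"
proof -
  obtain a b where w: "w = (a, b)" by (cases w)
  have ab: "a \<in> {\<epsilon>, rot, rot'}" "b \<in> {\<epsilon>, rot, rot'}" "(a, b) \<noteq> (\<epsilon>, \<epsilon>)"
    using assms unfolding w O3_iff by blast+
  have "lg a \<noteq> 0 \<or> lg b \<noteq> 0" using ab by (auto simp: lg_def)
  then show ?thesis by (auto simp: w wvec_def vec_eq_iff forall_2)
qed

lemma P13_eq: "P13 = line_of ` O3"
proof (intro subset_antisym subsetI)
  fix L assume "L \<in> line_of ` O3"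
  then show "L \<in> P13" using wvec_nonzero by (auto simp: P13_def line_of_def)
next
  fix L :: "(3^2) set" assume "L \<in> P13"
  then obtain v where v: "v \<noteq> 0" "L = {c *s v | c. True}" by (auto simp: P13_def)
  define w where "w = (unlg (- v$2), unlg (v$1))"
  have "wvec w = v" by (simp add: w_def wvec_def vec_eq_iff forall_2 lg_unlg)
  moreover have "w \<in> O3"
  proof -
    have "w \<noteq> (\<epsilon>, \<epsilon>)"
    proof
      assume "w = (\<epsilon>, \<epsilon>)"
      then have "wvec w = 0" by (simp add: wvec_def vec_eq_iff forall_2 lg_def)
      with \<open>wvec w = v\<close> v(1) show False by simp
    qed
    then show ?thesis unfolding w_def O3_iff using lg_unlg(2) by blast
  qed
  ultimately show "L \<in> line_of ` O3" using v(2) by (auto simp: line_of_def)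
qed

text \<open>
  The alternating group centralizes itself, and a transposition inverts it. So conjugation multiplies
  the vector of a pair by \<open>1\<close> or \<open>-1\<close>.
\<close>
lemma line_of_conj:
  assumes g: "g \<in> carrier S3" and w: "w \<in> O3"
  shows "line_of (conj_pair g w) = line_of w"
proof -
  obtain a b where w': "w = (a, b)" by (cases w)
  have ab: "a \<in> {\<epsilon>, rot, rot'}" "b \<in> {\<epsilon>, rot, rot'}" using w by (simp_all only: w' O3_iff)
  obtain c :: 3 where c: "c * c = 1"
    "\<And>x. x \<in> {\<epsilon>, rot, rot'} \<Longrightarrow> lg (g \<otimes>\<^bsub>S3\<^esub> x \<otimes>\<^bsub>S3\<^esub> inv\<^bsub>S3\<^esub> g) = c * lg x"
    using lg_conj[OF g] by blast
  have v: "wvec (conj_pair g w) = c *s wvec w"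
    using c(2)[OF ab(1)] c(2)[OF ab(2)] by (simp add: w' wvec_def conj_pair_simp vec_eq_iff forall_2)
  have "d *s wvec w = (d * c) *s (c *s wvec w)" for d
    using c(1) by (simp add: mult.assoc vector_smult_assoc)
  then show ?thesis
    unfolding line_of_def v by (auto simp: vector_smult_assoc)
qed

text \<open>
  The nonzero scalars are \<open>1\<close> and \<open>2 = -1\<close>, and the second is realized by conjugation with a
  transposition.
\<close>
lemma line_of_eqD:
  assumes w: "w \<in> O3" and w': "w' \<in> O3" and eq: "line_of w = line_of w'"
  shows "\<exists>g\<in>carrier S3. conj_pair g w = w'"
proof -
  obtain a b a' b' where ww: "w = (a, b)" "w' = (a', b')" by (cases w, cases w')
  have ab: "a \<in> {\<epsilon>, rot, rot'}" "b \<in> {\<epsilon>, rot, rot'}" "a' \<in> {\<epsilon>, rot, rot'}" "b' \<in> {\<epsilon>, rot, rot'}"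
    using w w' by (simp_all only: ww O3_iff)
  have "wvec w' \<in> line_of w"
    unfolding eq unfolding line_of_def by (rule CollectI, rule exI[of _ 1]) simp
  then obtain c where c: "wvec w' = c *s wvec w" by (auto simp: line_of_def)
  then have lg: "lg b' = c * lg b" "lg a' = c * lg a"
    by (simp_all add: ww wvec_def vec_eq_iff forall_2)
  have c0: "c \<noteq> 0" using c wvec_nonzero[OF w'] by auto
  consider "c = 1" | "c = 2" using cases_3[of c] c0 by blast
  then show ?thesis
  proof cases
    case 1
    then have "w' = w" using lg lg_inj ab by (simp only: ww) (metis mult_1)
    then have "conj_pair \<epsilon> w = w'"
      using conj_pair_one[of w] w by (simp add: S3_one O3_def case_prod_beta)
    then show ?thesis by (auto simp: carrier_S3)
  next
    case 2
    have conj: "\<tau>1 \<otimes>\<^bsub>S3\<^esub> x \<otimes>\<^bsub>S3\<^esub> inv\<^bsub>S3\<^esub> \<tau>1 = y"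
      if "x \<in> {\<epsilon>, rot, rot'}" "y \<in> {\<epsilon>, rot, rot'}" "lg y = 2 * lg x" for x y
      using that unfolding insert_iff empty_iff by (elim disjE FalseE; hypsubst) (simp_all add: lg_def)
    have "conj_pair \<tau>1 w = w'"
      using conj[of a a'] conj[of b b'] ab lg 2 by (simp add: ww conj_pair_simp)
    then show ?thesis by (auto simp: carrier_S3)
  qed
qed

lemma line_of_sl2:
  assumes A: "A \<in> SL2Z" and w: "w \<in> O3"
  shows "line_of (sl2_pair A w) = line_act A (line_of w)"
proof -
  obtain a b where w': "w = (a, b)" by (cases w)
  have ab: "a \<in> {\<epsilon>, rot, rot'}" "b \<in> {\<epsilon>, rot, rot'}" using w by (simp_all only: w' O3_iff)
  let ?A = "(\<chi> i j. of_int (A$i$j)) :: 3^2^2"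
  have lg: "lg (a [^]\<^bsub>S3\<^esub> k \<otimes>\<^bsub>S3\<^esub> b [^]\<^bsub>S3\<^esub> l) = of_int k * lg a + of_int l * lg b" for k l
    using lg_mult[OF lg_int_pow(1)[OF ab(1)] lg_int_pow(1)[OF ab(2)]] lg_int_pow(2)[OF ab(1)] lg_int_pow(2)[OF ab(2)]
    by simp
  have v: "wvec (sl2_pair A w) = ?A *v wvec w"
    by (simp add: w' wvec_def matrix_pair_simp lg adjugate[OF A] vec_eq_iff forall_2
        matrix_vector_mult_def UNIV_2)
  have "?A *v (c *s x) = c *s (?A *v x)" for c :: 3 and x
    by (simp add: vec_eq_iff forall_2 matrix_vector_mult_def UNIV_2 algebra_simps)
  then have "{c *s (?A *v wvec w) | c. True} = {?A *v (c *s wvec w) | c. True}" by simp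
  also have "\<dots> = (\<lambda>x. ?A *v x) ` {c *s wvec w | c. True}" by blast
  finally show ?thesis
    unfolding line_of_def line_act_def v .
qed

text \<open>
  A surjective map of a finite set to itself is injective. Surjectivity is inherited from the action on
  pairs.
\<close>
lemma line_act_bij:
  assumes A: "A \<in> SL2Z"
  shows "inj_on (line_act A) P13" "line_act A ` P13 \<subseteq> P13"
proof -
  have O3: "w \<in> O3 \<Longrightarrow> sl2_pair A w \<in> O3" for w using sl2_pair_parts[OF A, of O3] by simp
  show "line_act A ` P13 \<subseteq> P13"
    using O3 line_of_sl2[OF A, symmetric] unfolding P13_eq by auto
  have "P13 \<subseteq> line_act A ` P13"
  proof
    fix L assume "L \<in> P13"
    then obtain w where w: "w \<in> O3" "L = line_of w" by (auto simp: P13_eq)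
    have "finite O3" by (simp add: O3_eq)
    then have surj: "sl2_pair A ` O3 = O3"
      by (intro bij_betw_imp_surj_on[OF sl2_pair_bij[OF A]]) simp_all
    have "w \<in> sl2_pair A ` O3" unfolding surj by (rule w(1))
    then obtain w' where w': "w' \<in> O3" "sl2_pair A w' = w" by (elim imageE) simp
    have "L = line_act A (line_of w')" using line_of_sl2[OF A w'(1)] w' w by simp
    then show "L \<in> line_act A ` P13" using w'(1) by (auto simp: P13_eq)
  qed
  moreover have "finite P13" by (simp add: P13_eq O3_eq)
  ultimately show "inj_on (line_act A) P13" by (intro finite_surj_inj) auto
qed

subsection \<open>Invariants of the generating pairs\<close>

lemma KP13_simps [simp]:
  "carrier KP13 = {p. keys p \<subseteq> P13}" "x \<oplus>\<^bsub>KP13\<^esub> y = x + y"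
  "module.smult KP13 = pm_scale" "gact KP13 A = pm_push (line_act A)"
  by (simp_all add: KP13_def)

definition line_rep :: "(3^2) set \<Rightarrow> perm_pair" where
  "line_rep L = (SOME w. w \<in> O3 \<and> line_of w = L)"

text \<open>
  Conjugation acts transitively on the pairs of each line, so that an invariant vector is a function
  on the set of lines. Its value at a line is read off at an arbitrary pair of this line.
\<close>
definition descend :: "(perm_pair \<Rightarrow>\<^sub>0 'k::field) \<Rightarrow> ((3^2) set \<Rightarrow>\<^sub>0 'k)" where
  "descend v = (\<Sum>L\<in>P13. single L (lookup v (line_rep L)))"

lemma line_rep: "L \<in> P13 \<Longrightarrow> line_rep L \<in> O3 \<and> line_of (line_rep L) = L"
  unfolding line_rep_def P13_eq by (rule someI_ex) auto

lemma finite_O3: "finite O3" and finite_P13: "finite P13"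
  by (simp_all add: P13_eq O3_eq)

lemma lookup_descend:
  "lookup (descend v) L = (if L \<in> P13 then lookup v (line_rep L) else 0)"
proof -
  have "lookup (descend v) L
      = (\<Sum>L'\<in>P13. if L' = L then lookup v (line_rep L') else 0)"
    unfolding descend_def lookup_sum by (intro sum.cong) (auto simp: lookup_single when_def)
  then show ?thesis by (simp add: finite_P13)
qed

definition O3_invariant :: "(perm_pair \<Rightarrow>\<^sub>0 'k::field) \<Rightarrow> bool" where
  "O3_invariant v \<longleftrightarrow>
     keys v \<subseteq> O3 \<and> (\<forall>g\<in>carrier S3. pm_push (conj_pair g) v = v)"

lemma O3_subset: "O3 \<subseteq> Omega1"
  by (auto simp: O3_def)

lemma lookup_descend_line_of:
  assumes v: "O3_invariant v" and w: "w \<in> O3"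
  shows "lookup (descend v) (line_of w) = lookup v w"
proof -
  have L: "line_of w \<in> P13" using w by (auto simp: P13_eq)
  obtain g where g: "g \<in> carrier S3" "conj_pair g w = line_rep (line_of w)"
    using line_of_eqD[OF w, of "line_rep (line_of w)"] line_rep[OF L] by metis
  have "inj_on (conj_pair g) O3"
    by (rule inj_on_inverseI[where g = "conj_pair (inv\<^bsub>S3\<^esub> g)"])
      (rule conj_pair_inverse[OF g(1) subsetD[OF O3_subset]])
  then have "lookup (pm_push (conj_pair g) v) (conj_pair g w) = lookup v w"
    using v w by (intro lookup_pm_push) (auto simp: O3_invariant_def)
  then show ?thesis
    using v g L by (simp add: lookup_descend O3_invariant_def)
qed

lemma O3_invariant_eqI:
  assumes "O3_invariant v" "O3_invariant v'" "descend v = descend v'"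
  shows "v = v'"
proof (rule poly_mapping_eqI)
  fix w
  show "lookup v w = lookup v' w"
  proof (cases "w \<in> O3")
    case True
    then show ?thesis using assms lookup_descend_line_of by metis
  next
    case False
    then have "w \<notin> keys v" "w \<notin> keys v'"
      using assms(1,2) by (auto simp: O3_invariant_def)
    then show ?thesis by (simp add: in_keys_iff)
  qed
qed

lemma descend_surj:
  assumes q: "keys q \<subseteq> P13"
  obtains v where "O3_invariant v" "descend v = (q :: _ \<Rightarrow>\<^sub>0 'k::field)"
proof
  define v where "v = (\<Sum>w\<in>O3. single w (lookup q (line_of w)))"
  have lookup: "lookup v w = (if w \<in> O3 then lookup q (line_of w) else 0)" for w
  proof -
    have "lookup v w = (\<Sum>x\<in>O3. if x = w then lookup q (line_of x) else 0)"
      unfolding v_def lookup_sum by (intro sum.cong) (auto simp: lookup_single when_def)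
    then show ?thesis by (simp add: finite_O3)
  qed
  have "pm_push (conj_pair g) v = v" if g: "g \<in> carrier S3" for g
  proof -
    have conj: "conj_pair g w \<in> O3" if "w \<in> O3" for w
      using conj_stable_parts(4) g that by (simp add: conj_stable_def)
    have inj: "inj_on (conj_pair g) O3"
      by (rule inj_on_inverseI[where g = "conj_pair (inv\<^bsub>S3\<^esub> g)"])
        (rule conj_pair_inverse[OF g subsetD[OF O3_subset]])
    then have bij: "bij_betw (conj_pair g) O3 O3"
      using conj finite_O3 by (simp add: bij_betw_def endo_inj_surj image_subset_iff)
    have "pm_push (conj_pair g) v
        = (\<Sum>w\<in>O3. single (conj_pair g w) (lookup q (line_of w)))"
      by (simp add: v_def pm_push_eq_lin pm.lin_sum)
    also have "\<dots> = (\<Sum>w\<in>O3. single (conj_pair g w) (lookup q (line_of (conj_pair g w))))"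
      using line_of_conj[OF g] by (intro sum.cong) auto
    also have "\<dots> = v"
      unfolding v_def by (rule sum.reindex_bij_betw[OF bij])
    finally show ?thesis .
  qed
  moreover have "keys v \<subseteq> O3"
    by (auto simp: in_keys_iff lookup split: if_splits)
  ultimately show "O3_invariant v" by (simp add: O3_invariant_def)
  show "descend v = q"
  proof (rule poly_mapping_eqI)
    fix L
    show "lookup (descend v) L = lookup q L"
    proof (cases "L \<in> P13")
      case True
      then show ?thesis using line_rep[OF True] by (simp add: lookup_descend lookup)
    next
      case False
      then have "L \<notin> keys q" using q by blast
      with False show ?thesis by (simp add: lookup_descend in_keys_iff)
    qed
  qed
qed

lemma keys_descend: "keys (descend v) \<subseteq> P13"
  by (auto simp: in_keys_iff lookup_descend split: if_splits)

lemma descend_sl2: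
  fixes v :: "perm_pair \<Rightarrow>\<^sub>0 'k::field"
  assumes A: "A \<in> SL2Z" and v: "O3_invariant v"
  shows "O3_invariant (sl2_act A v)" "descend (sl2_act A v) = pm_push (line_act A) (descend v)"
proof -
  have keys: "keys v \<subseteq> O3" using v by (simp add: O3_invariant_def)
  have T: "gmod_map S3 (M1 O3 :: ('k, _, _) gmodule) (M1 O3) (sl2_act A)"
    by (rule gmod_map_sl2_act[OF A]) simp
  show inv: "O3_invariant (sl2_act A v)"
    unfolding O3_invariant_def
  proof (intro conjI ballI)
    show "keys (sl2_act A v) \<subseteq> O3"
      using T keys by (simp add: gmod_map_def)
    fix g assume g: "g \<in> carrier S3"
    then have "sl2_act A (pm_push (conj_pair g) v) = pm_push (conj_pair g) (sl2_act A v)"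
      using T keys by (simp add: gmod_map_def)
    then show "pm_push (conj_pair g) (sl2_act A v) = sl2_act A v"
      using v g by (simp add: O3_invariant_def)
  qed
  have bij: "bij_betw (sl2_pair A) O3 O3" by (rule sl2_pair_bij[OF A _ finite_O3]) simp
  show "descend (sl2_act A v) = pm_push (line_act A) (descend v)"
  proof (rule poly_mapping_eqI)
    fix L
    show "lookup (descend (sl2_act A v)) L
        = lookup (pm_push (line_act A) (descend v)) L"
    proof (cases "L \<in> P13")
      case True
      then obtain w' where "w' \<in> O3" "L = line_of w'" by (auto simp: P13_eq)
      moreover have "w' \<in> sl2_pair A ` O3"
        unfolding bij_betw_imp_surj_on[OF bij] by (rule \<open>w' \<in> O3\<close>)
      then obtain w where w: "w \<in> O3" "sl2_pair A w = w'" by (elim imageE) simp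
      ultimately have L: "L = line_of (sl2_pair A w)" "sl2_pair A w \<in> O3" by auto
      have "lookup (descend (sl2_act A v)) L = lookup (sl2_act A v) (sl2_pair A w)"
        unfolding L(1) by (rule lookup_descend_line_of[OF inv L(2)])
      also have "\<dots> = lookup v w"
        unfolding sl2_act_def using bij keys w(1) by (intro lookup_pm_push) (auto simp: bij_betw_def)
      also have "\<dots> = lookup (descend v) (line_of w)"
        by (rule lookup_descend_line_of[OF v w(1), symmetric])
      also have "\<dots> = lookup (pm_push (line_act A) (descend v)) (line_act A (line_of w))"
        using w(1) by (intro lookup_pm_push[symmetric, OF line_act_bij(1)[OF A] keys_descend]) (auto simp: P13_eq)
      finally show ?thesis unfolding L(1) line_of_sl2[OF A w(1)] .
    next
      case False
      have "keys (pm_push (line_act A) (descend v)) \<subseteq> P13"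
        using keys_pm_push[of "line_act A" "descend v"] keys_descend[of v] line_act_bij(2)[OF A] by blast
      with False keys_descend[of "sl2_act A v"]
      have "L \<notin> keys (descend (sl2_act A v))"
        "L \<notin> keys (pm_push (line_act A) (descend v))" by blast+
      then show ?thesis by (simp add: in_keys_iff)
    qed
  qed
qed

lemma (in gmod) cls_zero_eq_iff:
  assumes "Z F" "Z H"
  shows "cls G M 0 F = cls G M 0 H \<longleftrightarrow> F [\<one>\<^bsub>G\<^esub>] = H [\<one>\<^bsub>G\<^esub>]"
proof
  assume "cls G M 0 F = cls G M 0 H"
  then obtain E where "C E" "\<forall>xs\<in>tuples G 0. F xs = H xs + cobd E xs"
    unfolding cls_eq_iff[OF assms] by blast
  moreover have "[\<one>\<^bsub>G\<^esub>] \<in> tuples G 0" by (simp add: tuples_def)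
  ultimately have "F [\<one>\<^bsub>G\<^esub>] = H [\<one>\<^bsub>G\<^esub>] + cobd E [\<one>\<^bsub>G\<^esub>]" "E [] = 0"
    by (auto simp: cochain_def)
  then show "F [\<one>\<^bsub>G\<^esub>] = H [\<one>\<^bsub>G\<^esub>]" by simp
next
  assume eq: "F [\<one>\<^bsub>G\<^esub>] = H [\<one>\<^bsub>G\<^esub>]"
  show "cls G M 0 F = cls G M 0 H"
  proof (rule cls_cong)
    fix xs assume "xs \<in> tuples G 0"
    then obtain y where "xs = [y]" "y \<in> carrier G" by (auto simp: tuples_def length_Suc_conv)
    then show "F xs = H xs"
      using degree_zero_invariant(1)[OF assms(1), of y] degree_zero_invariant(1)[OF assms(2), of y] eq by simp
  qed
qed

text \<open>
  The cohomology in degree \<open>0\<close> is the space of invariants, by evaluation of cocycles at the unit.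
  Two generating pairs are conjugate if and only if they define the same line, so that invariants are
  functions on lines.
\<close>
theorem Ext_O3_iso_KP13:
  "\<exists>\<Psi>. linear_iso (Ext S3 (M1 O3 :: ('k::field, _, _) gmodule) 0) KP13 \<Psi> \<and>
     (\<forall>A\<in>SL2Z. \<forall>x\<in>carrier (Ext S3 (M1 O3 :: ('k, _, _) gmodule) 0).
        \<Psi> (Ext_map S3 (M1 O3) (sl2_act A) 0 x) = gact KP13 A (\<Psi> x))"
proof -
  define M where "M = (M1 O3 :: ('k, perm_pair \<Rightarrow>\<^sub>0 'k, nat \<Rightarrow> nat) gmodule)"
  have simps: "carrier M = {p. keys p \<subseteq> O3}" "module.smult M = pm_scale"
    "gact M g = pm_push (conj_pair g)" for g by (simp_all add: M_def)
  interpret M: gmod S3 M unfolding M_def by (rule gmod_M1[OF conj_stable_parts(4)])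
  define val where "val x = (SOME v. \<exists>F. M.Z F \<and> x = cls S3 M 0 F \<and> v = F [\<one>\<^bsub>S3\<^esub>])" for x
  have val: "val (cls S3 M 0 F) = F [\<one>\<^bsub>S3\<^esub>]" if F: "M.Z F" for F
  proof -
    have "\<exists>H. M.Z H \<and> cls S3 M 0 F = cls S3 M 0 H \<and> val (cls S3 M 0 F) = H [\<one>\<^bsub>S3\<^esub>]"
      unfolding val_def by (rule someI_ex) (use F in blast)
    then obtain H where "M.Z H" "cls S3 M 0 F = cls S3 M 0 H" "val (cls S3 M 0 F) = H [\<one>\<^bsub>S3\<^esub>]"
      by blast
    then show ?thesis using M.cls_zero_eq_iff[OF F, of H] by simp
  qed
  have inv: "O3_invariant (F [\<one>\<^bsub>S3\<^esub>])" if F: "M.Z F" for F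
  proof -
    have "F [\<one>\<^bsub>S3\<^esub>] \<in> carrier M" by (rule M.cochainD(2)[OF M.cocycleD(1)[OF F]]) simp
    moreover have "gact M g (F [\<one>\<^bsub>S3\<^esub>]) = F [\<one>\<^bsub>S3\<^esub>]" if "g \<in> carrier S3" for g
      by (rule M.degree_zero_invariant(2)[OF F _ that]) simp
    ultimately show ?thesis by (simp add: O3_invariant_def simps)
  qed
  define \<Psi> where "\<Psi> x = descend (val x)" for x
  have \<Psi>: "\<Psi> (cls S3 M 0 F) = descend (F [\<one>\<^bsub>S3\<^esub>])" if "M.Z F" for F
    using val[OF that] by (simp add: \<Psi>_def)
  have descend_linear: "descend (x + y) = descend x + descend y"
    "descend (pm_scale c x) = pm_scale c (descend x)" for c and x y :: "perm_pair \<Rightarrow>\<^sub>0 'k"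
    by (auto intro!: poly_mapping_eqI simp: lookup_descend lookup_add)
  have "linear_iso (Ext S3 M 0) KP13 \<Psi>"
    unfolding linear_iso_def
  proof
    show "linear_map (Ext S3 M 0) KP13 \<Psi>"
      unfolding linear_map_def
    proof (intro conjI ballI allI funcsetI)
      fix x assume "x \<in> carrier (Ext S3 M 0)"
      then obtain F where F: "M.Z F" "x = cls S3 M 0 F" by (auto simp: M.carrier_Ext)
      show "\<Psi> x \<in> carrier KP13" using F keys_descend by (simp add: \<Psi>)
      show "\<Psi> (c \<odot>\<^bsub>Ext S3 M 0\<^esub> x) = c \<odot>\<^bsub>KP13\<^esub> \<Psi> x" for c
        using F M.cocycle_smult[OF F(1), of c]
        by (simp add: M.Ext_smult \<Psi> simps descend_linear)
      fix y assume "y \<in> carrier (Ext S3 M 0)"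
      then obtain H where H: "M.Z H" "y = cls S3 M 0 H" by (auto simp: M.carrier_Ext)
      show "\<Psi> (x \<oplus>\<^bsub>Ext S3 M 0\<^esub> y) = \<Psi> x \<oplus>\<^bsub>KP13\<^esub> \<Psi> y"
        using F H M.cocycle_add[OF F(1) H(1)] by (simp add: M.Ext_add \<Psi> descend_linear)
    qed
    show "bij_betw \<Psi> (carrier (Ext S3 M 0)) (carrier KP13)"
      unfolding bij_betw_def
    proof
      show "inj_on \<Psi> (carrier (Ext S3 M 0))"
      proof (rule inj_onI)
        fix x y assume "x \<in> carrier (Ext S3 M 0)" "y \<in> carrier (Ext S3 M 0)" and eq: "\<Psi> x = \<Psi> y"
        then obtain F H where F: "M.Z F" "x = cls S3 M 0 F" and H: "M.Z H" "y = cls S3 M 0 H"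
          by (auto simp: M.carrier_Ext)
        have "F [\<one>\<^bsub>S3\<^esub>] = H [\<one>\<^bsub>S3\<^esub>]"
          using eq F H by (intro O3_invariant_eqI inv) (auto simp: \<Psi>)
        then show "x = y" using F H by (simp add: M.cls_zero_eq_iff)
      qed
      show "\<Psi> ` carrier (Ext S3 M 0) = carrier KP13"
      proof (intro subset_antisym subsetI)
        fix q :: "(3^2) set \<Rightarrow>\<^sub>0 'k" assume "q \<in> carrier KP13"
        then obtain v where v: "O3_invariant v" "descend v = q" using descend_surj[of q] by auto
        have Z: "M.Z (constant_cocycle v)"
          using M.cocycle_constant[of v] v(1) by (simp add: simps O3_invariant_def)
        then have "\<Psi> (cls S3 M 0 (constant_cocycle v)) = q"
          using v(2) by (simp add: \<Psi> constant_cocycle_def)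
        then show "q \<in> \<Psi> ` carrier (Ext S3 M 0)" using Z by (auto simp: M.carrier_Ext)
      qed (auto simp: M.carrier_Ext \<Psi> dest!: subsetD[OF keys_descend])
    qed
  qed
  moreover have "\<Psi> (Ext_map S3 M (sl2_act A) 0 x) = gact KP13 A (\<Psi> x)"
    if A: "A \<in> SL2Z" and x: "x \<in> carrier (Ext S3 M 0)" for A x
  proof -
    obtain F where F: "M.Z F" "x = cls S3 M 0 F" using x by (auto simp: M.carrier_Ext)
    have T: "gmod_map S3 M M (sl2_act A)" unfolding M_def by (rule gmod_map_sl2_act[OF A]) simp
    show ?thesis
      using F cocycle_map[OF T F(1)] descend_sl2(2)[OF A inv[OF F(1)]]
      by (simp add: Ext_map_cls[OF M.gmod_axioms T] \<Psi>)
  qed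
  ultimately show ?thesis unfolding M_def by blast
qed

subsection \<open>The decomposition of the module of commuting pairs\<close>

lemma Omega1_disjoint: "O1 \<inter> O2 = {}" "O1 \<inter> O3 = {}" "O2 \<inter> O3 = {}"
  by (auto simp: O1_eq O2_eq O3_eq)

definition restrict_keys :: "'x set \<Rightarrow> ('x \<Rightarrow>\<^sub>0 'k::field) \<Rightarrow> ('x \<Rightarrow>\<^sub>0 'k)" where
  "restrict_keys B = lin pm_scale (\<lambda>x. if x \<in> B then single x 1 else 0)"

lemma lookup_restrict_keys:
  "lookup (restrict_keys B v) x = (if x \<in> B then lookup v x else 0)"
proof -
  have "lookup (restrict_keys B v) x
      = (\<Sum>y\<in>keys v. if y = x then (if x \<in> B then lookup v x else 0) else 0)"
    unfolding restrict_keys_def lin_def lookup_sum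
    by (intro sum.cong) (auto simp: lookup_single when_def)
  then show ?thesis by (simp add: in_keys_iff)
qed

lemma M1_decomposition:
  assumes "v \<in> carrier (M1 Omega1 :: ('k::field, _, _) gmodule)"
  shows "\<exists>!(x, y, z). x \<in> carrier (M1 O1 :: ('k, _, _) gmodule) \<and> y \<in> carrier (M1 O2 :: ('k, _, _) gmodule) \<and>
     z \<in> carrier (M1 O3 :: ('k, _, _) gmodule) \<and> v = x \<oplus>\<^bsub>M1 Omega1\<^esub> y \<oplus>\<^bsub>M1 Omega1\<^esub> z"
proof (rule ex1I[of _ "(restrict_keys O1 v, restrict_keys O2 v, restrict_keys O3 v)"])
  have v: "keys v \<subseteq> O1 \<union> O2 \<union> O3" using assms by (simp add: Omega1_parts)
  have keys: "keys (restrict_keys B v) \<subseteq> B" for B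
    by (auto simp: in_keys_iff lookup_restrict_keys split: if_splits)
  have "v = restrict_keys O1 v + restrict_keys O2 v + restrict_keys O3 v"
  proof (rule poly_mapping_eqI)
    fix w
    have "w \<notin> O1 \<union> O2 \<union> O3 \<Longrightarrow> lookup v w = 0" using v by (auto simp: in_keys_iff)
    then show "lookup v w
        = lookup (restrict_keys O1 v + restrict_keys O2 v + restrict_keys O3 v) w"
      using Omega1_disjoint by (auto simp: lookup_add lookup_restrict_keys)
  qed
  then show "case (restrict_keys O1 v, restrict_keys O2 v, restrict_keys O3 v) of (x, y, z) \<Rightarrow>
      x \<in> carrier (M1 O1 :: ('k, _, _) gmodule) \<and> y \<in> carrier (M1 O2 :: ('k, _, _) gmodule) \<and>
      z \<in> carrier (M1 O3 :: ('k, _, _) gmodule) \<and> v = x \<oplus>\<^bsub>M1 Omega1\<^esub> y \<oplus>\<^bsub>M1 Omega1\<^esub> z"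
    using keys by simp
next
  fix t assume t: "case t of (x, y, z) \<Rightarrow>
      x \<in> carrier (M1 O1 :: ('k, _, _) gmodule) \<and> y \<in> carrier (M1 O2 :: ('k, _, _) gmodule) \<and>
      z \<in> carrier (M1 O3 :: ('k, _, _) gmodule) \<and> v = x \<oplus>\<^bsub>M1 Omega1\<^esub> y \<oplus>\<^bsub>M1 Omega1\<^esub> z"
  obtain x y z where xyz: "t = (x, y, z)" by (cases t)
  have k: "keys x \<subseteq> O1" "keys y \<subseteq> O2" "keys z \<subseteq> O3"
    and v: "v = x + y + z" using t by (simp_all add: xyz)
  have 0: "w \<notin> O1 \<Longrightarrow> lookup x w = 0" "w \<notin> O2 \<Longrightarrow> lookup y w = 0"
    "w \<notin> O3 \<Longrightarrow> lookup z w = 0" for w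
    using k by (auto simp: in_keys_iff)
  have disjoint: "w \<in> O1 \<Longrightarrow> w \<notin> O2 \<and> w \<notin> O3" "w \<in> O2 \<Longrightarrow> w \<notin> O1 \<and> w \<notin> O3"
    "w \<in> O3 \<Longrightarrow> w \<notin> O1 \<and> w \<notin> O2" for w
    using Omega1_disjoint by blast+
  have "x = restrict_keys O1 v"
  proof (rule poly_mapping_eqI)
    fix w
    show "lookup x w = lookup (restrict_keys O1 v) w"
    proof (cases "w \<in> O1")
      case True
      with disjoint(1)[OF True] show ?thesis by (simp add: v lookup_add lookup_restrict_keys 0)
    qed (simp add: lookup_restrict_keys 0)
  qed
  moreover have "y = restrict_keys O2 v"
  proof (rule poly_mapping_eqI)
    fix w
    show "lookup y w = lookup (restrict_keys O2 v) w"
    proof (cases "w \<in> O2")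
      case True
      with disjoint(2)[OF True] show ?thesis by (simp add: v lookup_add lookup_restrict_keys 0)
    qed (simp add: lookup_restrict_keys 0)
  qed
  moreover have "z = restrict_keys O3 v"
  proof (rule poly_mapping_eqI)
    fix w
    show "lookup z w = lookup (restrict_keys O3 v) w"
    proof (cases "w \<in> O3")
      case True
      with disjoint(3)[OF True] show ?thesis by (simp add: v lookup_add lookup_restrict_keys 0)
    qed (simp add: lookup_restrict_keys 0)
  qed
  ultimately show "t = (restrict_keys O1 v, restrict_keys O2 v, restrict_keys O3 v)" by (simp add: xyz)
qed

section \<open>The cohomology of the module of commuting pairs\<close>

lemma action_iso_M1:
  assumes "trace_free S3 (M1 B :: ('k::field, _, _) gmodule) I u p t" "B \<in> {Omega1, O1, O2, O3}"
  shows "action_iso (M1 B :: ('k, _, _) gmodule)"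
proof -
  interpret trace_free S3 "M1 B :: ('k, _, _) gmodule" I u p t by fact
  from action_isomorphism obtain \<Phi> where \<Phi>:
    "linear_iso (tensor_product (Ext S3 (M1 B) 0) HK) (coh S3 (M1 B :: ('k, _, _) gmodule)) \<Phi>"
    "\<And>x h. x \<in> carrier (Ext S3 (M1 B) 0) \<Longrightarrow> h \<in> carrier HK \<Longrightarrow>
       \<Phi> (pure_tensor (Ext S3 (M1 B) 0) HK x h) = coh_act S3 (M1 B) (in_degree (Ext S3 (M1 B)) 0 x) h"
    "\<And>x h h'. x \<in> carrier (Ext S3 (M1 B) 0) \<Longrightarrow> h \<in> carrier HK \<Longrightarrow> h' \<in> carrier HK \<Longrightarrow>
       \<Phi> (pure_tensor (Ext S3 (M1 B) 0) HK x (h \<otimes>\<^bsub>HK\<^esub> h'))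
         = coh_act S3 (M1 B) (\<Phi> (pure_tensor (Ext S3 (M1 B) 0) HK x h)) h'"
    "\<And>T t. gmod_map S3 (M1 B) (M1 B) T \<Longrightarrow> t \<in> carrier (tensor_product (Ext S3 (M1 B) 0) HK) \<Longrightarrow>
       \<Phi> (tensor_map (Ext S3 (M1 B) 0) HK (Ext_map S3 (M1 B) T 0) id t) = coh_map S3 (M1 B) T (\<Phi> t)"
    by blast
  show ?thesis
    unfolding action_iso_def
    by (intro exI[of _ \<Phi>] conjI ballI)
      (rule \<Phi>(1), (rule \<Phi>(2); assumption), (rule \<Phi>(3); assumption),
        (rule \<Phi>(4)[OF gmod_map_sl2_act[OF _ assms(2)]]; assumption))
qed

lemma trace_free_parts:
  assumes "CHAR('k::field) = 2"
  shows "trace_free S3 (M1 O1 :: ('k, _, _) gmodule) {..<1 :: nat} (\<lambda>i. orbit_sum (pair_orbit 3))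
      (\<lambda>i. orbit_coeff (pair_orbit 3)) trace_map"
    and "trace_free S3 (M1 O2 :: ('k, _, _) gmodule) {..<3 :: nat} (\<lambda>i. orbit_sum (pair_orbit i))
      (\<lambda>i. orbit_coeff (pair_orbit i)) trace_map"
proof -
  show "trace_free S3 (M1 O1 :: ('k, _, _) gmodule) {..<1 :: nat} (\<lambda>i. orbit_sum (pair_orbit 3))
      (\<lambda>i. orbit_coeff (pair_orbit 3)) trace_map"
    by (rule trace_free_M1[OF assms conj_stable_parts(2), where j = "\<lambda>_. 3"])
      (simp_all add: O1_orbit lessThan_Suc)
  show "trace_free S3 (M1 O2 :: ('k, _, _) gmodule) {..<3 :: nat} (\<lambda>i. orbit_sum (pair_orbit i))
      (\<lambda>i. orbit_coeff (pair_orbit i)) trace_map"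
    by (rule trace_free_M1[OF assms conj_stable_parts(3), where j = "\<lambda>i. i"])
      (simp_all add: O2_orbits subset_eq)
qed

lemma trace_split_O3:
  assumes "CHAR('k::field) = 2"
  shows "trace_split S3 (M1 O3 :: ('k, _, _) gmodule) ({} :: nat set) (\<lambda>i. orbit_sum (pair_orbit i))
      (\<lambda>i. orbit_coeff (pair_orbit i)) trace_map"
proof (rule trace_split_M1[OF assms conj_stable_parts(4), where j = "\<lambda>i. i"])
  show "pair_orbit i \<inter> O3 = {}" for i
    by (auto simp: pair_orbit_def O3_eq)
qed simp_all

lemma trace_split_Omega1:
  assumes "CHAR('k::field) = 2"
  shows "trace_split S3 (M1 Omega1 :: ('k, _, _) gmodule) {..<4 :: nat} (\<lambda>i. orbit_sum (pair_orbit i))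
      (\<lambda>i. orbit_coeff (pair_orbit i)) trace_map"
  by (rule trace_split_M1[OF assms conj_stable_parts(1), where j = "\<lambda>i. i"])
    (simp_all add: pair_orbit_facts)

theorem theorem7p5:
  assumes "CHAR('k::alg_closed_field) = 2"
  shows
    "(\<forall>v\<in>carrier (M1 Omega1 :: ('k, _, _) gmodule).
        \<exists>!(x, y, z). x \<in> carrier (M1 O1) \<and> y \<in> carrier (M1 O2) \<and> z \<in> carrier (M1 O3) \<and>
          v = x \<oplus>\<^bsub>M1 Omega1\<^esub> y \<oplus>\<^bsub>M1 Omega1\<^esub> z) \<and>
     right_module (coh_ring S3) (coh S3 (M1 Omega1 :: ('k, _, _) gmodule))
       (coh_act S3 (M1 Omega1)) \<and>
     right_generated_by (coh_ring S3) (coh S3 (M1 Omega1 :: ('k, _, _) gmodule))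
       (coh_act S3 (M1 Omega1)) (coh_degree0 S3 (M1 Omega1)) \<and>
     right_free_of_rank (coh_ring S3) (coh S3 (M1 O1 :: ('k, _, _) gmodule))
       (coh_act S3 (M1 O1)) 1 \<and>
     action_iso (M1 O1 :: ('k, _, _) gmodule) \<and>
     right_free_of_rank (coh_ring S3) (coh S3 (M1 O2 :: ('k, _, _) gmodule))
       (coh_act S3 (M1 O2)) 3 \<and>
     action_iso (M1 O2 :: ('k, _, _) gmodule) \<and>
     carrier (coh S3 (M1 O3 :: ('k, _, _) gmodule)) = coh_degree0 S3 (M1 O3) \<and>
     (\<exists>\<Psi>. linear_iso (Ext S3 (M1 O3 :: ('k, _, _) gmodule) 0) KP13 \<Psi> \<and>
       (\<forall>A\<in>SL2Z. \<forall>x\<in>carrier (Ext S3 (M1 O3 :: ('k, _, _) gmodule) 0).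
          \<Psi> (Ext_map S3 (M1 O3) (sl2_act A) 0 x) = gact KP13 A (\<Psi> x))) \<and>
     trivial_coh_module S3 (M1 O3 :: ('k, _, _) gmodule)"
proof (intro conjI)
  interpret O: gmod S3 "M1 Omega1 :: ('k, _, _) gmodule"
    by (rule gmod_M1[OF conj_stable_parts(1)])
  note free = trace_free_parts[OF assms]
  note triv = trace_split_O3[OF assms]
  show "\<forall>v\<in>carrier (M1 Omega1 :: ('k, _, _) gmodule).
        \<exists>!(x, y, z). x \<in> carrier (M1 O1) \<and> y \<in> carrier (M1 O2) \<and> z \<in> carrier (M1 O3) \<and>
          v = x \<oplus>\<^bsub>M1 Omega1\<^esub> y \<oplus>\<^bsub>M1 Omega1\<^esub> z"
    using M1_decomposition by blast
  show "right_module (coh_ring S3) (coh S3 (M1 Omega1 :: ('k, _, _) gmodule)) (coh_act S3 (M1 Omega1))"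
    by (rule O.right_module_coh)
  show "right_generated_by (coh_ring S3) (coh S3 (M1 Omega1 :: ('k, _, _) gmodule))
      (coh_act S3 (M1 Omega1)) (coh_degree0 S3 (M1 Omega1))"
    by (rule trace_split.coh_generated_by_degree0[OF trace_split_Omega1[OF assms]])
  show "right_free_of_rank (coh_ring S3) (coh S3 (M1 O1 :: ('k, _, _) gmodule)) (coh_act S3 (M1 O1)) 1"
    by (rule right_free_of_rank_coh[OF free(1)])
  show "action_iso (M1 O1 :: ('k, _, _) gmodule)"
    by (rule action_iso_M1[OF free(1)]) simp
  show "right_free_of_rank (coh_ring S3) (coh S3 (M1 O2 :: ('k, _, _) gmodule)) (coh_act S3 (M1 O2)) 3"
    by (rule right_free_of_rank_coh[OF free(2)])
  show "action_iso (M1 O2 :: ('k, _, _) gmodule)"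
    by (rule action_iso_M1[OF free(2)]) simp
  show "carrier (coh S3 (M1 O3 :: ('k, _, _) gmodule)) = coh_degree0 S3 (M1 O3)"
    by (rule trace_split.coh_concentrated_in_degree0[OF triv]) simp
  show "\<exists>\<Psi>. linear_iso (Ext S3 (M1 O3 :: ('k, _, _) gmodule) 0) KP13 \<Psi> \<and>
       (\<forall>A\<in>SL2Z. \<forall>x\<in>carrier (Ext S3 (M1 O3 :: ('k, _, _) gmodule) 0).
          \<Psi> (Ext_map S3 (M1 O3) (sl2_act A) 0 x) = gact KP13 A (\<Psi> x))"
    by (rule Ext_O3_iso_KP13)
  show "trivial_coh_module S3 (M1 O3 :: ('k, _, _) gmodule)"
    by (rule trace_split.trivial_coh_module[OF triv]) simp
qed

end
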